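(* For every $\nu\in\mathcal N$, $$\tilde Q^\nu(y)=\tilde R^\nu(y)=\tilde K^\nu(y)/\tilde K^0(y),\qquad Q^\nu(x)=R^\nu(x)=K^\nu(x)/K^0(x).$$
   Context: Let $X_n$ be a finite-dimensional simple Lie algebra over $\mathbb{C}$ of rank $n$ with simple roots $\alpha_1,\dots,\alpha_n$; $(\cdot|\cdot)$ is the standard bilinear form with $(\alpha|\alpha)=2$ for long roots; $t_a=2/(\alpha_a|\alpha_a)\in\{1,2,3\}$. $H=\{(a,m)\mid 1\le a\le n,\ m\in\{1,2,\dots\}\}$; $\mathcal N$ is the set of families $N=(N_m^{(a)})_{(a,m)\in H}$ of nonnegative integers with finitely many nonzero entries. $B_{am,bk}=2\min(t_bm,t_ak)-\min(t_bm,t_a(k+1))-\min(t_bm,t_a(k-1))$. $x_a=e^{\Lambda_a}$ and $y_a=e^{-\alpha_a}$ are formal exponentials of the fundamental weights and negative simple roots, related by $y=y(x)$: $y_a=\prod_{b=1}^nx_b^{-(\alpha_a|\alpha_b)t_b}$. $\mathbb C[[y]]$ has the standard ($y$-adic) topology. $(\tilde Q_m^{(a)}(y))_{(a,m)\in H}$ is the unique family of invertible power series in $\mathbb C[[y]]$ such that, with $\tilde Q_0^{(a)}=1$, $(\tilde Q_m^{(a)})^2=\tilde Q_{m+1}^{(a)}\tilde Q_{m-1}^{(a)}+y_a^m(\tilde Q_m^{(a)})^2\prod_{(b,k)\in H}(\tilde Q_k^{(b)})^{-(\alpha_a|\alpha_b)B_{am,bk}}$ for all $(a,m)\in H$, and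 $\lim_{m\to\infty}\tilde Q_m^{(a)}$ exists in $\mathbb C[[y]]$ for each $a$. $\tilde Q^\nu(y)=\prod_{(a,m)\in H}(\tilde Q_m^{(a)}(y))^{\nu_m^{(a)}}$. $Q_m^{(a)}(x)=x_a^m\tilde Q_m^{(a)}(y(x))$ and $Q^\nu(x)=\prod_{(a,m)\in H}(Q_m^{(a)}(x))^{\nu_m^{(a)}}$. Binomials: $\binom kj=k(k-1)\cdots(k-j+1)/j!$ if $j>0$, $1$ if $j=0$, $0$ if $j<0$. For $\nu,N\in\mathcal N$: $H'=\{(a,m)\in H\mid N_m^{(a)}>0\}$, $\gamma_m^{(a)}=\sum_{k\ge1}\min(m,k)\nu_k^{(a)}$, $P_m^{(a)}=\gamma_m^{(a)}-\sum_{(b,k)\in H}(\alpha_a|\alpha_b)\min(t_bm,t_ak)N_k^{(b)}$, $F_{am,bk}=\delta_{ab}\delta_{mk}P_m^{(a)}+(\alpha_a|\alpha_b)\min(t_bm,t_ak)N_k^{(b)}$, $$R(\nu,N)=\Bigl(\det_{(a,m),(b,k)\in H'}F_{am,bk}\Bigr)\prod_{(a,m)\in H'}\frac1{N_m^{(a)}}\binom{P_m^{(a)}+N_m^{(a)}-1}{N_m^{(a)}-1}\ (N\ne0),\qquad R(\nu,0)=1,$$ $$K(\nu,N)=\prod_{(a,m)\in H}\binom{P_m^{(a)}+N_m^{(a)}}{N_m^{(a)}}.$$ $\tilde R^\nu(y)=\sum_{N\in\mathcal N}R(\nu,N)\prod_ay_a^{\sum_mmN_m^{(a)}}$, $\tilde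 K^\nu(y)=\sum_{N\in\mathcal N}K(\nu,N)\prod_ay_a^{\sum_mmN_m^{(a)}}$; $R^\nu(x)=\bigl(\prod_{(a,m)\in H}x_a^{m\nu_m^{(a)}}\bigr)\tilde R^\nu(y(x))$, $K^\nu(x)=\bigl(\prod_{(a,m)\in H}x_a^{m\nu_m^{(a)}}\bigr)\tilde K^\nu(y(x))$; superscript $0$ means $\nu=0$. *)

theory Defs
  imports Complex_Main "HOL-Combinatorics.Permutations" "HOL-Algebra.Ring"
begin

section \<open>Simple Lie algebras, roots and the standard form\<close>

locale complex_lie_algebra = vector_space scale
  for scale :: "complex \<Rightarrow> 'g::ab_group_add \<Rightarrow> 'g" +
  fixes bracket :: "'g \<Rightarrow> 'g \<Rightarrow> 'g"
  assumes finite_dim: "\<exists>B. finite B \<and> span B = UNIV"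
    and bracket_add_left: "bracket (x + y) z = bracket x z + bracket y z"
    and bracket_add_right: "bracket x (y + z) = bracket x y + bracket x z"
    and bracket_scale_left: "bracket (scale c x) y = scale c (bracket x y)"
    and bracket_scale_right: "bracket x (scale c y) = scale c (bracket x y)"
    and bracket_self: "bracket x x = 0"
    and jacobi: "bracket x (bracket y z) + bracket y (bracket z x) + bracket z (bracket x y) = 0"
begin

definition lie_ideal :: "'g set \<Rightarrow> bool" where
  "lie_ideal I \<longleftrightarrow> subspace I \<and> (\<forall>x. \<forall>y\<in>I. bracket x y \<in> I)"

definition simple_lie :: bool where
  "simple_lie \<longleftrightarrow> (\<exists>x y. bracket x y \<noteq> 0) \<and> (\<forall>I. lie_ideal I \<longrightarrow> I = {0} \<or> I = UNIV)"

text \<open>Cartan subalgebra of a complex semisimple Lie algebra: abelian, equal to its own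
  centralizer, and acting by diagonalizable operators in the adjoint representation.\<close>

definition cartan_subalgebra :: "'g set \<Rightarrow> bool" where
  "cartan_subalgebra \<h> \<longleftrightarrow> subspace \<h>
     \<and> (\<forall>x\<in>\<h>. \<forall>y\<in>\<h>. bracket x y = 0)
     \<and> (\<forall>x. (\<forall>y\<in>\<h>. bracket y x = 0) \<longrightarrow> x \<in> \<h>)
     \<and> (\<forall>x\<in>\<h>. span {v. \<exists>c. bracket x v = scale c v} = UNIV)"

text \<open>Elements of the dual of \<open>\<h>\<close> are represented by functions on the whole algebra of which only
  the values on \<open>\<h>\<close> matter. The eigenvalue equation makes a root linear on \<open>\<h>\<close>.\<close>

definition is_root :: "'g set \<Rightarrow> ('g \<Rightarrow> complex) \<Rightarrow> bool" where
  "is_root \<h> \<phi> \<longleftrightarrow> (\<exists>x\<in>\<h>. \<phi> x \<noteq> 0) \<and> (\<exists>v. v \<noteq> 0 \<and> (\<forall>x\<in>\<h>. bracket x v = scale (\<phi> x) v))"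

definition simple_roots :: "'g set \<Rightarrow> ('n::finite \<Rightarrow> 'g \<Rightarrow> complex) \<Rightarrow> bool" where
  "simple_roots \<h> \<alpha> \<longleftrightarrow>
     (\<forall>a. is_root \<h> (\<alpha> a))
     \<and> (\<forall>c. (\<forall>x\<in>\<h>. (\<Sum>a\<in>UNIV. c a * \<alpha> a x) = 0) \<longrightarrow> (\<forall>a. c a = 0))
     \<and> (\<forall>\<beta>. is_root \<h> \<beta> \<longrightarrow> (\<exists>k :: 'n \<Rightarrow> nat.
            (\<forall>x\<in>\<h>. \<beta> x = (\<Sum>a\<in>UNIV. of_nat (k a) * \<alpha> a x))
          \<or> (\<forall>x\<in>\<h>. \<beta> x = - (\<Sum>a\<in>UNIV. of_nat (k a) * \<alpha> a x))))"

definition invariant_form :: "('g \<Rightarrow> 'g \<Rightarrow> complex) \<Rightarrow> bool" where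
  "invariant_form \<kappa> \<longleftrightarrow>
     (\<forall>x y z. \<kappa> (x + y) z = \<kappa> x z + \<kappa> y z)
     \<and> (\<forall>c x y. \<kappa> (scale c x) y = c * \<kappa> x y)
     \<and> (\<forall>x y. \<kappa> x y = \<kappa> y x)
     \<and> (\<forall>x y z. \<kappa> (bracket x y) z = \<kappa> x (bracket y z))
     \<and> (\<forall>x. (\<forall>y. \<kappa> x y = 0) \<longrightarrow> x = 0)"

text \<open>The form on the dual of \<open>\<h>\<close> induced by \<open>\<kappa>\<close>, through the element of \<open>\<h>\<close> representing a
  functional.\<close>

definition dual_elt :: "'g set \<Rightarrow> ('g \<Rightarrow> 'g \<Rightarrow> complex) \<Rightarrow> ('g \<Rightarrow> complex) \<Rightarrow> 'g" where
  "dual_elt \<h> \<kappa> \<phi> = (THE t. t \<in> \<h> \<and> (\<forall>x\<in>\<h>. \<kappa> t x = \<phi> x))"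

definition dual_form ::
    "'g set \<Rightarrow> ('g \<Rightarrow> 'g \<Rightarrow> complex) \<Rightarrow> ('g \<Rightarrow> complex) \<Rightarrow> ('g \<Rightarrow> complex) \<Rightarrow> complex" where
  "dual_form \<h> \<kappa> \<phi> \<psi> = \<kappa> (dual_elt \<h> \<kappa> \<phi>) (dual_elt \<h> \<kappa> \<psi>)"

text \<open>The standard form: the invariant form for which \<open>(\<beta>|\<beta>)\<close> is real for all roots, with
  maximal value 2, i.e. \<open>(\<beta>|\<beta>) = 2\<close> exactly for the long roots.\<close>

definition standard_form :: "'g set \<Rightarrow> ('g \<Rightarrow> 'g \<Rightarrow> complex) \<Rightarrow> bool" where
  "standard_form \<h> \<kappa> \<longleftrightarrow> invariant_form \<kappa>
     \<and> (\<forall>\<beta>. is_root \<h> \<beta> \<longrightarrow> dual_form \<h> \<kappa> \<beta> \<beta> \<in> \<real> \<and> Re (dual_form \<h> \<kappa> \<beta> \<beta>) \<le> 2)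
     \<and> (\<exists>\<beta>. is_root \<h> \<beta> \<and> dual_form \<h> \<kappa> \<beta> \<beta> = 2)"

end

text \<open>The rank is the number \<open>CARD('n)\<close> of elements of the index type.\<close>

locale simple_lie_data = complex_lie_algebra scale bracket
  for scale :: "complex \<Rightarrow> 'g::ab_group_add \<Rightarrow> 'g" and bracket :: "'g \<Rightarrow> 'g \<Rightarrow> 'g" +
  fixes \<h> :: "'g set"
    and \<kappa> :: "'g \<Rightarrow> 'g \<Rightarrow> complex"
    and \<alpha> :: "'n::finite \<Rightarrow> 'g \<Rightarrow> complex"
  assumes simple: simple_lie
    and cartan: "cartan_subalgebra \<h>"
    and rank: "dim \<h> = card (UNIV :: 'n set)"
    and simple_roots: "simple_roots \<h> \<alpha>"
    and standard_form: "standard_form \<h> \<kappa>"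
begin

text \<open>\<open>(\<alpha>\<^sub>a|\<alpha>\<^sub>b)\<close>, which is a real number.\<close>

definition root_ip :: "'n \<Rightarrow> 'n \<Rightarrow> real" where
  "root_ip a b = Re (dual_form \<h> \<kappa> (\<alpha> a) (\<alpha> b))"

end


section \<open>The ring of formal power series in the variables \<open>y\<^sub>a\<close>\<close>

typedef 'n mfps = "UNIV :: (('n::finite \<Rightarrow> nat) \<Rightarrow> complex) set"
  morphisms mcoeff Abs_mfps ..

setup_lifting type_definition_mfps

lemma finite_exponent_splittings:
  fixes \<beta> :: "'n::finite \<Rightarrow> nat"
  shows "finite {(\<gamma>, \<delta>). \<forall>a. \<gamma> a + \<delta> a = \<beta> a}"
proof -
  have fin: "finite (PiE UNIV (\<lambda>a. {..\<beta> a}))"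
    by (rule finite_PiE) auto
  have "{(\<gamma>, \<delta>). \<forall>a. \<gamma> a + \<delta> a = \<beta> a} \<subseteq> PiE UNIV (\<lambda>a. {..\<beta> a}) \<times> PiE UNIV (\<lambda>a. {..\<beta> a})"
    by (auto simp: PiE_UNIV_domain) (metis le_add1, metis le_add2)
  then show ?thesis
    using fin by (meson finite_SigmaI finite_subset)
qed

instantiation mfps :: (finite) comm_ring_1
begin

lift_definition zero_mfps :: "'a mfps" is "\<lambda>_. 0" .
lift_definition one_mfps :: "'a mfps" is "\<lambda>\<beta>. if \<beta> = (\<lambda>_. 0) then 1 else 0" .
lift_definition plus_mfps :: "'a mfps \<Rightarrow> 'a mfps \<Rightarrow> 'a mfps" is "\<lambda>f g \<beta>. f \<beta> + g \<beta>" .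
lift_definition minus_mfps :: "'a mfps \<Rightarrow> 'a mfps \<Rightarrow> 'a mfps" is "\<lambda>f g \<beta>. f \<beta> - g \<beta>" .
lift_definition uminus_mfps :: "'a mfps \<Rightarrow> 'a mfps" is "\<lambda>f \<beta>. - f \<beta>" .
lift_definition times_mfps :: "'a mfps \<Rightarrow> 'a mfps \<Rightarrow> 'a mfps" is
  "\<lambda>f g \<beta>. \<Sum>(\<gamma>, \<delta>) \<in> {(\<gamma>, \<delta>). \<forall>a. \<gamma> a + \<delta> a = \<beta> a}. f \<gamma> * g \<delta>" .

instance
proof
  fix f g h :: "'a mfps"
  show "f + g + h = f + (g + h)" by transfer (simp add: add.assoc)
  show "f + g = g + f" by transfer (simp add: add.commute)
  show "0 + f = f" by transfer simp
  show "- f + f = 0" by transfer simp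
  show "f - g = f + - g" by transfer simp
  show "(0 :: 'a mfps) \<noteq> 1" by transfer (metis zero_neq_one)
  show "f * g = g * f"
  proof (transfer, rule ext)
    fix f g :: "('a \<Rightarrow> nat) \<Rightarrow> complex" and \<beta> :: "'a \<Rightarrow> nat"
    show "(\<Sum>(\<gamma>, \<delta>) \<in> {(\<gamma>, \<delta>). \<forall>a. \<gamma> a + \<delta> a = \<beta> a}. f \<gamma> * g \<delta>)
        = (\<Sum>(\<gamma>, \<delta>) \<in> {(\<gamma>, \<delta>). \<forall>a. \<gamma> a + \<delta> a = \<beta> a}. g \<gamma> * f \<delta>)"
      by (rule sum.reindex_bij_witness[of _ prod.swap prod.swap]) (auto simp: add.commute)
  qed
  show "(f + g) * h = f * h + g * h"
    by transfer (auto simp: fun_eq_iff distrib_right sum.distrib split_def)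
  show "1 * f = f"
  proof (transfer, rule ext)
    fix f :: "('a \<Rightarrow> nat) \<Rightarrow> complex" and \<beta> :: "'a \<Rightarrow> nat"
    let ?S = "{(\<gamma>, \<delta>). \<forall>a. \<gamma> a + \<delta> a = \<beta> a}"
    have "(\<Sum>(\<gamma>, \<delta>) \<in> ?S. (if \<gamma> = (\<lambda>_. 0) then 1 else 0) * f \<delta>)
        = (\<Sum>(\<gamma>, \<delta>) \<in> {(\<lambda>_ :: 'a. 0 :: nat, \<beta>)}. (if \<gamma> = (\<lambda>_. 0) then 1 else 0) * f \<delta>)"
      by (rule sum.mono_neutral_right[OF finite_exponent_splittings]) (auto split: if_splits)
    then show "(\<Sum>(\<gamma>, \<delta>) \<in> ?S. (if \<gamma> = (\<lambda>_. 0) then 1 else 0) * f \<delta>) = f \<beta>"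
      by simp
  qed
  show "f * g * h = f * (g * h)"
  proof (transfer, rule ext)
    fix f g h :: "('a \<Rightarrow> nat) \<Rightarrow> complex" and \<beta> :: "'a \<Rightarrow> nat"
    let ?S = "\<lambda>\<beta>. {(\<gamma>, \<delta>). \<forall>a :: 'a. \<gamma> a + \<delta> a = (\<beta> a :: nat)}"
    have "(\<Sum>(\<gamma>, \<delta>) \<in> ?S \<beta>. (\<Sum>(\<epsilon>, \<zeta>) \<in> ?S \<gamma>. f \<epsilon> * g \<zeta>) * h \<delta>)
        = (\<Sum>p \<in> ?S \<beta>. \<Sum>q \<in> ?S (fst p). f (fst q) * g (snd q) * h (snd p))"
      by (simp add: split_def sum_distrib_right)
    also have "\<dots> = (\<Sum>(p, q) \<in> Sigma (?S \<beta>) (\<lambda>p. ?S (fst p)). f (fst q) * g (snd q) * h (snd p))"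
      by (rule sum.Sigma) (auto simp: finite_exponent_splittings)
    also have "\<dots> = (\<Sum>(p, q) \<in> Sigma (?S \<beta>) (\<lambda>p. ?S (snd p)). f (fst p) * (g (fst q) * h (snd q)))"
      by (rule sum.reindex_bij_witness[of _
            "\<lambda>(p, q). ((\<lambda>a. fst p a + fst q a, snd q), (fst p, fst q))"
            "\<lambda>(p, q). ((fst q, \<lambda>a. snd q a + snd p a), (snd q, snd p))"])
         (auto simp: fun_eq_iff algebra_simps)
    also have "\<dots> = (\<Sum>p \<in> ?S \<beta>. \<Sum>q \<in> ?S (snd p). f (fst p) * (g (fst q) * h (snd q)))"
      by (rule sum.Sigma[symmetric]) (auto simp: finite_exponent_splittings)
    also have "\<dots> = (\<Sum>(\<gamma>, \<delta>) \<in> ?S \<beta>. f \<gamma> * (\<Sum>(\<epsilon>, \<zeta>) \<in> ?S \<delta>. g \<epsilon> * h \<zeta>))"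
      by (simp add: split_def sum_distrib_left)
    finally show "(\<Sum>(\<gamma>, \<delta>) \<in> ?S \<beta>. (\<Sum>(\<epsilon>, \<zeta>) \<in> ?S \<gamma>. f \<epsilon> * g \<zeta>) * h \<delta>)
        = (\<Sum>(\<gamma>, \<delta>) \<in> ?S \<beta>. f \<gamma> * (\<Sum>(\<epsilon>, \<zeta>) \<in> ?S \<delta>. g \<epsilon> * h \<zeta>))" .
  qed
qed

end

text \<open>As for inverses elsewhere, a non-unit gets the dummy inverse 0.\<close>

instantiation mfps :: (finite) inverse
begin

definition inverse_mfps :: "'a mfps \<Rightarrow> 'a mfps" where
  "inverse_mfps f = (if f dvd 1 then (THE g. f * g = 1) else 0)"

definition divide_mfps :: "'a mfps \<Rightarrow> 'a mfps \<Rightarrow> 'a mfps" where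
  "divide_mfps f g = f * inverse g"

instance ..

end

definition mfps_monom :: "complex \<Rightarrow> ('n::finite \<Rightarrow> nat) \<Rightarrow> 'n mfps" where
  "mfps_monom c \<beta> = Abs_mfps (\<lambda>\<gamma>. if \<gamma> = \<beta> then c else 0)"

definition mfps_var :: "'n::finite \<Rightarrow> 'n mfps" where
  "mfps_var a = mfps_monom 1 (\<lambda>b. if b = a then 1 else 0)"

text \<open>Sum of a family of power series in which each monomial occurs only finitely often.\<close>

definition mfps_sum :: "('i \<Rightarrow> 'n::finite mfps) \<Rightarrow> 'i set \<Rightarrow> 'n mfps" where
  "mfps_sum f I = Abs_mfps (\<lambda>\<beta>. \<Sum>i | i \<in> I \<and> mcoeff (f i) \<beta> \<noteq> 0. mcoeff (f i) \<beta>)"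

definition yadic_tendsto :: "(nat \<Rightarrow> 'n::finite mfps) \<Rightarrow> 'n mfps \<Rightarrow> bool" where
  "yadic_tendsto f L \<longleftrightarrow>
     (\<forall>d. \<exists>M. \<forall>m\<ge>M. \<forall>\<beta>. (\<Sum>a\<in>UNIV. \<beta> a) < d \<longrightarrow> mcoeff (f m) \<beta> = mcoeff L \<beta>)"


section \<open>The canonical solution of the Q-system\<close>

text \<open>From here on \<open>ip a b\<close> stands for \<open>(\<alpha>\<^sub>a|\<alpha>\<^sub>b)\<close>.\<close>

definition tt :: "('n \<Rightarrow> 'n \<Rightarrow> real) \<Rightarrow> 'n \<Rightarrow> real" where
  "tt ip a = 2 / ip a a"

definition HH :: "('n \<times> nat) set" where
  "HH = {(a, m). m \<ge> 1}"

definition families :: "('n \<times> nat \<Rightarrow> nat) set" where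
  "families = {N. finite {h. N h \<noteq> 0} \<and> (\<forall>h. h \<notin> HH \<longrightarrow> N h = 0)}"

definition BB :: "('n \<Rightarrow> 'n \<Rightarrow> real) \<Rightarrow> 'n \<times> nat \<Rightarrow> 'n \<times> nat \<Rightarrow> real" where
  "BB ip = (\<lambda>(a, m) (b, k).
     2 * min (tt ip b * real m) (tt ip a * real k)
     - min (tt ip b * real m) (tt ip a * (real k + 1))
     - min (tt ip b * real m) (tt ip a * (real k - 1)))"

text \<open>\<open>(\<alpha>\<^sub>a|\<alpha>\<^sub>b) B\<^bsub>am,bk\<^esub>\<close>; this real number is an integer, so the floor only converts its type.\<close>

definition ipB :: "('n \<Rightarrow> 'n \<Rightarrow> real) \<Rightarrow> 'n \<times> nat \<Rightarrow> 'n \<times> nat \<Rightarrow> int" where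
  "ipB ip h h' = \<lfloor>ip (fst h) (fst h') * BB ip h h'\<rfloor>"

text \<open>For fixed \<open>(a, m)\<close> only finitely many exponents in the product are nonzero.\<close>

definition canonical_solution ::
    "('n::finite \<Rightarrow> 'n \<Rightarrow> real) \<Rightarrow> ('n \<times> nat \<Rightarrow> 'n mfps) \<Rightarrow> bool" where
  "canonical_solution ip Q \<longleftrightarrow>
     (\<forall>a. Q (a, 0) = 1)
     \<and> (\<forall>h\<in>HH. Q h dvd 1)
     \<and> (\<forall>(a, m)\<in>HH. (Q (a, m))\<^sup>2 = Q (a, m + 1) * Q (a, m - 1)
          + mfps_var a ^ m * (Q (a, m))\<^sup>2
            * (\<Prod>h' | h' \<in> HH \<and> ipB ip (a, m) h' \<noteq> 0. Q h' powi (- ipB ip (a, m) h')))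
     \<and> (\<forall>a. \<exists>L. yadic_tendsto (\<lambda>m. Q (a, m)) L)"

definition Q_tilde :: "('n \<times> nat \<Rightarrow> 'n::finite mfps) \<Rightarrow> ('n \<times> nat \<Rightarrow> nat) \<Rightarrow> 'n mfps" where
  "Q_tilde Q \<nu> = (\<Prod>h | \<nu> h \<noteq> 0. Q h ^ \<nu> h)"


section \<open>The series R and K\<close>

text \<open>The sums and products over \<open>HH\<close> are restricted to the support of the family, outside of
  which the terms are 0 and the factors are 1.\<close>

definition gam :: "('n \<times> nat \<Rightarrow> nat) \<Rightarrow> 'n \<times> nat \<Rightarrow> nat" where
  "gam \<nu> = (\<lambda>(a, m). \<Sum>k | \<nu> (a, k) \<noteq> 0. min m k * \<nu> (a, k))"

definition ip_min :: "('n \<Rightarrow> 'n \<Rightarrow> real) \<Rightarrow> 'n \<times> nat \<Rightarrow> 'n \<times> nat \<Rightarrow> real" where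
  "ip_min ip = (\<lambda>(a, m) (b, k). ip a b * min (tt ip b * real m) (tt ip a * real k))"

definition PP :: "('n \<Rightarrow> 'n \<Rightarrow> real) \<Rightarrow> ('n \<times> nat \<Rightarrow> nat) \<Rightarrow> ('n \<times> nat \<Rightarrow> nat) \<Rightarrow> 'n \<times> nat \<Rightarrow> real" where
  "PP ip \<nu> N h = real (gam \<nu> h) - (\<Sum>h' | N h' \<noteq> 0. ip_min ip h h' * real (N h'))"

definition FF :: "('n \<Rightarrow> 'n \<Rightarrow> real) \<Rightarrow> ('n \<times> nat \<Rightarrow> nat) \<Rightarrow> ('n \<times> nat \<Rightarrow> nat)
    \<Rightarrow> 'n \<times> nat \<Rightarrow> 'n \<times> nat \<Rightarrow> real" where
  "FF ip \<nu> N h h' = (if h = h' then PP ip \<nu> N h else 0) + ip_min ip h h' * real (N h')"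

definition det_on :: "'i set \<Rightarrow> ('i \<Rightarrow> 'i \<Rightarrow> real) \<Rightarrow> real" where
  "det_on S A = (\<Sum>p | p permutes S. of_int (sign p) * (\<Prod>i\<in>S. A i (p i)))"

definition RR :: "('n \<Rightarrow> 'n \<Rightarrow> real) \<Rightarrow> ('n \<times> nat \<Rightarrow> nat) \<Rightarrow> ('n \<times> nat \<Rightarrow> nat) \<Rightarrow> real" where
  "RR ip \<nu> N = (if N = (\<lambda>_. 0) then 1 else
     det_on {h. N h > 0} (FF ip \<nu> N)
     * (\<Prod>h | N h > 0. 1 / real (N h) * ((PP ip \<nu> N h + real (N h) - 1) gchoose (N h - 1))))"

definition KK :: "('n \<Rightarrow> 'n \<Rightarrow> real) \<Rightarrow> ('n \<times> nat \<Rightarrow> nat) \<Rightarrow> ('n \<times> nat \<Rightarrow> nat) \<Rightarrow> real" where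
  "KK ip \<nu> N = (\<Prod>h | N h \<noteq> 0. (PP ip \<nu> N h + real (N h)) gchoose N h)"

definition weight :: "('n \<times> nat \<Rightarrow> nat) \<Rightarrow> 'n \<Rightarrow> nat" where
  "weight N a = (\<Sum>m | N (a, m) \<noteq> 0. m * N (a, m))"

definition R_tilde :: "('n::finite \<Rightarrow> 'n \<Rightarrow> real) \<Rightarrow> ('n \<times> nat \<Rightarrow> nat) \<Rightarrow> 'n mfps" where
  "R_tilde ip \<nu> = mfps_sum (\<lambda>N. mfps_monom (complex_of_real (RR ip \<nu> N)) (weight N)) families"

definition K_tilde :: "('n::finite \<Rightarrow> 'n \<Rightarrow> real) \<Rightarrow> ('n \<times> nat \<Rightarrow> nat) \<Rightarrow> 'n mfps" where
  "K_tilde ip \<nu> = mfps_sum (\<lambda>N. mfps_monom (complex_of_real (KK ip \<nu> N)) (weight N)) families"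


section \<open>Passage to the variables \<open>x\<^sub>a\<close>\<close>

text \<open>The exponent of \<open>x\<^sub>b\<close> in \<open>y\<^sub>a = \<Prod>\<^sub>b x\<^sub>b\<^bsup>-(\<alpha>\<^sub>a|\<alpha>\<^sub>b)t\<^sub>b\<^esup>\<close> is minus a Cartan integer; again the
  floor only converts the type.\<close>

definition y_exp :: "('n \<Rightarrow> 'n \<Rightarrow> real) \<Rightarrow> 'n \<Rightarrow> 'n \<Rightarrow> int" where
  "y_exp ip a b = - \<lfloor>ip a b * tt ip b\<rfloor>"

definition y_mono_exp :: "('n::finite \<Rightarrow> 'n \<Rightarrow> real) \<Rightarrow> ('n \<Rightarrow> nat) \<Rightarrow> 'n \<Rightarrow> int" where
  "y_mono_exp ip \<beta> b = (\<Sum>a\<in>UNIV. int (\<beta> a) * y_exp ip a b)"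

text \<open>The ring of formal series in the formal exponentials
  \<open>x\<^bsup>e\<^esup> = e\<^bsup>\<Sum>e\<^sub>b\<Lambda>\<^sub>b\<^esup>\<close> (a series is given by its coefficients) whose support lies in a
  finite union of cones \<open>\<mu> - \<Sum>\<^sub>a \<nat> \<alpha>\<^sub>a\<close>. These supports make all convolution sums finite.\<close>

definition x_ring :: "('n::finite \<Rightarrow> 'n \<Rightarrow> real) \<Rightarrow> (('n \<Rightarrow> int) \<Rightarrow> complex) ring" where
  "x_ring ip = \<lparr>
     carrier = {f. \<exists>S. finite S \<and> (\<forall>e. f e \<noteq> 0 \<longrightarrow>
                 (\<exists>\<mu>\<in>S. \<exists>\<beta>. e = (\<lambda>b. \<mu> b + y_mono_exp ip \<beta> b)))},
     mult = (\<lambda>f g e. \<Sum>(u, v) | (\<forall>b. u b + v b = e b) \<and> f u \<noteq> 0 \<and> g v \<noteq> 0. f u * g v),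
     one = (\<lambda>e. if e = (\<lambda>_. 0) then 1 else 0),
     zero = (\<lambda>_. 0),
     add = (\<lambda>f g e. f e + g e) \<rparr>"

definition x_monom :: "('n \<Rightarrow> int) \<Rightarrow> ('n \<Rightarrow> int) \<Rightarrow> complex" where
  "x_monom \<mu> e = (if e = \<mu> then 1 else 0)"

text \<open>The substitution \<open>f \<mapsto> f(y(x))\<close>; the exponent map \<open>y_mono_exp\<close> is injective.\<close>

definition y_of_x :: "('n::finite \<Rightarrow> 'n \<Rightarrow> real) \<Rightarrow> 'n mfps \<Rightarrow> ('n \<Rightarrow> int) \<Rightarrow> complex" where
  "y_of_x ip f e = (\<Sum>\<beta> | y_mono_exp ip \<beta> = e. mcoeff f \<beta>)"

definition Q_x1 :: "('n::finite \<Rightarrow> 'n \<Rightarrow> real) \<Rightarrow> ('n \<times> nat \<Rightarrow> 'n mfps)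
    \<Rightarrow> 'n \<times> nat \<Rightarrow> ('n \<Rightarrow> int) \<Rightarrow> complex" where
  "Q_x1 ip Q = (\<lambda>(a, m).
     x_monom (\<lambda>b. if b = a then int m else 0) \<otimes>\<^bsub>x_ring ip\<^esub> y_of_x ip (Q (a, m)))"

definition Q_x :: "('n::finite \<Rightarrow> 'n \<Rightarrow> real) \<Rightarrow> ('n \<times> nat \<Rightarrow> 'n mfps)
    \<Rightarrow> ('n \<times> nat \<Rightarrow> nat) \<Rightarrow> ('n \<Rightarrow> int) \<Rightarrow> complex" where
  "Q_x ip Q \<nu> = (\<Otimes>\<^bsub>x_ring ip\<^esub>h \<in> {h. \<nu> h \<noteq> 0}. Q_x1 ip Q h [^]\<^bsub>x_ring ip\<^esub> \<nu> h)"

text \<open>The prefactor \<open>\<Prod> x\<^sub>a\<^bsup>m \<nu>\<^esup>\<close> over all \<open>(a, m)\<close> is the monomial with exponents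
  \<open>weight \<nu>\<close>.\<close>

definition R_x :: "('n::finite \<Rightarrow> 'n \<Rightarrow> real) \<Rightarrow> ('n \<times> nat \<Rightarrow> nat) \<Rightarrow> ('n \<Rightarrow> int) \<Rightarrow> complex" where
  "R_x ip \<nu> = x_monom (\<lambda>a. int (weight \<nu> a)) \<otimes>\<^bsub>x_ring ip\<^esub> y_of_x ip (R_tilde ip \<nu>)"

definition K_x :: "('n::finite \<Rightarrow> 'n \<Rightarrow> real) \<Rightarrow> ('n \<times> nat \<Rightarrow> nat) \<Rightarrow> ('n \<Rightarrow> int) \<Rightarrow> complex" where
  "K_x ip \<nu> = x_monom (\<lambda>a. int (weight \<nu> a)) \<otimes>\<^bsub>x_ring ip\<^esub> y_of_x ip (K_tilde ip \<nu>)"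

end

theory Submission
  imports Defs "HOL-Library.Function_Algebras"
begin

text \<open>Both \<open>\<nu> \<mapsto> Q\<^sup>\<nu>\<close> and the series \<open>R\<^sup>\<nu>\<close>, \<open>K\<^sup>\<nu>\<close> solve one linear recursion in \<open>\<nu>\<close>, and that recursion
  determines a solution by its value at \<open>\<nu> = 0\<close>.

  Extend \<open>\<nu>\<close> to finitely supported integer families and put
  \<open>c\<^bsub>am\<^esub> = 2 e\<^bsub>am\<^esub> - e\<^bsub>am-1\<^esub> - e\<^bsub>am+1\<^esub>\<close>. Multiplying the equation of the Q-system at \<open>(a, m)\<close> by
  \<open>Q\<close> to the power \<open>\<nu> - 2 e\<^bsub>am\<^esub>\<close> turns it into
  \<open>A(\<nu>) = A(\<nu> - c\<^bsub>am\<^esub>) + y\<^sub>a\<^sup>m A(\<nu> - b\<^bsub>am\<^esub>)\<close> for \<open>A(\<nu>) = Q\<^sup>\<nu>\<close>, where \<open>b\<^bsub>am\<^esub>\<close> is the row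
  \<open>(\<alpha>\<^sub>a|\<alpha>\<^sub>b) B\<close> of exponents (\<open>Q_power_recursion\<close>). The
  numbers \<open>\<gamma>\<close> depend linearly on \<open>\<nu>\<close>, subtracting \<open>c\<^bsub>am\<^esub>\<close> lowers \<open>\<gamma>\<close> by one at \<open>(a, m)\<close> only, and subtracting \<open>b\<^bsub>am\<^esub>\<close>
  takes away from it the row \<open>(\<alpha>\<^sub>a|\<alpha>\<^sub>b) min(t\<^sub>b m, t\<^sub>a k)\<close>. For \<open>K\<^sup>\<nu>\<close> the recursion is therefore, coefficient by
  coefficient, the rule of Pascal's triangle in the single binomial at \<open>(a, m)\<close>: lowering \<open>N\<close> by one
  at \<open>(a, m)\<close> together with this change of \<open>\<gamma>\<close> leaves all vacancy numbers \<open>P\<close> fixed (\<open>P_vac_remove\<close>, \<open>K_coeff_pascal\<close>). For \<open>R\<^sup>\<nu>\<close> one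
  first expands the determinant along its diagonal part, which writes \<open>R(\<nu>, N)\<close> as a
  linear combination, with principal minors as coefficients that do not depend on \<open>\<nu>\<close> and \<open>N\<close>, of products of
  binomials each obeying Pascal's rule (\<open>R_coeff_eq\<close>, \<open>R_coeff_pascal\<close>).

  Uniqueness (\<open>q_recursion_unique\<close>) is an induction on the degree in \<open>y\<close>: if all \<open>A(\<nu>)\<close>
  vanish below degree \<open>d\<close>, then in degree \<open>d\<close> the second term of the recursion drops out, \<open>A\<close> becomes
  invariant under all \<open>c\<^bsub>am\<^esub>\<close>, and the convergence condition adds invariance under
  \<open>e\<^bsub>am+1\<^esub> - e\<^bsub>am\<^esub>\<close> for large \<open>m\<close>; together these translations generate everything, so \<open>A(\<nu>) = A(0) = 0\<close>.
  Applied to the difference of \<open>A(\<nu>)\<close> and \<open>Q\<^sup>\<nu> A(0)\<close> this gives \<open>R\<^sup>\<nu> = Q\<^sup>\<nu> R\<^sup>0\<close> and \<open>K\<^sup>\<nu> = Q\<^sup>\<nu> K\<^sup>0\<close>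
  (\<open>pascal_series_eq_Q_power\<close>).
  Finally \<open>R\<^sup>0 = 1\<close>, because for \<open>\<nu> = 0\<close> the rows of the matrix \<open>F\<close> sum to zero, and \<open>K\<^sup>0\<close>
  has constant term 1.

  The Lie algebra enters only through its Gram matrix \<open>(\<alpha>\<^sub>a|\<alpha>\<^sub>b)\<close>, of which four properties are needed:
  it is symmetric, has positive diagonal and integral Cartan numbers, and is nondegenerate. The first part
  derives them from the definition of a simple Lie algebra. The last part transfers the identities to the
  variables \<open>x\<^sub>a\<close>: as the Gram matrix is nondegenerate, \<open>f \<mapsto> f(y(x))\<close> is an injective homomorphism into
  the multiplicative monoid of series in the \<open>x\<^sub>a\<close>, and the prefactors are monomials, which multiply by addition of
  exponents.
\<close>

section \<open>Weight spaces of commuting diagonalizable operators\<close>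

context complex_lie_algebra
begin

lemma bracket_zero_left [simp]: "bracket 0 x = 0"
  using bracket_add_left[of 0 0 x] by simp

lemma bracket_zero_right [simp]: "bracket x 0 = 0"
  using bracket_add_right[of x 0 0] by simp

lemma bracket_anticomm: "bracket x y = - bracket y x"
proof -
  have "bracket x y + bracket y x = 0"
    using bracket_self[of "x + y"] by (simp add: bracket_add_left bracket_add_right bracket_self[of x] bracket_self[of y] add.commute)
  then show ?thesis
    by (simp add: eq_neg_iff_add_eq_0)
qed

lemma bracket_minus_right: "bracket x (- y) = - bracket x y"
  using bracket_add_right[of x y "- y"] by (simp add: eq_neg_iff_add_eq_0 add.commute)

lemma bracket_diff_right: "bracket x (y - z) = bracket x y - bracket x z"
  using bracket_add_right[of x y "- z"] by (simp add: bracket_minus_right)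

lemma bracket_sum_right: "bracket x (\<Sum>i\<in>I. f i) = (\<Sum>i\<in>I. bracket x (f i))"
  by (induction I rule: infinite_finite_induct) (auto simp: bracket_add_right)

lemma bracket_derivation: "bracket x (bracket y z) = bracket (bracket x y) z + bracket y (bracket x z)"
proof -
  have "bracket x (bracket y z) + (bracket y (bracket z x) + bracket z (bracket x y)) = 0"
    using jacobi[of x y z] by (simp add: add.assoc)
  moreover have "bracket y (bracket z x) = - bracket y (bracket x z)"
    using bracket_anticomm[of z x] by (simp add: bracket_minus_right)
  moreover have "bracket z (bracket x y) = - bracket (bracket x y) z"
    by (rule bracket_anticomm)
  ultimately show ?thesis
    by (simp add: eq_neg_iff_add_eq_0[symmetric] add.commute)
qed

lemma finite_independent:
  assumes "independent S"
  shows "finite S"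
proof -
  obtain B where "finite B" "span B = UNIV"
    using finite_dim by blast
  then show ?thesis
    using independent_span_bound[of B S] assms by simp
qed

text \<open>The set \<open>X\<close> of acting elements is a parameter, because the simultaneous diagonalization of a Cartan
  subalgebra passes through one element and through finite sets. Only the values of \<open>\<phi>\<close> on \<open>X\<close> matter.\<close>

definition weight_space :: "'g set \<Rightarrow> ('g \<Rightarrow> complex) \<Rightarrow> 'g set" where
  "weight_space X \<phi> = {v. \<forall>x\<in>X. bracket x v = scale (\<phi> x) v}"

lemma weight_space_0 [simp]: "0 \<in> weight_space X \<phi>"
  by (simp add: weight_space_def)

lemma weight_space_scale: "v \<in> weight_space X \<phi> \<Longrightarrow> scale c v \<in> weight_space X \<phi>"
  by (simp add: weight_space_def bracket_scale_right scale_left_commute)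

text \<open>An element of \<open>X\<close> that separates two of the weights kills one summand and rescales the others, so a
  shorter relation remains.\<close>

lemma weight_vectors_sum_eq_0:
  assumes "finite I" "\<And>i. i \<in> I \<Longrightarrow> v i \<in> weight_space X (\<phi> i)"
    and "\<And>i j. i \<in> I \<Longrightarrow> j \<in> I \<Longrightarrow> i \<noteq> j \<Longrightarrow> \<exists>x\<in>X. \<phi> i x \<noteq> \<phi> j x"
    and "(\<Sum>i\<in>I. v i) = 0" "i \<in> I"
  shows "v i = 0"
  using assms
proof (induction I arbitrary: v i rule: finite_induct)
  case (insert j I)
  have zero: "v k = 0" if k: "k \<in> I" for k
  proof -
    have "k \<noteq> j"
      using k insert.hyps(2) by metis
    then obtain x where x: "x \<in> X" "\<phi> k x \<noteq> \<phi> j x"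
      using insert.prems(2)[of k j] k by blast
    have "0 = bracket x (\<Sum>i\<in>insert j I. v i) - scale (\<phi> j x) (\<Sum>i\<in>insert j I. v i)"
      using insert.prems(3) by simp
    also have "\<dots> = (\<Sum>i\<in>insert j I. bracket x (v i) - scale (\<phi> j x) (v i))"
      by (simp add: bracket_sum_right scale_sum_right sum_subtractf del: sum.insert)
    also have "\<dots> = (\<Sum>i\<in>insert j I. scale (\<phi> i x - \<phi> j x) (v i))"
    proof (rule sum.cong)
      fix i assume "i \<in> insert j I"
      then have "bracket x (v i) = scale (\<phi> i x) (v i)"
        using insert.prems(1)[of i] x by (auto simp: weight_space_def)
      then show "bracket x (v i) - scale (\<phi> j x) (v i) = scale (\<phi> i x - \<phi> j x) (v i)"
        by (simp add: scale_left_diff_distrib)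
    qed simp
    also have "\<dots> = (\<Sum>i\<in>I. scale (\<phi> i x - \<phi> j x) (v i))"
      using insert.hyps by simp
    finally have "(\<Sum>i\<in>I. scale (\<phi> i x - \<phi> j x) (v i)) = 0" ..
    then have "scale (\<phi> k x - \<phi> j x) (v k) = 0"
      by (intro insert.IH[of "\<lambda>i. scale (\<phi> i x - \<phi> j x) (v i)"])
         (use insert.prems k in \<open>auto intro: weight_space_scale\<close>)
    then show ?thesis
      using x by simp
  qed
  have "v j = 0"
    using insert.prems(3) insert.hyps zero by simp
  then show ?case
    using zero insert.prems(4) by auto
qed simp

lemma eigenvector_expansion:
  assumes "v \<in> span {w. \<exists>c. bracket x w = scale c w}"
  shows "\<exists>C w. finite C \<and> v = (\<Sum>c\<in>C. w c) \<and> (\<forall>c. bracket x (w c) = scale c (w c))"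
  using assms
proof (induction rule: span_induct_alt)
  case base
  show ?case
    by (rule exI[of _ "{}"], rule exI[of _ "\<lambda>_. 0"]) simp
next
  case (step a u y)
  then obtain C w d where C: "finite C" "y = (\<Sum>c\<in>C. w c)" "\<forall>c. bracket x (w c) = scale c (w c)"
    and d: "bracket x u = scale d u" by blast
  define w0 where "w0 c = (if c \<in> C then w c else 0)" for c
  define w1 where "w1 c = (if c = d then w0 d + scale a u else w0 c)" for c
  have "(\<Sum>c\<in>insert d C. w1 c) = w0 d + scale a u + (\<Sum>c\<in>C - {d}. w0 c)"
  proof -
    have "(\<Sum>c\<in>C - {d}. w1 c) = (\<Sum>c\<in>C - {d}. w0 c)"
      by (rule sum.cong) (auto simp: w1_def)
    moreover have "w1 d = w0 d + scale a u" by (simp add: w1_def)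
    ultimately show ?thesis
      by (simp only: sum.insert_remove[OF C(1), of w1 d])
  qed
  also have "\<dots> = scale a u + (\<Sum>c\<in>insert d C. w0 c)"
    by (simp only: sum.insert_remove[OF C(1), of w0 d] add.assoc add.left_commute)
  also have "(\<Sum>c\<in>insert d C. w0 c) = (\<Sum>c\<in>C. w c)"
    using C(1) by (intro sum.mono_neutral_cong_right) (auto simp: w0_def)
  finally have "scale a u + y = (\<Sum>c\<in>insert d C. w1 c)"
    using C(2) by simp
  moreover have "bracket x (w1 c) = scale c (w1 c)" for c
    using C(3) d by (simp add: w1_def w0_def bracket_add_right bracket_scale_right scale_right_distrib
        scale_left_commute)
  ultimately show ?case
    using C(1) by (intro exI[of _ "insert d C"] exI[of _ w1]) simp
qed

lemma bracket_weight:
  assumes "u \<in> weight_space X \<phi>" "v \<in> weight_space X \<psi>"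
  shows "bracket u v \<in> weight_space X (\<lambda>x. \<phi> x + \<psi> x)"
  using assms
  by (simp add: weight_space_def bracket_derivation[of _ u v] bracket_scale_left bracket_scale_right
      scale_left_distrib)

text \<open>The components of a common eigenvector \<open>v\<close> of \<open>S\<close> with respect to a further operator \<open>x\<close> are
  again eigenvectors of \<open>S\<close>, with the eigenvalues of \<open>v\<close>: for \<open>s \<in> S\<close> the elements \<open>[s, w\<^sub>c] - \<phi>(s) w\<^sub>c\<close>
  lie in different eigenspaces of \<open>x\<close>, as \<open>s\<close> and \<open>x\<close> commute, and sum to zero.\<close>

lemma common_eigenvectors_span:
  assumes fin: "finite S" and comm: "\<And>x y. x \<in> S \<Longrightarrow> y \<in> S \<Longrightarrow> bracket x y = 0"
    and diag: "\<And>x. x \<in> S \<Longrightarrow> span {v. \<exists>c. bracket x v = scale c v} = UNIV"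
  shows "span {v. \<exists>\<phi>. v \<in> weight_space S \<phi>} = UNIV"
  using assms
proof (induction S rule: finite_induct)
  case empty
  show ?case by (simp add: weight_space_def)
next
  case (insert x S)
  have "v \<in> span {v. \<exists>\<phi>. v \<in> weight_space (insert x S) \<phi>}" if v: "v \<in> weight_space S \<phi>" for v \<phi>
  proof -
    have "v \<in> span {w. \<exists>c. bracket x w = scale c w}"
      using insert.prems(2)[of x] by simp
    then obtain C w where C: "finite C" "v = (\<Sum>c\<in>C. w c)" and w: "\<And>c. bracket x (w c) = scale c (w c)"
      using eigenvector_expansion by metis
    have wS: "bracket s (w c) = scale (\<phi> s) (w c)" if s: "s \<in> S" and c: "c \<in> C" for s c
    proof -
      have xs: "bracket x s = 0"
        using insert.prems(1)[of x s] s by simp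
      have "bracket s (w c) - scale (\<phi> s) (w c) = 0"
      proof (rule weight_vectors_sum_eq_0[of C "\<lambda>c. bracket s (w c) - scale (\<phi> s) (w c)" "{x}" "\<lambda>c _. c"])
        show "bracket s (w c) - scale (\<phi> s) (w c) \<in> weight_space {x} (\<lambda>_. c)" for c
          by (simp add: weight_space_def bracket_diff_right bracket_derivation[of x s] xs w
              bracket_scale_right scale_right_diff_distrib scale_left_commute)
        have "bracket s v = scale (\<phi> s) v"
          using v s by (simp add: weight_space_def)
        then show "(\<Sum>c\<in>C. bracket s (w c) - scale (\<phi> s) (w c)) = 0"
          unfolding C(2) by (simp add: bracket_sum_right scale_sum_right sum_subtractf)
      qed (use C c in auto)
      then show ?thesis by simp
    qed
    have "w c \<in> weight_space (insert x S) (\<phi>(x := c))" if "c \<in> C" for c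
      using w wS[OF _ that] insert.hyps by (auto simp: weight_space_def)
    then have "w c \<in> span {v. \<exists>\<phi>. v \<in> weight_space (insert x S) \<phi>}" if "c \<in> C" for c
      using that by (intro span_base) blast
    then show ?thesis
      unfolding C(2) by (rule span_sum)
  qed
  then have "{v. \<exists>\<phi>. v \<in> weight_space S \<phi>} \<subseteq> span {v. \<exists>\<phi>. v \<in> weight_space (insert x S) \<phi>}"
    by blast
  then have "span {v. \<exists>\<phi>. v \<in> weight_space S \<phi>} \<subseteq> span {v. \<exists>\<phi>. v \<in> weight_space (insert x S) \<phi>}"
    by (rule span_minimal[OF _ subspace_span])
  then show ?case
    using insert.IH insert.prems by auto
qed

end

context simple_lie_data
begin

lemma h_subspace: "subspace \<h>" and h_abelian: "x \<in> \<h> \<Longrightarrow> y \<in> \<h> \<Longrightarrow> bracket x y = 0"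
  and h_centralizer: "(\<And>y. y \<in> \<h> \<Longrightarrow> bracket y x = 0) \<Longrightarrow> x \<in> \<h>"
  and h_diagonalizable: "x \<in> \<h> \<Longrightarrow> span {v. \<exists>c. bracket x v = scale c v} = UNIV"
  using cartan by (auto simp: cartan_subalgebra_def)

abbreviation wt where "wt \<equiv> weight_space \<h>"

text \<open>A common eigenvector of a basis of \<open>\<h>\<close> is an eigenvector of all of \<open>\<h>\<close>.\<close>

lemma weight_vectors_span: "span {v. \<exists>\<phi>. v \<in> wt \<phi>} = UNIV"
proof -
  obtain S where S: "S \<subseteq> \<h>" "independent S" "\<h> \<subseteq> span S"
    using maximal_independent_subset[of \<h>] by blast
  have finS: "finite S"
    using S(2) by (rule finite_independent)
  have "v \<in> wt (\<lambda>x. SOME c. bracket x v = scale c v)" if v: "v \<in> weight_space S \<phi>" for v \<phi>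
  proof -
    have "\<exists>c. bracket x v = scale c v" if "x \<in> \<h>" for x
    proof -
      have "x \<in> span S" using S(3) that by auto
      then show ?thesis
      proof (induction rule: span_induct_alt)
        case base
        show ?case by (rule exI[of _ 0]) simp
      next
        case (step a y z)
        then obtain c where "bracket z v = scale c v" by blast
        moreover have "bracket y v = scale (\<phi> y) v"
          using v step by (simp add: weight_space_def)
        ultimately show ?case
          by (intro exI[of _ "a * \<phi> y + c"]) (simp add: bracket_add_left bracket_scale_left scale_left_distrib)
      qed
    qed
    then show ?thesis
      unfolding weight_space_def by (auto intro: someI_ex)
  qed
  then have "{v. \<exists>\<phi>. v \<in> weight_space S \<phi>} \<subseteq> {v. \<exists>\<phi>. v \<in> wt \<phi>}"
    by blast
  then have "span {v. \<exists>\<phi>. v \<in> weight_space S \<phi>} \<subseteq> span {v. \<exists>\<phi>. v \<in> wt \<phi>}"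
    by (rule span_mono)
  moreover have "span {v. \<exists>\<phi>. v \<in> weight_space S \<phi>} = UNIV"
    by (rule common_eigenvectors_span[OF finS]) (use S h_abelian h_diagonalizable in blast)+
  ultimately show ?thesis by auto
qed

lemma form_add_left: "\<kappa> (x + y) z = \<kappa> x z + \<kappa> y z"
  and form_scale_left: "\<kappa> (scale c x) y = c * \<kappa> x y"
  and form_sym: "\<kappa> x y = \<kappa> y x"
  and form_invariant: "\<kappa> (bracket x y) z = \<kappa> x (bracket y z)"
  and form_nondegenerate: "(\<And>y. \<kappa> x y = 0) \<Longrightarrow> x = 0"
  using standard_form unfolding standard_form_def invariant_form_def by blast+

lemma form_add_right: "\<kappa> z (x + y) = \<kappa> z x + \<kappa> z y"
  and form_scale_right: "\<kappa> y (scale c x) = c * \<kappa> y x"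
  using form_add_left form_scale_left form_sym by metis+

lemma form_zero_left [simp]: "\<kappa> 0 y = 0"
  using form_scale_left[of 0 0 y] by simp

lemma form_zero_right [simp]: "\<kappa> y 0 = 0"
  using form_sym[of y 0] by simp

text \<open>The form in which the root space decomposition is used below: a linear statement need only be checked on weight
  vectors.\<close>

lemma linear_eq_0_by_weights:
  assumes "\<And>\<phi> v. v \<in> wt \<phi> \<Longrightarrow> f v = 0"
    and "\<And>x y. f (x + y) = f x + f y" "\<And>c x. f x = 0 \<Longrightarrow> f (scale c x) = 0"
  shows "f x = (0 :: 'b::ab_group_add)"
proof -
  have "x \<in> span {v. \<exists>\<phi>. v \<in> wt \<phi>}"
    using weight_vectors_span by simp
  then show ?thesis
  proof (induction rule: span_induct_alt)
    case base
    show ?case using assms(2)[of 0 0] by simp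
  qed (use assms in auto)
qed

lemma form_weights_orthogonal:
  assumes "u \<in> wt \<phi>" "v \<in> wt \<psi>" "x \<in> \<h>" "\<phi> x + \<psi> x \<noteq> 0"
  shows "\<kappa> u v = 0"
proof -
  have "\<phi> x * \<kappa> u v = \<kappa> (bracket x u) v"
    using assms by (simp add: weight_space_def form_scale_left)
  also have "\<dots> = - \<kappa> (bracket u x) v"
    using bracket_anticomm[of x u] form_scale_left[of "-1" "bracket u x" v] by simp
  also have "\<dots> = - \<kappa> u (bracket x v)"
    by (simp add: form_invariant)
  also have "\<dots> = - \<psi> x * \<kappa> u v"
    using assms by (simp add: weight_space_def form_scale_right)
  finally have "(\<phi> x + \<psi> x) * \<kappa> u v = 0"
    by (simp add: algebra_simps)
  then show ?thesis using assms by simp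
qed

lemma wt_cong: "(\<And>x. x \<in> \<h> \<Longrightarrow> \<phi> x = \<psi> x) \<Longrightarrow> wt \<phi> = wt \<psi>"
  by (auto simp: weight_space_def)

lemma wt_0_eq: "(\<And>x. x \<in> \<h> \<Longrightarrow> \<phi> x = 0) \<Longrightarrow> wt \<phi> = \<h>"
  by (auto simp: weight_space_def h_abelian intro: h_centralizer)

text \<open>Weight spaces of weights that do not cancel are orthogonal, so nondegeneracy of the form must be witnessed
  in the opposite weight space.\<close>

lemma opposite_weight_vector:
  assumes "u \<in> wt \<phi>" "u \<noteq> 0"
  obtains v where "v \<in> wt (\<lambda>x. - \<phi> x)" "\<kappa> u v = 1"
proof -
  obtain \<psi> w where w: "w \<in> wt \<psi>" "\<kappa> u w \<noteq> 0"
  proof (rule ccontr)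
    assume no: "\<not> thesis"
    have "\<kappa> u y = 0" for y
      by (rule linear_eq_0_by_weights[of "\<kappa> u"]) (use no that in \<open>auto simp: form_add_right form_scale_right\<close>)
    then show False
      using form_nondegenerate assms by blast
  qed
  have "wt \<psi> = wt (\<lambda>x. - \<phi> x)"
    by (rule wt_cong) (use form_weights_orthogonal[OF assms(1) w(1)] w(2) in \<open>auto simp: eq_neg_iff_add_eq_0 add.commute\<close>)
  then show ?thesis
    using that[of "scale (1 / \<kappa> u w) w"] w weight_space_scale by (simp add: form_scale_right)
qed

lemma form_h_nondegenerate:
  assumes "x \<in> \<h>" "\<And>y. y \<in> \<h> \<Longrightarrow> \<kappa> x y = 0"
  shows "x = 0"
proof (rule ccontr)
  assume "x \<noteq> 0"
  have "x \<in> wt (\<lambda>_. 0)" using wt_0_eq assms(1) by simp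
  then obtain v where "v \<in> wt (\<lambda>_. - 0)" "\<kappa> x v = 1"
    using \<open>x \<noteq> 0\<close> by (rule opposite_weight_vector)
  then show False
    using assms(2)[of v] wt_0_eq[of "\<lambda>_. 0"] by simp
qed

abbreviation dual where "dual \<equiv> dual_elt \<h> \<kappa>"
abbreviation pair where "pair \<equiv> dual_form \<h> \<kappa>"

lemma h_unique:
  assumes "s \<in> \<h>" "t \<in> \<h>" "\<And>x. x \<in> \<h> \<Longrightarrow> \<kappa> s x = \<kappa> t x"
  shows "s = t"
proof -
  have "\<kappa> (s + scale (-1) t) x = 0" if "x \<in> \<h>" for x
    using assms(3)[OF that] by (simp only: form_add_left form_scale_left) simp
  moreover have "s + scale (-1) t \<in> \<h>"
    using assms h_subspace subspace_add subspace_scale by blast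
  ultimately have "s + scale (-1) t = 0"
    using form_h_nondegenerate by blast
  then show ?thesis by simp
qed

lemma dual_eqI:
  assumes "t \<in> \<h>" "\<And>x. x \<in> \<h> \<Longrightarrow> \<kappa> t x = \<phi> x"
  shows "dual \<phi> = t"
  unfolding dual_elt_def by (rule the_equality) (use assms h_unique in auto)

text \<open>Thus the element of \<open>\<h>\<close> that represents a root \<open>\<beta>\<close> is the bracket of two opposite root vectors, normalized
  by \<open>\<kappa>(e, f) = 1\<close>.\<close>

lemma root_pair_bracket:
  assumes "e \<in> wt \<beta>" "f \<in> wt (\<lambda>x. - \<beta> x)"
  shows "bracket e f \<in> \<h>" "x \<in> \<h> \<Longrightarrow> \<kappa> (bracket e f) x = \<beta> x * \<kappa> e f"
proof -
  show "bracket e f \<in> \<h>"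
    using bracket_weight[OF assms] wt_0_eq[of "\<lambda>x. \<beta> x + - \<beta> x"] by simp
  assume x: "x \<in> \<h>"
  have "\<kappa> (bracket e f) x = \<kappa> e (bracket f x)"
    by (rule form_invariant)
  also have "bracket f x = scale (\<beta> x) f"
    using assms(2) x bracket_anticomm[of f x] by (simp add: weight_space_def)
  finally show "\<kappa> (bracket e f) x = \<beta> x * \<kappa> e f"
    by (simp add: form_scale_right)
qed

lemma is_root_iff: "is_root \<h> \<phi> \<longleftrightarrow> (\<exists>x\<in>\<h>. \<phi> x \<noteq> 0) \<and> (\<exists>v. v \<noteq> 0 \<and> v \<in> wt \<phi>)"
  by (auto simp: is_root_def weight_space_def)

lemma root_triple:
  assumes "is_root \<h> \<beta>"
  obtains e f where "e \<in> wt \<beta>" "f \<in> wt (\<lambda>x. - \<beta> x)" "e \<noteq> 0" "\<kappa> e f = 1" "bracket e f = dual \<beta>"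
    "dual \<beta> \<in> \<h>" "\<And>x. x \<in> \<h> \<Longrightarrow> \<kappa> (dual \<beta>) x = \<beta> x"
proof -
  obtain e where e: "e \<noteq> 0" "e \<in> wt \<beta>" using assms by (auto simp: is_root_iff)
  then obtain f where f: "f \<in> wt (\<lambda>x. - \<beta> x)" "\<kappa> e f = 1"
    using opposite_weight_vector by blast
  have "dual \<beta> = bracket e f"
    by (rule dual_eqI) (use root_pair_bracket[OF e(2) f(1)] f(2) in auto)
  then show ?thesis
    using that[OF e(2) f(1) e(1) f(2)] root_pair_bracket[OF e(2) f(1)] f(2) by simp
qed

lemma dual_in_h: "is_root \<h> \<beta> \<Longrightarrow> dual \<beta> \<in> \<h>"
  and form_dual: "is_root \<h> \<beta> \<Longrightarrow> x \<in> \<h> \<Longrightarrow> \<kappa> (dual \<beta>) x = \<beta> x"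
  by (erule root_triple, blast)+

lemma pair_eq: "is_root \<h> \<beta> \<Longrightarrow> is_root \<h> \<gamma> \<Longrightarrow> pair \<beta> \<gamma> = \<beta> (dual \<gamma>)"
  by (simp add: dual_form_def form_dual dual_in_h)

lemma pair_sym: "pair \<beta> \<gamma> = pair \<gamma> \<beta>"
  by (simp add: dual_form_def form_sym)

lemma root_cong: "is_root \<h> \<beta> \<Longrightarrow> (\<And>x. x \<in> \<h> \<Longrightarrow> \<beta> x = \<gamma> x) \<Longrightarrow> is_root \<h> \<gamma>"
  by (metis is_root_def)

lemma root_uminus:
  assumes "is_root \<h> \<beta>"
  shows "is_root \<h> (\<lambda>x. - \<beta> x)"
proof -
  obtain e f where "f \<in> wt (\<lambda>x. - \<beta> x)" "\<kappa> e f = 1"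
    using root_triple[OF assms] by metis
  moreover from this have "f \<noteq> 0" by auto
  ultimately show ?thesis
    using assms by (auto simp: is_root_iff)
qed

text \<open>A weight is a function on the whole algebra of which only the values on \<open>\<h>\<close> matter; finiteness holds for the
  representatives that vanish off \<open>\<h>\<close>. One nonzero vector from each weight space gives an independent
  family.\<close>

lemma finite_weights: "finite {\<phi>. (\<forall>x. x \<notin> \<h> \<longrightarrow> \<phi> x = 0) \<and> wt \<phi> \<noteq> {0}}" (is "finite ?W")
proof -
  define v where "v \<phi> = (SOME v. v \<in> wt \<phi> \<and> v \<noteq> 0)" for \<phi>
  have v: "v \<phi> \<in> wt \<phi> \<and> v \<phi> \<noteq> 0" if "\<phi> \<in> ?W" for \<phi>
  proof -
    have "\<exists>v. v \<in> wt \<phi> \<and> v \<noteq> 0"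
      using that weight_space_0[of \<h> \<phi>] by auto
    then show ?thesis
      unfolding v_def by (rule someI_ex)
  qed
  have dist: "\<exists>x\<in>\<h>. \<phi> x \<noteq> \<psi> x" if "\<phi> \<in> ?W" "\<psi> \<in> ?W" "\<phi> \<noteq> \<psi>" for \<phi> \<psi>
  proof (rule ccontr)
    assume "\<not> ?thesis"
    then have "\<phi> x = \<psi> x" for x
      using that(1,2) by (cases "x \<in> \<h>") auto
    then show False using that(3) by blast
  qed
  have inj: "inj_on v ?W"
  proof (rule inj_onI, rule ccontr)
    fix \<phi> \<psi> assume a: "\<phi> \<in> ?W" "\<psi> \<in> ?W" "v \<phi> = v \<psi>" "\<phi> \<noteq> \<psi>"
    obtain x where "x \<in> \<h>" "\<phi> x \<noteq> \<psi> x" using dist a by blast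
    then show False
      using v[OF a(1)] v[OF a(2)] a(3) by (auto simp: weight_space_def)
  qed
  have "independent (v ` ?W)"
    unfolding independent_explicit_module
  proof (intro allI impI)
    fix T u w assume T: "finite T" "T \<subseteq> v ` ?W" "(\<Sum>w\<in>T. scale (u w) w) = 0" "w \<in> T"
    obtain I where I: "I \<subseteq> ?W" "T = v ` I" using T(2) unfolding subset_image_iff by blast
    have injI: "inj_on v I" using inj I(1) by (rule inj_on_subset)
    obtain i where i: "i \<in> I" "w = v i" using T(4) I by blast
    have "scale (u (v i)) (v i) = 0"
    proof (rule weight_vectors_sum_eq_0[of I "\<lambda>i. scale (u (v i)) (v i)" \<h> "\<lambda>i. i"])
      show "finite I" using T(1) I injI by (simp add: finite_image_iff)
      show "(\<Sum>i\<in>I. scale (u (v i)) (v i)) = 0"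
        using T(3) unfolding I(2) by (simp add: sum.reindex[OF injI])
    next
      fix i assume "i \<in> I"
      then show "scale (u (v i)) (v i) \<in> wt i"
        using I v weight_space_scale by blast
    next
      fix i j assume "i \<in> I" "j \<in> I" "i \<noteq> j"
      then show "\<exists>x\<in>\<h>. i x \<noteq> j x"
        using I by (intro dist) auto
    qed (use i in auto)
    moreover have "v i \<noteq> 0" using v[of i] i(1) I(1) by blast
    ultimately show "u w = 0" using i(2) by simp
  qed
  then have "finite (v ` ?W)"
    by (rule finite_independent)
  then show ?thesis
    using inj by (simp add: finite_image_iff)
qed

lemma funpow_bracket_weight:
  assumes "f \<in> wt \<beta>" "v \<in> wt \<gamma>"
  shows "(bracket f ^^ k) v \<in> wt (\<lambda>x. \<gamma> x + of_nat k * \<beta> x)"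
proof (induction k)
  case (Suc k)
  have "wt (\<lambda>x. \<beta> x + (\<gamma> x + of_nat k * \<beta> x)) = wt (\<lambda>x. \<gamma> x + of_nat (Suc k) * \<beta> x)"
    by (rule wt_cong) (simp add: algebra_simps)
  then show ?case
    using bracket_weight[OF assms(1) Suc] by simp
qed (use assms in simp)

lemma funpow_bracket_nilpotent:
  assumes "f \<in> wt \<beta>" "v \<in> wt \<gamma>" "y \<in> \<h>" "\<beta> y \<noteq> 0"
  shows "\<exists>k. (bracket f ^^ k) v = 0"
proof (rule ccontr)
  assume no: "\<not> ?thesis"
  define \<phi> where "\<phi> k x = (if x \<in> \<h> then \<gamma> x + of_nat k * \<beta> x else 0)" for k x
  have "wt (\<phi> k) = wt (\<lambda>x. \<gamma> x + of_nat k * \<beta> x)" for k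
    by (rule wt_cong) (simp add: \<phi>_def)
  then have "(bracket f ^^ k) v \<in> wt (\<phi> k)" for k
    using funpow_bracket_weight[OF assms(1,2)] by simp
  then have "range \<phi> \<subseteq> {\<phi>. (\<forall>x. x \<notin> \<h> \<longrightarrow> \<phi> x = 0) \<and> wt \<phi> \<noteq> {0}}"
    using no by (auto simp: \<phi>_def)
  then have "finite (range \<phi>)"
    using finite_weights finite_subset by blast
  moreover have "inj \<phi>"
    by (rule injI) (use assms(3,4) in \<open>auto simp: \<phi>_def fun_eq_iff dest!: spec[of _ y]\<close>)
  ultimately show False
    using finite_imageD infinite_UNIV_nat by blast
qed

lemma last_nonzero_power:
  assumes "f \<in> wt \<beta>" "v \<in> wt \<gamma>" "y \<in> \<h>" "\<beta> y \<noteq> 0" "v \<noteq> 0"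
  obtains k where "(bracket f ^^ k) v \<noteq> 0" "(bracket f ^^ Suc k) v = 0" "\<And>i. i \<le> k \<Longrightarrow> (bracket f ^^ i) v \<noteq> 0"
proof -
  define n where "n = (LEAST k. (bracket f ^^ k) v = 0)"
  have n: "(bracket f ^^ n) v = 0"
    unfolding n_def using funpow_bracket_nilpotent[OF assms(1-4)] by (rule LeastI_ex)
  have less: "(bracket f ^^ i) v \<noteq> 0" if "i < n" for i
    using not_less_Least that unfolding n_def by blast
  have "n \<noteq> 0" using n assms(5) by (intro notI) simp
  then obtain k where "n = Suc k" by (cases n) auto
  then show ?thesis
    using that[of k] n less by simp
qed

section \<open>Root strings\<close>

text \<open>The computation of \<open>\<ss>\<ll>\<^sub>2\<close> representation theory, with \<open>[e, f] = t\<close> not yet normalized, so that the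
  case \<open>\<beta>(t) = 0\<close> is included. If \<open>e v = 0\<close> then
  \<open>e f\<^bsup>i+1\<^esup> v = ((i + 1) \<gamma>(t) - i (i + 1) / 2 \<beta>(t)) f\<^sup>i v\<close>; at the last nonzero power \<open>f\<^sup>k v\<close> the scalar must
  vanish.\<close>

lemma string_from_top:
  assumes e: "e \<in> wt \<beta>" and f: "f \<in> wt (\<lambda>x. - \<beta> x)" and t: "bracket e f = t" "t \<in> \<h>"
    and y: "y \<in> \<h>" "\<beta> y \<noteq> 0" and v: "v \<in> wt \<gamma>" "v \<noteq> 0" "bracket e v = 0"
  obtains k :: nat where "2 * \<gamma> t = of_nat k * \<beta> t"
    "\<And>i. i \<le> k \<Longrightarrow> \<exists>w. w \<noteq> 0 \<and> w \<in> wt (\<lambda>x. \<gamma> x - of_nat i * \<beta> x)"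
proof -
  define g where "g i = (bracket f ^^ i) v" for i
  have wt: "g i \<in> wt (\<lambda>x. \<gamma> x - of_nat i * \<beta> x)" for i
    using funpow_bracket_weight[OF f v(1), of i] by (simp add: g_def)
  \<comment> \<open>The commutation relation, by induction from \<open>e f = t + f e\<close>.\<close>
  have eg: "bracket e (g (Suc i)) = scale (of_nat (Suc i) * \<gamma> t - of_nat (Suc i * i) / 2 * \<beta> t) (g i)" for i
  proof (induction i)
    case 0
    show ?case
      using v t by (simp add: g_def bracket_derivation[of e f] weight_space_def)
  next
    case (Suc i)
    have "bracket e (g (Suc (Suc i))) = bracket t (g (Suc i)) + bracket f (bracket e (g (Suc i)))"
      by (simp add: g_def bracket_derivation[of e f] t)
    also have "bracket t (g (Suc i)) = scale (\<gamma> t - of_nat (Suc i) * \<beta> t) (g (Suc i))"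
      using wt[of "Suc i"] t by (simp add: weight_space_def)
    also have "bracket f (bracket e (g (Suc i)))
        = scale (of_nat (Suc i) * \<gamma> t - of_nat (Suc i * i) / 2 * \<beta> t) (g (Suc i))"
      by (simp add: Suc bracket_scale_right) (simp add: g_def)
    also have "scale (\<gamma> t - of_nat (Suc i) * \<beta> t) (g (Suc i)) + \<dots> =
      scale (of_nat (Suc (Suc i)) * \<gamma> t - of_nat (Suc (Suc i) * Suc i) / 2 * \<beta> t) (g (Suc i))"
      unfolding scale_left_distrib[symmetric] by (rule arg_cong[of _ _ "\<lambda>c. scale c (g (Suc i))"]) (simp add: field_simps)
    finally show ?case .
  qed
  obtain k where k: "g k \<noteq> 0" "g (Suc k) = 0" "\<And>i. i \<le> k \<Longrightarrow> g i \<noteq> 0"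
    using last_nonzero_power[OF f v(1) y(1) _ v(2)] y(2) unfolding g_def by auto
  have "of_nat (Suc k) * \<gamma> t - of_nat (Suc k * k) / 2 * \<beta> t = 0"
    using eg[of k] k by simp
  then have "of_nat (Suc k) * (2 * \<gamma> t - of_nat k * \<beta> t) = 0"
    by (simp add: field_simps)
  then have "2 * \<gamma> t = of_nat k * \<beta> t"
    by (simp del: of_nat_Suc)
  then show ?thesis
    using that[of k] wt k(3) by blast
qed

text \<open>The root string through an arbitrary weight \<open>\<gamma>\<close>: raise \<open>v\<close> by \<open>p\<close> steps to the top of its string, then descend.
  The second statement says that \<open>\<gamma> + j \<beta>\<close> has a nonzero weight space for \<open>p - k \<le> j \<le> p\<close>.\<close>

lemma string_upper:
  assumes \<beta>: "is_root \<h> \<beta>" and v: "v \<in> wt \<gamma>" "v \<noteq> 0"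
  obtains p k :: nat where "2 * \<gamma> (dual \<beta>) = (of_nat k - 2 * of_nat p) * \<beta> (dual \<beta>)"
    "\<And>i. i \<le> k \<Longrightarrow> \<exists>w. w \<noteq> 0 \<and> w \<in> wt (\<lambda>x. \<gamma> x + (of_nat p - of_nat i) * \<beta> x)"
proof -
  obtain e f where ef: "e \<in> wt \<beta>" "f \<in> wt (\<lambda>x. - \<beta> x)" "bracket e f = dual \<beta>"
    using root_triple[OF \<beta>] by metis
  obtain y where y: "y \<in> \<h>" "\<beta> y \<noteq> 0" using \<beta> by (auto simp: is_root_def)
  obtain p where p: "(bracket e ^^ p) v \<noteq> 0" "(bracket e ^^ Suc p) v = 0"
    using last_nonzero_power[OF ef(1) v(1) y v(2)] by blast
  obtain k where k: "2 * (\<gamma> (dual \<beta>) + of_nat p * \<beta> (dual \<beta>)) = of_nat k * \<beta> (dual \<beta>)"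
    "\<And>i. i \<le> k \<Longrightarrow> \<exists>w. w \<noteq> 0 \<and> w \<in> wt (\<lambda>x. (\<gamma> x + of_nat p * \<beta> x) - of_nat i * \<beta> x)"
    by (rule string_from_top[OF ef dual_in_h[OF \<beta>] y funpow_bracket_weight[OF ef(1) v(1), of p] p(1)])
       (use p(2) in auto)
  show ?thesis
    by (rule that[of k p]) (use k in \<open>simp_all add: algebra_simps\<close>)
qed


text \<open>The center is an ideal other than the whole algebra.\<close>

lemma central_eq_0:
  assumes "\<And>y. bracket x y = 0"
  shows "x = 0"
proof -
  let ?I = "{x. \<forall>y. bracket x y = 0}"
  have "bracket x y = 0" if "y \<in> ?I" for x y
    using that bracket_anticomm[of x y] by simp
  then have "lie_ideal ?I"
    unfolding lie_ideal_def by (auto simp: subspace_def bracket_add_left bracket_scale_left)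
  moreover have "?I \<noteq> UNIV"
    using simple unfolding simple_lie_def by blast
  ultimately have "?I = {0}"
    using simple unfolding simple_lie_def by blast
  then show ?thesis
    using assms by blast
qed

lemma weights_vanish_eq_0:
  assumes "t \<in> \<h>" "\<And>\<beta>. is_root \<h> \<beta> \<Longrightarrow> \<beta> t = 0"
  shows "t = 0"
proof (rule central_eq_0, rule linear_eq_0_by_weights[of "bracket t"])
  fix \<phi> v assume v: "v \<in> wt \<phi>"
  show "bracket t v = 0"
  proof (cases "v = 0 \<or> (\<forall>x\<in>\<h>. \<phi> x = 0)")
    case True
    then show ?thesis using v assms(1) by (auto simp: weight_space_def)
  next
    case False
    then have "is_root \<h> \<phi>" using v by (auto simp: is_root_iff)
    then show ?thesis using v assms by (simp add: weight_space_def)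
  qed
qed (auto simp: bracket_add_right bracket_scale_right)

text \<open>If \<open>\<beta>(t\<^sub>\<beta>) = 0\<close>, the string relation forces every root to vanish at \<open>t\<^sub>\<beta>\<close>, which is then central.\<close>

lemma root_not_isotropic:
  assumes \<beta>: "is_root \<h> \<beta>"
  shows "\<beta> (dual \<beta>) \<noteq> 0"
proof
  assume 0: "\<beta> (dual \<beta>) = 0"
  have "dual \<beta> = 0"
  proof (rule weights_vanish_eq_0)
    fix \<gamma> assume "is_root \<h> \<gamma>"
    then obtain v where v: "v \<in> wt \<gamma>" "v \<noteq> 0" by (auto simp: is_root_iff)
    show "\<gamma> (dual \<beta>) = 0"
      by (rule string_upper[OF \<beta> v]) (simp add: 0)
  qed (rule dual_in_h[OF \<beta>])
  then show False
    using form_dual[OF \<beta>] \<beta> by (auto simp: is_root_def)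
qed

lemma form_diff_left: "\<kappa> (x - scale c y) z = \<kappa> x z - c * \<kappa> y z"
  using form_add_left[of x "scale (- c) y" z] form_scale_left[of "- c" y z] by simp

lemma dual_diff:
  assumes "is_root \<h> \<beta>" "is_root \<h> \<gamma>"
  shows "dual (\<lambda>x. \<gamma> x - c * \<beta> x) = dual \<gamma> - scale c (dual \<beta>)"
  by (rule dual_eqI)
     (use assms dual_in_h form_dual h_subspace subspace_diff subspace_scale in \<open>auto simp: form_diff_left\<close>)

lemma pair_diff_left:
  assumes "is_root \<h> \<beta>" "is_root \<h> \<gamma>"
  shows "pair (\<lambda>x. \<gamma> x - c * \<beta> x) \<delta> = pair \<gamma> \<delta> - c * pair \<beta> \<delta>"
  using assms by (simp add: dual_form_def dual_diff form_diff_left)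

lemma dual_cong:
  assumes "\<And>x. x \<in> \<h> \<Longrightarrow> \<phi> x = \<psi> x"
  shows "dual \<phi> = dual \<psi>"
  using assms unfolding dual_elt_def by (intro arg_cong[of _ _ The]) (auto simp: fun_eq_iff)

lemma dual_uminus: "is_root \<h> \<beta> \<Longrightarrow> dual (\<lambda>x. - \<beta> x) = - dual \<beta>"
  using dual_in_h[of \<beta>] form_dual[of \<beta>] h_subspace subspace_neg form_scale_left[of "-1"]
  by (intro dual_eqI) auto

text \<open>Both the integrality of Cartan numbers and the invariance of the set of roots under reflections. The string
  descending from the top contains the reflected weight when \<open>p \<le> k\<close>; otherwise the Cartan
  number is negative and the string for \<open>-\<beta>\<close> serves.\<close>

lemma root_reflection:
  assumes \<beta>: "is_root \<h> \<beta>" and \<gamma>: "is_root \<h> \<gamma>"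
  obtains n :: int where "2 * pair \<gamma> \<beta> = of_int n * pair \<beta> \<beta>"
    "is_root \<h> (\<lambda>x. \<gamma> x - of_int n * \<beta> x)"
proof -
  obtain v where v: "v \<in> wt \<gamma>" "v \<noteq> 0" using \<gamma> by (auto simp: is_root_iff)
  let ?t = "dual \<beta>"
  let ?\<epsilon> = "\<lambda>x. - \<beta> x"
  have \<epsilon>: "is_root \<h> ?\<epsilon>" by (rule root_uminus[OF \<beta>])
  have lin: "\<phi> (- ?t) = - \<phi> ?t" if "is_root \<h> \<phi>" for \<phi>
    using form_dual[OF that, of "- ?t"] form_dual[OF that, of ?t] dual_in_h[OF \<beta>] h_subspace subspace_neg
      form_scale_right[of "dual \<phi>" "-1" ?t] by simp
  have \<beta>t: "\<beta> ?t \<noteq> 0" by (rule root_not_isotropic[OF \<beta>])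
  obtain p k where pk: "2 * \<gamma> ?t = (of_nat k - 2 * of_nat p) * \<beta> ?t"
    "\<And>i. i \<le> k \<Longrightarrow> \<exists>w. w \<noteq> 0 \<and> w \<in> wt (\<lambda>x. \<gamma> x + (of_nat p - of_nat i) * \<beta> x)"
    using string_upper[OF \<beta> v] by blast
  obtain p' k' where "2 * \<gamma> (dual ?\<epsilon>) = (of_nat k' - 2 * of_nat p') * ?\<epsilon> (dual ?\<epsilon>)"
    and pk'2: "\<And>i. i \<le> k' \<Longrightarrow> \<exists>w. w \<noteq> 0 \<and> w \<in> wt (\<lambda>x. \<gamma> x + (of_nat p' - of_nat i) * ?\<epsilon> x)"
    using string_upper[OF \<epsilon> v] by blast
  then have "- 2 * \<gamma> ?t = (of_nat k' - 2 * of_nat p') * \<beta> ?t"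
    by (simp add: dual_uminus[OF \<beta>] lin[OF \<beta>] lin[OF \<gamma>])
  then have "(of_nat k - 2 * of_nat p) * \<beta> ?t = - (of_nat k' - 2 * of_nat p') * \<beta> ?t"
    using pk(1) by (metis minus_mult_left minus_minus)
  then have "(of_int (int k - 2 * int p) :: complex) = of_int (- (int k' - 2 * int p'))"
    using \<beta>t by simp
  \<comment> \<open>The strings for \<open>\<beta>\<close> and \<open>-\<beta>\<close> give Cartan numbers of opposite sign.\<close>
  then have kk': "int k - 2 * int p = - (int k' - 2 * int p')"
    by (simp only: of_int_eq_iff)
  define n where "n = int k - 2 * int p"
  have n: "2 * \<gamma> ?t = of_int n * \<beta> ?t"
    using pk(1) by (simp add: n_def)
  have "\<exists>w. w \<noteq> 0 \<and> w \<in> wt (\<lambda>x. \<gamma> x - of_int n * \<beta> x)"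
  proof (cases "p \<le> k")
    case True
    have "wt (\<lambda>x. \<gamma> x + (of_nat p - of_nat (k - p)) * \<beta> x) = wt (\<lambda>x. \<gamma> x - of_int n * \<beta> x)"
      by (rule wt_cong) (use True in \<open>simp add: of_nat_diff algebra_simps n_def\<close>)
    then show ?thesis using pk(2)[of "k - p"] by simp
  next
    case False
    then have le: "p' \<le> k'" using kk' by simp
    have n': "n = - (int k' - 2 * int p')" using kk' n_def by simp
    have "wt (\<lambda>x. \<gamma> x + (of_nat p' - of_nat (k' - p')) * ?\<epsilon> x) = wt (\<lambda>x. \<gamma> x - of_int n * \<beta> x)"
      by (rule wt_cong) (use le in \<open>simp add: of_nat_diff algebra_simps n'\<close>)
    then show ?thesis using pk'2[of "k' - p'"] by simp
  qed
  moreover have "\<exists>x\<in>\<h>. \<gamma> x - of_int n * \<beta> x \<noteq> 0"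
  proof (rule ccontr)
    assume "\<not> ?thesis"
    then have eq: "\<gamma> x = of_int n * \<beta> x" if "x \<in> \<h>" for x
      using that by simp
    then have "2 * (of_int n * \<beta> ?t) = of_int n * \<beta> ?t"
      using n dual_in_h[OF \<beta>] by metis
    then have "n = 0" using \<beta>t by simp
    then show False using eq \<gamma> by (auto simp: is_root_def)
  qed
  ultimately have "is_root \<h> (\<lambda>x. \<gamma> x - of_int n * \<beta> x)"
    by (auto simp: is_root_iff)
  then show ?thesis
    using that[of n] n \<beta> \<gamma> by (simp add: pair_eq)
qed

section \<open>Positivity of root norms\<close>

lemma pair_self_real: "is_root \<h> \<beta> \<Longrightarrow> pair \<beta> \<beta> = of_real (Re (pair \<beta> \<beta>))"
  using standard_form unfolding standard_form_def by (metis of_real_Re)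

lemma pair_self_neq_0: "is_root \<h> \<beta> \<Longrightarrow> Re (pair \<beta> \<beta>) \<noteq> 0"
  using pair_self_real root_not_isotropic pair_eq by (metis of_real_0)

lemma pair_real: "is_root \<h> \<beta> \<Longrightarrow> is_root \<h> \<gamma> \<Longrightarrow> pair \<gamma> \<beta> = of_real (Re (pair \<gamma> \<beta>))"
proof -
  assume \<beta>: "is_root \<h> \<beta>" and \<gamma>: "is_root \<h> \<gamma>"
  obtain n :: int where "2 * pair \<gamma> \<beta> = of_int n * pair \<beta> \<beta>"
    using root_reflection[OF \<beta> \<gamma>] by blast
  then have "pair \<gamma> \<beta> = of_real (of_int n * Re (pair \<beta> \<beta>) / 2)"
    using pair_self_real[OF \<beta>] by (simp add: field_simps)
  then show ?thesis by (metis Re_complex_of_real)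
qed

lemma restrict_root:
  assumes "is_root \<h> \<beta>"
  defines "\<beta>' \<equiv> \<lambda>x. if x \<in> \<h> then \<beta> x else 0"
  shows "is_root \<h> \<beta>'" "dual \<beta>' = dual \<beta>"
proof -
  show "is_root \<h> \<beta>'"
    using assms(1) by (rule root_cong) (simp add: \<beta>'_def)
  show "dual \<beta>' = dual \<beta>"
    by (rule dual_cong) (simp add: \<beta>'_def)
qed

lemma finite_pairings: "finite {pair \<beta> \<gamma> |\<beta> \<gamma>. is_root \<h> \<beta> \<and> is_root \<h> \<gamma>}"
proof -
  let ?W = "{\<phi>. (\<forall>x. x \<notin> \<h> \<longrightarrow> \<phi> x = 0) \<and> wt \<phi> \<noteq> {0}}"
  have "dual \<beta> \<in> dual ` ?W" if \<beta>: "is_root \<h> \<beta>" for \<beta>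
  proof -
    let ?\<beta>' = "\<lambda>x. if x \<in> \<h> then \<beta> x else 0"
    have "?\<beta>' \<in> ?W"
      using restrict_root(1)[OF \<beta>] by (auto simp: is_root_iff)
    then show ?thesis
      using restrict_root(2)[OF \<beta>] by (metis (no_types, lifting) imageI)
  qed
  then have "{pair \<beta> \<gamma> |\<beta> \<gamma>. is_root \<h> \<beta> \<and> is_root \<h> \<gamma>} \<subseteq> (\<lambda>(s, t). \<kappa> s t) ` (dual ` ?W \<times> dual ` ?W)"
    unfolding dual_form_def by fast
  then show ?thesis
    by (rule finite_subset) (use finite_weights in auto)
qed

text \<open>Take a nonorthogonal pair of roots of opposite signs with \<open>\<bar>(\<beta>|\<gamma>)\<bar>\<close> maximal, and let \<open>p\<close>, \<open>q\<close> be its Cartan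
  numbers, so that \<open>p q < 0\<close>. Reflecting each root in the other keeps their norms and multiplies \<open>(\<beta>|\<gamma>)\<close> by
  \<open>p q - 3\<close>, whose absolute value exceeds 1: geometrically, the reflections in a hyperbolic plane would
  generate infinitely many roots.\<close>

lemma nonorthogonal_roots_same_sign:
  assumes "is_root \<h> \<beta>" "is_root \<h> \<gamma>" "Re (pair \<beta> \<beta>) > 0" "Re (pair \<gamma> \<gamma>) < 0"
  shows "pair \<beta> \<gamma> = 0"
proof (rule ccontr)
  assume "pair \<beta> \<gamma> \<noteq> 0"
  define V where "V = {cmod (pair \<beta> \<gamma>) |\<beta> \<gamma>. is_root \<h> \<beta> \<and> is_root \<h> \<gamma> \<and> Re (pair \<beta> \<beta>) > 0
     \<and> Re (pair \<gamma> \<gamma>) < 0 \<and> pair \<beta> \<gamma> \<noteq> 0}"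
  have "V \<subseteq> cmod ` {pair \<beta> \<gamma> |\<beta> \<gamma>. is_root \<h> \<beta> \<and> is_root \<h> \<gamma>}"
    unfolding V_def by blast
  then have V: "finite V"
    using finite_pairings finite_subset by blast
  moreover have "V \<noteq> {}"
    using assms \<open>pair \<beta> \<gamma> \<noteq> 0\<close> unfolding V_def by blast
  ultimately have "Max V \<in> V" by (rule Max_in)
  then obtain \<beta> \<gamma> where \<beta>: "is_root \<h> \<beta>" and \<gamma>: "is_root \<h> \<gamma>"
    and pos: "Re (pair \<beta> \<beta>) > 0" and neg: "Re (pair \<gamma> \<gamma>) < 0" and nz: "pair \<beta> \<gamma> \<noteq> 0"
    and mx: "Max V = cmod (pair \<beta> \<gamma>)" unfolding V_def by blast
  obtain p where p: "2 * pair \<beta> \<gamma> = of_int p * pair \<gamma> \<gamma>" and \<beta>': "is_root \<h> (\<lambda>x. \<beta> x - of_int p * \<gamma> x)"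
    using root_reflection[OF \<gamma> \<beta>] by blast
  obtain q where q: "2 * pair \<gamma> \<beta> = of_int q * pair \<beta> \<beta>" and \<gamma>': "is_root \<h> (\<lambda>x. \<gamma> x - of_int q * \<beta> x)"
    using root_reflection[OF \<beta> \<gamma>] by blast
  let ?\<beta> = "\<lambda>x. \<beta> x - of_int p * \<gamma> x" and ?\<gamma> = "\<lambda>x. \<gamma> x - of_int q * \<beta> x"
  have left\<beta>: "pair ?\<beta> \<delta> = pair \<beta> \<delta> - of_int p * pair \<gamma> \<delta>"
    and left\<gamma>: "pair ?\<gamma> \<delta> = pair \<gamma> \<delta> - of_int q * pair \<beta> \<delta>" for \<delta>
    by (rule pair_diff_left; fact)+
  have sym: "pair \<gamma> \<beta> = pair \<beta> \<gamma>" by (rule pair_sym)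
  have "pair ?\<beta> ?\<beta> = pair \<beta> \<beta>"
    using p by (simp add: left\<beta> pair_sym[of _ ?\<beta>] sym algebra_simps)
  moreover have "pair ?\<gamma> ?\<gamma> = pair \<gamma> \<gamma>"
    using q by (simp add: left\<gamma> pair_sym[of _ ?\<gamma>] sym algebra_simps)
  moreover have B': "pair ?\<beta> ?\<gamma> = of_int (p * q - 3) * pair \<beta> \<gamma>"
  proof -
    have "pair ?\<beta> ?\<gamma> = pair \<beta> \<gamma> - of_int q * pair \<beta> \<beta> - of_int p * (pair \<gamma> \<gamma> - of_int q * pair \<beta> \<gamma>)"
      by (simp add: left\<beta> pair_sym[of _ ?\<gamma>] left\<gamma> sym)
    also have "\<dots> = pair \<beta> \<gamma> - 2 * pair \<beta> \<gamma> - 2 * pair \<beta> \<gamma> + of_int (p * q) * pair \<beta> \<gamma>"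
      using p q by (simp add: sym algebra_simps)
    finally show ?thesis by (simp add: algebra_simps)
  qed
  moreover have pq: "p * q < 0"
  proof -
    let ?b = "Re (pair \<beta> \<gamma>)"
    have b: "pair \<beta> \<gamma> = of_real ?b" by (rule pair_real[OF \<gamma> \<beta>])
    then have b0: "?b \<noteq> 0" using nz by (metis of_real_0)
    have "2 * ?b = of_int p * Re (pair \<gamma> \<gamma>)" "2 * ?b = of_int q * Re (pair \<beta> \<beta>)"
      using arg_cong[OF p, of Re] arg_cong[OF q, of Re] by (simp_all add: sym)
    then have "of_int (p * q) * (Re (pair \<beta> \<beta>) * Re (pair \<gamma> \<gamma>)) = (2 * ?b) * (2 * ?b)"
      by (simp add: mult_ac)
    also have "\<dots> > 0" using b0 by (simp add: zero_less_mult_iff linorder_neq_iff disj_commute)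
    finally have prod_pos: "of_int (p * q) * (Re (pair \<beta> \<beta>) * Re (pair \<gamma> \<gamma>)) > 0" .
    have sgn: "z < 0" if "0 < z * (A * B)" "0 < A" "B < 0" for z A B :: real
      using that by (auto simp: zero_less_mult_iff)
    have "(of_int (p * q) :: real) < 0"
      using prod_pos pos neg by (rule sgn)
    then show ?thesis by (simp only: of_int_less_0_iff)
  qed
  ultimately have "cmod (pair ?\<beta> ?\<gamma>) \<in> V"
  proof -
    assume norms: "pair ?\<beta> ?\<beta> = pair \<beta> \<beta>" "pair ?\<gamma> ?\<gamma> = pair \<gamma> \<gamma>"
    have "(of_int (p * q - 3) :: complex) \<noteq> 0"
      using pq by (simp only: of_int_eq_0_iff)
    then have "pair ?\<beta> ?\<gamma> \<noteq> 0"
      using B' nz by simp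
    then show ?thesis
      unfolding V_def mem_Collect_eq
      by (intro exI[of _ ?\<beta>] exI[of _ ?\<gamma>] conjI refl) (simp_all only: norms \<beta>' \<gamma>' pos neg not_False_eq_True)
  qed
  then have "cmod (pair ?\<beta> ?\<gamma>) \<le> cmod (pair \<beta> \<gamma>)"
    using V mx by (metis Max_ge)
  moreover have "cmod (pair ?\<beta> ?\<gamma>) = \<bar>of_int (p * q - 3)\<bar> * cmod (pair \<beta> \<gamma>)"
    unfolding B' norm_mult by (metis norm_of_int)
  moreover have "1 < \<bar>of_int (p * q - 3) :: real\<bar>"
    using pq by (simp only: of_int_abs[symmetric] of_int_1_less_iff)
  ultimately show False
    using nz by simp
qed


text \<open>The standard form is normalized so that some root has norm 2. If a root had negative norm, the span of
  all root spaces of negative norm and of the elements representing these roots would be an ideal: when the sum of a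
  root and a root of negative norm is a root, it has negative norm, as roots of opposite signs are orthogonal.
  This ideal is not zero, and it is orthogonal to the element
  representing a root of norm 2, hence not the whole algebra.\<close>

lemma root_norm_pos:
  assumes \<beta>: "is_root \<h> \<beta>"
  shows "Re (pair \<beta> \<beta>) > 0"
proof (rule ccontr)
  define neg where "neg \<gamma> \<longleftrightarrow> is_root \<h> \<gamma> \<and> Re (pair \<gamma> \<gamma>) < 0" for \<gamma>
  assume "\<not> ?thesis"
  then have neg\<beta>: "neg \<beta>"
    using pair_self_neq_0[OF \<beta>] \<beta> by (simp add: neg_def)
  obtain \<beta>0 where \<beta>0: "is_root \<h> \<beta>0" "pair \<beta>0 \<beta>0 = 2"
    using standard_form unfolding standard_form_def by blast
  have orth: "pair \<phi> \<gamma> = 0" if "is_root \<h> \<phi>" "\<not> neg \<phi>" "neg \<gamma>" for \<phi> \<gamma>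
    using nonorthogonal_roots_same_sign[of \<phi> \<gamma>] pair_self_neq_0[of \<phi>] that by (auto simp: neg_def)
  define G where "G = {v. \<exists>\<gamma>. neg \<gamma> \<and> (v \<in> wt \<gamma> \<or> v = dual \<gamma>)}"
  have rootI: "v \<in> span G" if "neg \<gamma>" "v \<in> wt \<gamma>" for v \<gamma>
    using that unfolding G_def by (intro span_base) blast
  have dualI: "dual \<gamma> \<in> span G" if "neg \<gamma>" for \<gamma>
    using that unfolding G_def by (intro span_base) blast
  \<comment> \<open>It suffices to bracket a weight vector with a generator.\<close>
  have gen: "bracket x y \<in> span G" if x: "x \<in> wt \<phi>" and y: "y \<in> G" for x y \<phi>
  proof (cases "x = 0 \<or> (\<forall>z\<in>\<h>. \<phi> z = 0)")
    case True
    then have xh: "x \<in> \<h>"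
      using x wt_0_eq[of \<phi>] h_subspace subspace_0 by auto
    obtain \<gamma> where \<gamma>: "neg \<gamma>" "y \<in> wt \<gamma> \<or> y = dual \<gamma>" using y unfolding G_def by blast
    show ?thesis
      using \<gamma>(2)
    proof
      assume "y \<in> wt \<gamma>"
      then show ?thesis
        using rootI[OF \<gamma>(1)] span_scale xh by (simp add: weight_space_def)
    next
      assume "y = dual \<gamma>"
      then show ?thesis
        using h_abelian[OF xh] dual_in_h \<gamma>(1) span_zero by (simp add: neg_def)
    qed
  next
    case False
    then have \<phi>: "is_root \<h> \<phi>" using x by (auto simp: is_root_iff)
    obtain \<gamma> where \<gamma>: "neg \<gamma>" "y \<in> wt \<gamma> \<or> y = dual \<gamma>" using y unfolding G_def by blast
    then have \<gamma>r: "is_root \<h> \<gamma>" by (simp add: neg_def)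
    show ?thesis
      using \<gamma>(2)
    proof
      assume y: "y \<in> wt \<gamma>"
      let ?\<epsilon> = "\<lambda>z. \<phi> z + \<gamma> z"
      have b: "bracket x y \<in> wt ?\<epsilon>" by (rule bracket_weight[OF x y])
      consider "bracket x y = 0" | "\<forall>z\<in>\<h>. ?\<epsilon> z = 0" | "is_root \<h> ?\<epsilon>"
        using b by (auto simp: is_root_iff)
      then show ?thesis
      proof cases
        case 1
        then show ?thesis using span_zero by simp
      next
        case 2
        then have "x \<in> wt (\<lambda>z. - \<gamma> z)"
          using x wt_cong[of \<phi> "\<lambda>z. - \<gamma> z"] by (simp add: eq_neg_iff_add_eq_0)
        then have bh: "bracket y x \<in> \<h>" "\<And>z. z \<in> \<h> \<Longrightarrow> \<kappa> (bracket y x) z = \<gamma> z * \<kappa> y x"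
          using root_pair_bracket[OF y] by auto
        have "bracket y x = scale (\<kappa> y x) (dual \<gamma>)"
          by (rule h_unique)
             (use bh dual_in_h[OF \<gamma>r] form_dual[OF \<gamma>r] h_subspace subspace_scale in \<open>auto simp: form_scale_left\<close>)
        then show ?thesis
          using bracket_anticomm[of x y] dualI[OF \<gamma>(1)] by (auto intro!: span_neg span_scale)
      next
        case 3
        have add: "pair ?\<epsilon> \<delta> = pair \<phi> \<delta> + pair \<gamma> \<delta>" if "is_root \<h> \<delta>" for \<delta>
          using that 3 \<phi> \<gamma>r by (simp add: pair_eq)
        have nz: "pair \<delta> \<delta> \<noteq> 0" if "is_root \<h> \<delta>" for \<delta>
          using pair_self_neq_0[OF that] by auto
        \<comment> \<open>Otherwise \<open>\<epsilon> = \<phi> + \<gamma>\<close> is orthogonal to \<open>\<gamma>\<close>, then to \<open>\<phi>\<close>, and so to itself.\<close>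
        have "neg ?\<epsilon>"
        proof (rule ccontr)
          assume e: "\<not> neg ?\<epsilon>"
          have e\<gamma>: "pair ?\<epsilon> \<gamma> = 0" by (rule orth[OF 3 e \<gamma>(1)])
          then have "pair \<phi> \<gamma> \<noteq> 0" using add[OF \<gamma>r] nz[OF \<gamma>r] by auto
          then have "neg \<phi>" using orth[OF \<phi> _ \<gamma>(1)] by blast
          then have "pair ?\<epsilon> \<phi> = 0" by (rule orth[OF 3 e])
          then have "pair ?\<epsilon> ?\<epsilon> = 0"
            using add[OF 3] e\<gamma> pair_sym[of ?\<epsilon> \<phi>] pair_sym[of ?\<epsilon> \<gamma>] by simp
          then show False using nz[OF 3] by simp
        qed
        then show ?thesis using b by (rule rootI)
      qed
    next
      assume y: "y = dual \<gamma>"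
      have "bracket x y = - bracket y x" by (rule bracket_anticomm)
      also have "bracket y x = scale (pair \<phi> \<gamma>) x"
        using x y dual_in_h[OF \<gamma>r] by (simp add: weight_space_def pair_eq[OF \<phi> \<gamma>r])
      finally have eq: "bracket x y = - scale (pair \<phi> \<gamma>) x" .
      show ?thesis
      proof (cases "neg \<phi>")
        case True
        then show ?thesis unfolding eq by (intro span_neg span_scale rootI[OF _ x])
      next
        case False
        then show ?thesis unfolding eq using orth[OF \<phi> False \<gamma>(1)] span_zero by simp
      qed
    qed
  qed
  have "bracket x y \<in> span G" if y: "y \<in> span G" for x y
    using y
  proof (induction rule: span_induct_alt)
    case base
    then show ?case using span_zero by simp
  next
    case (step c y z)
    have "x \<in> span {v. \<exists>\<phi>. v \<in> wt \<phi>}" using weight_vectors_span by simp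
    then have "bracket x y \<in> span G"
    proof (induction rule: span_induct_alt)
      case base
      then show ?case using span_zero by simp
    next
      case (step d u w)
      then show ?case
        using gen[OF _ \<open>y \<in> G\<close>] by (auto simp: bracket_add_left bracket_scale_left intro!: span_add span_scale)
    qed
    then show ?case
      using step by (auto simp: bracket_add_right bracket_scale_right intro!: span_add span_scale)
  qed
  then have "lie_ideal (span G)"
    unfolding lie_ideal_def using subspace_span by blast
  then have "span G = {0} \<or> span G = UNIV"
    using simple unfolding simple_lie_def by blast
  moreover have "dual \<beta> \<noteq> 0"
    using form_dual[OF \<beta>] \<beta> by (auto simp: is_root_def)
  then have "span G \<noteq> {0}"
    using dualI[OF neg\<beta>] by blast
  ultimately have G: "span G = UNIV" by blast
  have "\<kappa> (dual \<beta>0) y = 0" if "y \<in> span G" for y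
    using that
  proof (induction rule: span_induct_alt)
    case (step c v w)
    obtain \<gamma> where \<gamma>: "neg \<gamma>" "v \<in> wt \<gamma> \<or> v = dual \<gamma>" using step unfolding G_def by blast
    have "\<kappa> (dual \<beta>0) v = 0"
      using \<gamma>(2)
    proof
      assume v: "v \<in> wt \<gamma>"
      obtain z where z: "z \<in> \<h>" "\<gamma> z \<noteq> 0" using \<gamma>(1) by (auto simp: neg_def is_root_def)
      have "dual \<beta>0 \<in> wt (\<lambda>_. 0)"
        using wt_0_eq dual_in_h[OF \<beta>0(1)] by simp
      then show ?thesis
        using form_weights_orthogonal[OF _ v z(1)] z(2) by simp
    next
      assume "v = dual \<gamma>"
      then show ?thesis
        using orth[OF \<beta>0(1) _ \<gamma>(1)] \<beta>0(2) by (simp add: dual_form_def neg_def)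
    qed
    then show ?case using step by (simp add: form_add_right form_scale_right)
  qed simp
  then have "dual \<beta>0 = 0"
    using form_nondegenerate G by blast
  then show False
    using \<beta>0(2) by (simp add: dual_form_def)
qed

section \<open>The Gram matrix of the simple roots\<close>

lemma simple_root: "is_root \<h> (\<alpha> a)"
  using simple_roots unfolding simple_roots_def by blast

lemma root_ip_sym: "root_ip a b = root_ip b a"
  by (simp add: root_ip_def pair_sym)

lemma root_ip_pos: "root_ip a a > 0"
  by (simp add: root_ip_def root_norm_pos simple_root)

text \<open>The Cartan numbers \<open>2 (\<alpha>\<^sub>a|\<alpha>\<^sub>b) / (\<alpha>\<^sub>b|\<alpha>\<^sub>b)\<close> make the exponents of the Q-system integers.\<close>

lemma cartan_integer: "2 * root_ip a b / root_ip b b \<in> \<int>"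
proof -
  obtain n :: int where "2 * pair (\<alpha> a) (\<alpha> b) = of_int n * pair (\<alpha> b) (\<alpha> b)"
    using root_reflection[OF simple_root simple_root] by blast
  from arg_cong[OF this, of Re] have "2 * root_ip a b = of_int n * root_ip b b"
    by (simp add: root_ip_def)
  then have "2 * root_ip a b / root_ip b b = of_int n"
    using root_ip_pos[of b] by (simp add: field_simps)
  then show ?thesis by simp
qed

text \<open>A combination of the elements of \<open>\<h>\<close> representing the simple roots on which all simple roots vanish is central.\<close>

lemma root_ip_nondegenerate:
  assumes "\<And>b. (\<Sum>a\<in>UNIV. c a * root_ip a b) = 0"
  shows "c a = 0"
proof -
  define t where "t = (\<Sum>a\<in>UNIV. scale (of_real (c a)) (dual (\<alpha> a)))"
  have th: "t \<in> \<h>"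
    unfolding t_def by (intro subspace_sum[OF h_subspace] subspace_scale[OF h_subspace] dual_in_h simple_root)
  have form_t: "\<kappa> t x = (\<Sum>a\<in>UNIV. of_real (c a) * \<kappa> (dual (\<alpha> a)) x)" for x
  proof -
    have "\<kappa> (\<Sum>a\<in>A. scale (of_real (c a)) (dual (\<alpha> a))) x
      = (\<Sum>a\<in>A. of_real (c a) * \<kappa> (dual (\<alpha> a)) x)" for A
      by (induction A rule: infinite_finite_induct) (auto simp: form_add_left form_scale_left)
    then show ?thesis unfolding t_def .
  qed
  have simple0: "\<alpha> b t = 0" for b
  proof -
    have "\<alpha> b t = \<kappa> t (dual (\<alpha> b))"
      using form_dual[OF simple_root th] form_sym by metis
    also have "\<dots> = (\<Sum>a\<in>UNIV. of_real (c a) * pair (\<alpha> a) (\<alpha> b))"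
      by (simp add: form_t dual_form_def)
    also have "\<dots> = of_real (\<Sum>a\<in>UNIV. c a * root_ip a b)"
      unfolding of_real_sum root_ip_def of_real_mult using pair_real[OF simple_root simple_root] by simp
    finally show ?thesis using assms[of b] by simp
  qed
  have "t = 0"
  proof (rule weights_vanish_eq_0[OF th])
    fix \<beta> assume "is_root \<h> \<beta>"
    then obtain k :: "'n \<Rightarrow> nat" where "\<beta> t = (\<Sum>a\<in>UNIV. of_nat (k a) * \<alpha> a t) \<or> \<beta> t = - (\<Sum>a\<in>UNIV. of_nat (k a) * \<alpha> a t)"
      using simple_roots th unfolding simple_roots_def by meson
    then show "\<beta> t = 0" by (auto simp: simple0)
  qed
  then have lin: "(\<Sum>a\<in>UNIV. of_real (c a) * \<alpha> a x) = 0" if "x \<in> \<h>" for x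
    using form_t[of x] form_dual[OF simple_root that] by simp
  have "(\<forall>x\<in>\<h>. (\<Sum>a\<in>UNIV. d a * \<alpha> a x) = 0) \<longrightarrow> (\<forall>a. d a = 0)" for d
    using simple_roots unfolding simple_roots_def by blast
  from this[of "\<lambda>a. of_real (c a)"] have "complex_of_real (c a) = 0"
    using lin by simp
  then show ?thesis by simp
qed

end

section \<open>Formal power series and their truncations\<close>

lemma mcoeff_zero [simp]: "mcoeff 0 \<beta> = 0" and mcoeff_add [simp]: "mcoeff (f + g) \<beta> = mcoeff f \<beta> + mcoeff g \<beta>"
  and mcoeff_diff [simp]: "mcoeff (f - g) \<beta> = mcoeff f \<beta> - mcoeff g \<beta>"
  and mcoeff_one: "mcoeff 1 \<beta> = (if \<beta> = (\<lambda>_. 0) then 1 else 0)"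
  and mcoeff_mult: "mcoeff (f * g) \<beta> = (\<Sum>(\<gamma>, \<delta>) \<in> {(\<gamma>, \<delta>). \<forall>a. \<gamma> a + \<delta> a = \<beta> a}. mcoeff f \<gamma> * mcoeff g \<delta>)"
  by (transfer, simp)+

lemma mcoeff_sum: "mcoeff (\<Sum>i\<in>I. f i) \<beta> = (\<Sum>i\<in>I. mcoeff (f i) \<beta>)"
  by (induction I rule: infinite_finite_induct) auto

lemma mfps_eqI: "(\<And>\<beta>. mcoeff f \<beta> = mcoeff g \<beta>) \<Longrightarrow> f = g"
  by (metis ext mcoeff_inject)

definition deg :: "('n::finite \<Rightarrow> nat) \<Rightarrow> nat" where
  "deg \<beta> = (\<Sum>a\<in>UNIV. \<beta> a)"

text \<open>Congruence modulo the terms of degree at least \<open>d\<close>, the \<open>d\<close>-th power of the maximal ideal.\<close>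

definition agree :: "nat \<Rightarrow> 'n::finite mfps \<Rightarrow> 'n mfps \<Rightarrow> bool" where
  "agree d f g \<longleftrightarrow> (\<forall>\<beta>. deg \<beta> < d \<longrightarrow> mcoeff f \<beta> = mcoeff g \<beta>)"

lemma agree_refl [simp]: "agree d f f" and agree_0 [simp]: "agree 0 f g"
  by (auto simp: agree_def)

lemma agree_sym: "agree d f g \<Longrightarrow> agree d g f"
  by (auto simp: agree_def)

lemma agree_trans [trans]: "agree d f g \<Longrightarrow> agree d g h \<Longrightarrow> agree d f h"
  by (auto simp: agree_def)

lemma agree_add: "agree d f f' \<Longrightarrow> agree d g g' \<Longrightarrow> agree d (f + g) (f' + g')"
  by (auto simp: agree_def)

lemma agree_iff_diff: "agree d f g \<longleftrightarrow> agree d (f - g) 0"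
  by (auto simp: agree_def)

lemma agree_eqI: "(\<And>d. agree d f g) \<Longrightarrow> f = g"
  unfolding agree_def by (rule mfps_eqI) blast

lemma agree_0_mult:
  assumes "agree m f 0" "agree n g 0"
  shows "agree (m + n) (f * g) 0"
  unfolding agree_def
proof (intro allI impI)
  fix \<beta> :: "'a \<Rightarrow> nat" assume \<beta>: "deg \<beta> < m + n"
  have "mcoeff f \<gamma> * mcoeff g \<delta> = 0" if "\<forall>a. \<gamma> a + \<delta> a = \<beta> a" for \<gamma> \<delta>
  proof -
    have "deg \<gamma> + deg \<delta> = deg \<beta>"
      using that by (simp add: deg_def flip: sum.distrib)
    then have "deg \<gamma> < m \<or> deg \<delta> < n"
      using \<beta> by linarith
    then show ?thesis using assms by (auto simp: agree_def)
  qed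
  then show "mcoeff (f * g) \<beta> = mcoeff 0 \<beta>"
    unfolding mcoeff_mult by (auto intro!: sum.neutral)
qed

lemma agree_mult:
  assumes "agree d f f'" "agree d g g'"
  shows "agree d (f * g) (f' * g')"
proof -
  have "agree (d + 0) ((f - f') * g) 0" "agree (0 + d) (f' * (g - g')) 0"
    using assms by (intro agree_0_mult; simp add: agree_iff_diff[symmetric])+
  then have "agree d ((f - f') * g + f' * (g - g')) (0 + 0)"
    by (intro agree_add) simp_all
  then show ?thesis
    by (subst agree_iff_diff) (simp add: algebra_simps)
qed

text \<open>The inverse is the geometric series in \<open>1 - f\<close>, assembled coefficientwise from its partial sums.\<close>

lemma mfps_unit:
  assumes "mcoeff f (\<lambda>_. 0) = 1"
  shows "f dvd 1"
proof -
  define h where "h = 1 - f"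
  have "\<beta> = (\<lambda>_. 0)" if "deg \<beta> < 1" for \<beta> :: "'a \<Rightarrow> nat"
    using that by (auto simp: deg_def)
  then have h: "agree 1 h 0"
    using assms by (auto simp: agree_def h_def mcoeff_one)
  have hk: "agree k (h ^ k) 0" for k
  proof (induction k)
    case (Suc k)
    show ?case using agree_0_mult[OF h Suc] by simp
  qed simp
  define s where "s d = (\<Sum>k<d. h ^ k)" for d
  define g where "g = Abs_mfps (\<lambda>\<beta>. mcoeff (s (Suc (deg \<beta>))) \<beta>)"
  have "mcoeff (s d) \<beta> = mcoeff (s (Suc (deg \<beta>))) \<beta>" if "deg \<beta> < d" for d \<beta>
  proof -
    have "mcoeff (h ^ k) \<beta> = 0" if "k \<notin> {..<Suc (deg \<beta>)}" for k
      using hk[of k] that by (auto simp: agree_def)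
    then show ?thesis
      unfolding s_def mcoeff_sum using that by (intro sum.mono_neutral_right) auto
  qed
  moreover have "mcoeff g \<beta> = mcoeff (s (Suc (deg \<beta>))) \<beta>" for \<beta>
    by (simp add: g_def Abs_mfps_inverse)
  ultimately have g: "agree d g (s d)" for d
    unfolding agree_def by metis
  have "agree d (f * g) 1" for d
  proof -
    have "agree d (f * g) (f * s d)"
      using g by (intro agree_mult) auto
    also have "f * s d = 1 - h ^ d"
      unfolding s_def one_diff_power_eq by (simp add: h_def)
    also have "agree d (1 - h ^ d) 1"
      using hk[of d] by (simp add: agree_def)
    finally show ?thesis .
  qed
  then have "f * g = 1" by (rule agree_eqI)
  then show ?thesis by (metis dvd_triv_left)
qed

lemma mfps_inverse:
  fixes f :: "'n::finite mfps"
  assumes "f dvd 1"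
  shows "f * inverse f = 1"
proof -
  obtain g where g: "1 = f * g" using assms by (elim dvdE)
  have "(THE g. f * g = 1) = g"
  proof (rule the_equality)
    fix g' assume "f * g' = 1"
    then have "g * (f * g') = g" by simp
    then show "g' = g" using g by (simp add: mult.assoc[symmetric] mult.commute)
  qed (use g in simp)
  then show ?thesis using assms g by (simp add: inverse_mfps_def)
qed

text \<open>The difference \<open>a - b\<close> need not be in reduced form, so that the exponents can be added in the
  numerator and the denominator separately.\<close>

lemma unit_powi_eq:
  fixes x :: "'n::finite mfps"
  assumes "x dvd 1"
  shows "x powi (int a - int b) = x ^ a * inverse x ^ b"
proof -
  have x: "x * inverse x = 1" using assms by (rule mfps_inverse)
  have cancel: "x ^ k * inverse x ^ k = 1" for k
    by (simp add: x flip: power_mult_distrib)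
  show ?thesis
  proof (cases "b \<le> a")
    case True
    then have "x ^ a = x ^ (a - b) * x ^ b"
      by (simp flip: power_add)
    then have "x ^ a * inverse x ^ b = x ^ (a - b)"
      by (simp add: mult.assoc cancel)
    then show ?thesis
      using True by (simp add: power_int_def nat_diff_distrib)
  next
    case False
    then have "inverse x ^ b = inverse x ^ a * inverse x ^ (b - a)"
      by (simp flip: power_add)
    then have "x ^ a * inverse x ^ b = inverse x ^ (b - a)"
      by (simp add: mult.assoc[symmetric] cancel)
    then show ?thesis
      using False by (simp add: power_int_def nat_diff_distrib)
  qed
qed

lemma unit_powi_add:
  fixes x :: "'n::finite mfps"
  assumes "x dvd 1"
  shows "x powi (m + n) = x powi m * x powi n"
proof -
  obtain a b c d where mn: "m = int a - int b" "n = int c - int d"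
    by (metis int_diff_cases)
  then have "m + n = int (a + c) - int (b + d)" by simp
  then show ?thesis
    unfolding mn using assms by (simp only: unit_powi_eq) (simp add: power_add mult_ac)
qed

lemma mcoeff_var_mult:
  "mcoeff (mfps_var a * f) \<beta> = (if \<beta> a = 0 then 0 else mcoeff f (\<beta>(a := \<beta> a - 1)))"
proof -
  let ?S = "{(\<gamma>, \<delta>). \<forall>b. \<gamma> b + \<delta> b = \<beta> b}" and ?e = "\<lambda>b. if b = a then 1 else 0 :: nat"
  have var: "mcoeff (mfps_var a) \<gamma> = (if \<gamma> = ?e then 1 else 0)" for \<gamma>
    by (simp add: mfps_var_def mfps_monom_def Abs_mfps_inverse)
  have "mcoeff (mfps_var a * f) \<beta> = (\<Sum>p\<in>{p \<in> ?S. fst p = ?e}. mcoeff f (snd p))"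
    unfolding mcoeff_mult using finite_exponent_splittings[of \<beta>]
    by (intro sum.mono_neutral_cong_right) (auto simp: var split: if_splits)
  also have "{p \<in> ?S. fst p = ?e} = (if \<beta> a = 0 then {} else {(?e, \<beta>(a := \<beta> a - 1))})"
  proof -
    have iff: "(\<forall>b. ?e b + \<delta> b = \<beta> b) \<longleftrightarrow> \<beta> a \<noteq> 0 \<and> \<delta> = \<beta>(a := \<beta> a - 1)" for \<delta>
    proof
      assume *: "\<forall>b. ?e b + \<delta> b = \<beta> b"
      have "\<delta> b = (\<beta>(a := \<beta> a - 1)) b" for b
        using spec[OF *, of b] by (cases "b = a") auto
      then show "\<beta> a \<noteq> 0 \<and> \<delta> = \<beta>(a := \<beta> a - 1)"
        using spec[OF *, of a] by auto
    qed auto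
    have "{p \<in> ?S. fst p = ?e} = {(\<gamma>, \<delta>). \<gamma> = ?e \<and> (\<forall>b. ?e b + \<delta> b = \<beta> b)}"
    proof (rule Set.set_eqI)
      fix p :: "('a \<Rightarrow> nat) \<times> ('a \<Rightarrow> nat)"
      have "(\<forall>b. \<gamma> b + \<delta> b = \<beta> b) \<and> \<gamma> = \<epsilon> \<longleftrightarrow> \<gamma> = \<epsilon> \<and> (\<forall>b. \<epsilon> b + \<delta> b = \<beta> b)" for \<gamma> \<delta> \<epsilon>
        by auto
      then show "p \<in> {p \<in> ?S. fst p = ?e} \<longleftrightarrow> p \<in> {(\<gamma>, \<delta>). \<gamma> = ?e \<and> (\<forall>b. ?e b + \<delta> b = \<beta> b)}"
        by (cases p) (simp only: mem_Collect_eq case_prod_conv fst_conv)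
    qed
    also have "\<dots> = {(\<gamma>, \<delta>). \<gamma> = ?e \<and> \<beta> a \<noteq> 0 \<and> \<delta> = \<beta>(a := \<beta> a - 1)}"
      by (simp only: iff)
    finally show ?thesis by auto
  qed
  finally show ?thesis by (simp add: fun_upd_def)
qed

lemma mcoeff_var_power_mult:
  "mcoeff (mfps_var a ^ m * f) \<beta> = (if \<beta> a < m then 0 else mcoeff f (\<beta>(a := \<beta> a - m)))"
proof (induction m arbitrary: \<beta>)
  case (Suc m)
  have "mcoeff (mfps_var a ^ Suc m * f) \<beta> = mcoeff (mfps_var a * (mfps_var a ^ m * f)) \<beta>"
    by (simp add: mult.assoc)
  also have "\<dots> = (if \<beta> a < Suc m then 0 else mcoeff f (\<beta>(a := \<beta> a - Suc m)))"
    by (auto simp: mcoeff_var_mult Suc intro!: arg_cong[of _ _ "mcoeff f"])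
  finally show ?case .
qed simp

lemma agree_var_power_mult:
  assumes "agree d f 0" "m \<ge> 1"
  shows "agree (Suc d) (mfps_var a ^ m * f) 0"
  unfolding agree_def
proof (intro allI impI)
  fix \<beta> :: "'a \<Rightarrow> nat" assume "deg \<beta> < Suc d"
  have "deg (\<beta>(a := \<beta> a - m)) < d" if "\<not> \<beta> a < m"
  proof -
    have "deg (\<beta>(a := \<beta> a - m)) + m = deg \<beta>"
      using that unfolding deg_def by (simp add: sum.remove[of UNIV a])
    then show ?thesis using \<open>deg \<beta> < Suc d\<close> assms(2) by linarith
  qed
  then show "mcoeff (mfps_var a ^ m * f) \<beta> = mcoeff 0 \<beta>"
    using assms(1) by (simp add: mcoeff_var_power_mult agree_def)
qed

section \<open>Two determinant identities\<close>

text \<open>Expand each product \<open>\<Prod>i. A i (\<pi> i)\<close> over the set \<open>X\<close> of rows where the second summand is chosen. The diagonal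
  summands in the other rows force \<open>\<pi>\<close> to fix them, so \<open>\<pi>\<close> is a permutation of \<open>X\<close>.\<close>

lemma det_on_diag_plus:
  assumes S: "finite S"
  shows "det_on S (\<lambda>i j. (if i = j then p i else 0) + g i j * n j)
    = (\<Sum>X\<in>Pow S. det_on X g * ((\<Prod>j\<in>X. n j) * (\<Prod>j\<in>S - X. p j)))"
proof -
  have "det_on S (\<lambda>i j. (if i = j then p i else 0) + g i j * n j)
    = (\<Sum>\<pi> | \<pi> permutes S. of_int (sign \<pi>) * (\<Sum>X\<in>Pow S. (\<Prod>i\<in>X. g i (\<pi> i) * n (\<pi> i)) * (\<Prod>i\<in>S - X. if i = \<pi> i then p i else 0)))"
    unfolding det_on_def prod_add[OF S, symmetric] by (simp add: add.commute)
  also have "\<dots> = (\<Sum>X\<in>Pow S. \<Sum>\<pi> | \<pi> permutes S. of_int (sign \<pi>) * ((\<Prod>i\<in>X. g i (\<pi> i) * n (\<pi> i)) * (\<Prod>i\<in>S - X. if i = \<pi> i then p i else 0)))"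
    unfolding sum_distrib_left by (rule sum.swap)
  also have "\<dots> = (\<Sum>X\<in>Pow S. det_on X g * ((\<Prod>j\<in>X. n j) * (\<Prod>j\<in>S - X. p j)))"
  proof (rule sum.cong)
    fix X assume "X \<in> Pow S"
    then have X: "X \<subseteq> S" "finite X" using S finite_subset by auto
    have "(\<Sum>\<pi> | \<pi> permutes S. of_int (sign \<pi>) * ((\<Prod>i\<in>X. g i (\<pi> i) * n (\<pi> i)) * (\<Prod>i\<in>S - X. if i = \<pi> i then p i else 0)))
      = (\<Sum>\<pi> | \<pi> permutes X. of_int (sign \<pi>) * (\<Prod>i\<in>X. g i (\<pi> i)) * ((\<Prod>j\<in>X. n j) * (\<Prod>j\<in>S - X. p j)))"
    proof (rule sum.mono_neutral_cong_right)
      show "finite {\<pi>. \<pi> permutes S}" using S by (rule finite_permutations)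
      show "{\<pi>. \<pi> permutes X} \<subseteq> {\<pi>. \<pi> permutes S}"
        using permutes_subset[OF _ X(1)] by blast
      show "\<forall>\<pi>\<in>{\<pi>. \<pi> permutes S} - {\<pi>. \<pi> permutes X}. of_int (sign \<pi>) * ((\<Prod>i\<in>X. g i (\<pi> i) * n (\<pi> i)) * (\<Prod>i\<in>S - X. if i = \<pi> i then p i else 0)) = 0"
      proof
        fix \<pi> assume \<pi>: "\<pi> \<in> {\<pi>. \<pi> permutes S} - {\<pi>. \<pi> permutes X}"
        then obtain i where "i \<in> S - X" "\<pi> i \<noteq> i"
          using permutes_superset[of \<pi> S X] by blast
        then have "(\<Prod>i\<in>S - X. if i = \<pi> i then p i else 0) = 0"
          using S by (intro prod_zero) (auto intro!: bexI[of _ i])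
        then show "of_int (sign \<pi>) * ((\<Prod>i\<in>X. g i (\<pi> i) * n (\<pi> i)) * (\<Prod>i\<in>S - X. if i = \<pi> i then p i else 0)) = 0"
          by simp
      qed
      fix \<pi> assume "\<pi> \<in> {\<pi>. \<pi> permutes X}"
      then have \<pi>: "\<pi> permutes X" by simp
      have "(\<Prod>i\<in>X. n (\<pi> i)) = (\<Prod>i\<in>X. n i)"
        by (rule prod.reindex_bij_betw[OF permutes_imp_bij[OF \<pi>]])
      moreover have "(\<Prod>i\<in>S - X. if i = \<pi> i then p i else 0) = (\<Prod>i\<in>S - X. p i)"
        by (rule prod.cong) (use permutes_not_in[OF \<pi>] in auto)
      ultimately show "of_int (sign \<pi>) * ((\<Prod>i\<in>X. g i (\<pi> i) * n (\<pi> i)) * (\<Prod>i\<in>S - X. if i = \<pi> i then p i else 0))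
        = of_int (sign \<pi>) * (\<Prod>i\<in>X. g i (\<pi> i)) * ((\<Prod>j\<in>X. n j) * (\<Prod>j\<in>S - X. p j))"
        by (simp add: prod.distrib)
    qed
    also have "\<dots> = det_on X g * ((\<Prod>j\<in>X. n j) * (\<Prod>j\<in>S - X. p j))"
      unfolding det_on_def sum_distrib_right ..
    finally show "(\<Sum>\<pi> | \<pi> permutes S. of_int (sign \<pi>) * ((\<Prod>i\<in>X. g i (\<pi> i) * n (\<pi> i)) * (\<Prod>i\<in>S - X. if i = \<pi> i then p i else 0))) = \<dots>" .
  qed simp
  finally show ?thesis .
qed

text \<open>Composition with the transposition of the two columns pairs off the terms with opposite signs.\<close>

lemma det_on_equal_columns:
  assumes S: "finite S" "j \<in> S" "k \<in> S" "j \<noteq> k" and eq: "\<And>i. i \<in> S \<Longrightarrow> A i j = A i k"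
  shows "det_on S A = 0"
proof -
  let ?t = "transpose j k"
  have t: "?t permutes S" using S by (intro permutes_swap_id)
  have "det_on S A = (\<Sum>\<pi> | \<pi> permutes S. of_int (sign (?t \<circ> \<pi>)) * (\<Prod>i\<in>S. A i ((?t \<circ> \<pi>) i)))"
    unfolding det_on_def
    by (rule sum.reindex_bij_witness[of _ "(\<circ>) ?t" "(\<circ>) ?t"])
       (auto simp: comp_assoc[symmetric] permutes_compose t)
  also have "\<dots> = (\<Sum>\<pi> | \<pi> permutes S. - (of_int (sign \<pi>) * (\<Prod>i\<in>S. A i (\<pi> i))))"
  proof (rule sum.cong)
    fix \<pi> assume "\<pi> \<in> {\<pi>. \<pi> permutes S}"
    then have \<pi>: "\<pi> permutes S" by simp
    have "sign (?t \<circ> \<pi>) = - sign \<pi>"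
      using S \<pi> t by (simp add: sign_compose sign_swap_id permutation_swap_id permutes_imp_permutation[OF S(1)])
    moreover have "(\<Prod>i\<in>S. A i ((?t \<circ> \<pi>) i)) = (\<Prod>i\<in>S. A i (\<pi> i))"
      by (rule prod.cong) (auto simp: transpose_def eq)
    ultimately show "of_int (sign (?t \<circ> \<pi>)) * (\<Prod>i\<in>S. A i ((?t \<circ> \<pi>) i)) = - (of_int (sign \<pi>) * (\<Prod>i\<in>S. A i (\<pi> i)))"
      by simp
  qed simp
  also have "\<dots> = - det_on S A"
    unfolding det_on_def by (simp add: sum_negf)
  finally show ?thesis by simp
qed

text \<open>Replacing one column by the sum of all columns changes the determinant only by determinants with two equal
  columns; the new column is zero.\<close>

lemma det_on_row_sums_0:
  assumes S: "finite S" "S \<noteq> {}" and rows: "\<And>i. i \<in> S \<Longrightarrow> (\<Sum>j\<in>S. A i j) = 0"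
  shows "det_on S A = 0"
proof -
  obtain j0 where j0: "j0 \<in> S" using S by blast
  let ?B = "\<lambda>k i j. if j = j0 then A i k else A i j"
  have "(\<Sum>k\<in>S. det_on S (?B k)) = (\<Sum>\<pi> | \<pi> permutes S. of_int (sign \<pi>) * (\<Sum>k\<in>S. \<Prod>i\<in>S. ?B k i (\<pi> i)))"
    unfolding det_on_def sum_distrib_left by (rule sum.swap)
  also have "\<dots> = 0"
  proof (rule sum.neutral, rule ballI)
    fix \<pi> assume "\<pi> \<in> {\<pi>. \<pi> permutes S}"
    then have \<pi>: "\<pi> permutes S" by simp
    obtain i0 where i0: "i0 \<in> S" "\<pi> i0 = j0"
      using permutes_image[OF \<pi>] j0 by (metis imageE)
    have ne: "\<pi> i \<noteq> j0" if "i \<in> S - {i0}" for i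
      using that i0 inj_eq[OF permutes_inj[OF \<pi>]] by auto
    have "(\<Sum>k\<in>S. \<Prod>i\<in>S. ?B k i (\<pi> i)) = (\<Sum>k\<in>S. A i0 k * (\<Prod>i\<in>S - {i0}. A i (\<pi> i)))"
    proof (rule sum.cong)
      fix k
      have "(\<Prod>i\<in>S - {i0}. ?B k i (\<pi> i)) = (\<Prod>i\<in>S - {i0}. A i (\<pi> i))"
        by (rule prod.cong) (use ne in auto)
      then show "(\<Prod>i\<in>S. ?B k i (\<pi> i)) = A i0 k * (\<Prod>i\<in>S - {i0}. A i (\<pi> i))"
        using i0 prod.remove[OF S(1) i0(1), of "\<lambda>i. ?B k i (\<pi> i)"] by simp
    qed simp
    also have "\<dots> = 0"
      using rows[OF i0(1)] by (simp flip: sum_distrib_right)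
    finally show "of_int (sign \<pi>) * (\<Sum>k\<in>S. \<Prod>i\<in>S. ?B k i (\<pi> i)) = 0" by simp
  qed
  finally have "(\<Sum>k\<in>S. det_on S (?B k)) = 0" .
  moreover have "det_on S (?B k) = 0" if "k \<in> S - {j0}" for k
    using that j0 S by (intro det_on_equal_columns[of S j0 k]) auto
  moreover have "?B j0 = A" by (auto simp: fun_eq_iff)
  ultimately show ?thesis
    using sum.remove[OF S(1) j0, of "\<lambda>k. det_on S (?B k)"] by simp
qed

section \<open>The recursion and its uniqueness\<close>

definition unit_at :: "'h \<Rightarrow> 'h \<Rightarrow> 'a::zero_neq_one" where
  "unit_at h = (\<lambda>x. if x = h then 1 else 0)"

definition fin_supp :: "('h \<Rightarrow> 'a::zero) set" where
  "fin_supp = {\<nu>. finite {h. \<nu> h \<noteq> 0}}"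

lemma fin_supp_0 [simp]: "0 \<in> fin_supp"
  by (simp add: fin_supp_def)

lemma fin_supp_unit_at [simp]: "unit_at h \<in> fin_supp"
  by (simp add: fin_supp_def unit_at_def)

lemma fin_supp_add [simp]:
  fixes \<nu> \<mu> :: "'h \<Rightarrow> 'a::monoid_add"
  shows "\<nu> \<in> fin_supp \<Longrightarrow> \<mu> \<in> fin_supp \<Longrightarrow> \<nu> + \<mu> \<in> fin_supp"
  unfolding fin_supp_def mem_Collect_eq
  by (rule finite_subset[of _ "{h. \<nu> h \<noteq> 0} \<union> {h. \<mu> h \<noteq> 0}"]) auto

lemma fin_supp_diff [simp]:
  fixes \<nu> \<mu> :: "'h \<Rightarrow> 'a::group_add"
  shows "\<nu> \<in> fin_supp \<Longrightarrow> \<mu> \<in> fin_supp \<Longrightarrow> \<nu> - \<mu> \<in> fin_supp"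
  unfolding fin_supp_def mem_Collect_eq
  by (rule finite_subset[of _ "{h. \<nu> h \<noteq> 0} \<union> {h. \<mu> h \<noteq> 0}"]) auto

text \<open>In direction \<open>a\<close> this is column \<open>m\<close> of the Cartan matrix of type \<open>A\<^sub>\<infinity>\<close>; the summand at level 0 is harmless,
  as \<open>Q\<^sub>0 = 1\<close>.\<close>

definition cartan_A :: "'n \<Rightarrow> nat \<Rightarrow> 'n \<times> nat \<Rightarrow> int" where
  "cartan_A a m = unit_at (a, m) + unit_at (a, m) - unit_at (a, m - 1) - unit_at (a, m + 1)"

lemma cartan_A_fin_supp [simp]: "cartan_A a m \<in> fin_supp"
  unfolding cartan_A_def by (intro fin_supp_add fin_supp_diff fin_supp_unit_at)

text \<open>Assume that all \<open>A(\<nu>)\<close> vanish below degree \<open>d\<close>. In degree \<open>d\<close> the second term of the recursion is then zero. Writing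
  \<open>u\<^sub>m = e\<^bsub>m+1\<^esub> - e\<^sub>m\<close>, the recursion says that translations by \<open>u\<^sub>m\<close> and \<open>u\<^bsub>m-1\<^esub>\<close> have the same effect, and
  \<open>stable\<close> says that \<open>u\<^sub>m\<close> has none for large \<open>m\<close>. By descending induction no \<open>u\<^sub>m\<close> has any effect, hence no \<open>e\<^sub>m\<close>, and
  \<open>A\<close> is constant.\<close>

lemma q_recursion_unique:
  fixes A :: "('n::finite \<times> nat \<Rightarrow> int) \<Rightarrow> 'n mfps"
  assumes rec: "\<And>\<nu> a m. \<nu> \<in> fin_supp \<Longrightarrow> m \<ge> 1 \<Longrightarrow>
      A \<nu> = A (\<nu> - cartan_A a m) + mfps_var a ^ m * A (\<nu> - b a m)"
    and b: "\<And>a m. m \<ge> 1 \<Longrightarrow> b a m \<in> fin_supp"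
    and stable: "\<And>d. \<exists>M. \<forall>m\<ge>M. \<forall>a. \<forall>\<nu>\<in>fin_supp.
      agree d (A (\<nu> + unit_at (a, m + 1))) (A (\<nu> + unit_at (a, m)))"
    and level0: "\<And>\<nu> a. \<nu> \<in> fin_supp \<Longrightarrow> A (\<nu> + unit_at (a, 0)) = A \<nu>"
    and A0: "A 0 = 0" and \<nu>: "\<nu> \<in> fin_supp"
  shows "A \<nu> = 0"
proof -
  have "\<forall>\<nu>\<in>fin_supp. agree d (A \<nu>) 0" for d
  proof (induction d)
    case (Suc d)
    have shift: "agree (Suc d) (A \<nu>) (A (\<nu> - cartan_A a m))" if "\<nu> \<in> fin_supp" "m \<ge> 1" for \<nu> a m
    proof -
      have "agree (Suc d) (mfps_var a ^ m * A (\<nu> - b a m)) 0"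
        using that b Suc by (intro agree_var_power_mult) auto
      then have "agree (Suc d) (A (\<nu> - cartan_A a m) + mfps_var a ^ m * A (\<nu> - b a m)) (A (\<nu> - cartan_A a m) + 0)"
        by (intro agree_add) auto
      then show ?thesis
        by (simp add: rec[OF that, symmetric])
    qed
    obtain M where M: "\<And>m a \<nu>. m \<ge> M \<Longrightarrow> \<nu> \<in> fin_supp \<Longrightarrow>
        agree (Suc d) (A (\<nu> + unit_at (a, m + 1))) (A (\<nu> + unit_at (a, m)))"
      using stable[of "Suc d"] by blast
    have up: "agree (Suc d) (A (\<nu> + unit_at (a, m + 1))) (A (\<nu> + unit_at (a, m)))"
      if "\<nu> \<in> fin_supp" for \<nu> a m
    proof (cases "M \<le> m")
      case False
      then have "m \<le> M" by simp
      then show ?thesis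
        using that
      proof (induction arbitrary: \<nu> rule: inc_induct)
        case base
        show ?case by (rule M[OF order_refl base])
      next
        case (step m)
        let ?e = "\<lambda>j. unit_at (a, j) :: _ \<Rightarrow> int"
        have "agree (Suc d) (A (\<nu> + ?e (m + 1))) (A (\<nu> + ?e (m + 1) - cartan_A a (m + 1)))"
          using step by (intro shift) auto
        also have "\<nu> + ?e (m + 1) - cartan_A a (m + 1) = (\<nu> - ?e (m + 1) + ?e m) + ?e (m + 1 + 1)"
          by (simp add: cartan_A_def fun_eq_iff)
        also have "agree (Suc d) (A \<dots>) (A ((\<nu> - ?e (m + 1) + ?e m) + ?e (m + 1)))"
        proof -
          have "\<nu> - ?e (m + 1) + ?e m \<in> fin_supp"
            by (intro fin_supp_add fin_supp_diff fin_supp_unit_at step.prems)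
          from step.IH[OF this] show ?thesis
            by (simp only: Suc_eq_plus1)
        qed
        also have "(\<nu> - ?e (m + 1) + ?e m) + ?e (m + 1) = \<nu> + ?e m"
          by (simp add: fun_eq_iff)
        finally show ?case .
      qed
    qed (use that M in blast)
    have add_unit: "agree (Suc d) (A (\<nu> + unit_at (a, m))) (A \<nu>)" if "\<nu> \<in> fin_supp" for \<nu> a m
    proof (induction m)
      case 0
      show ?case unfolding level0[OF that] by simp
    next
      case (Suc m)
      from agree_trans[OF up[OF that, of a m] Suc] show ?case
        by (simp only: Suc_eq_plus1)
    qed
    have add_mult: "agree (Suc d) (A (\<nu> + (\<lambda>x. int k * unit_at h x))) (A \<nu>)" if "\<nu> \<in> fin_supp" for \<nu> h k
    proof (induction k)
      case (Suc k)
      let ?\<mu> = "\<nu> + (\<lambda>x. int k * unit_at h x)"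
      have \<mu>: "?\<mu> \<in> fin_supp"
        by (rule fin_supp_add[OF that]) (simp add: fin_supp_def unit_at_def)
      have eq: "\<nu> + (\<lambda>x. int (Suc k) * unit_at h x) = ?\<mu> + unit_at h"
        by (simp add: fun_eq_iff algebra_simps)
      show ?case
        unfolding eq
        by (rule agree_trans[OF add_unit[OF \<mu>, of "fst h" "snd h", unfolded prod.collapse] Suc])
    qed (simp add: plus_fun_def)
    have drop: "agree (Suc d) (A \<nu>) (A (\<nu>(h := 0)))" if "\<nu> \<in> fin_supp" for \<nu> h
    proof -
      have z: "\<nu>(h := 0) \<in> fin_supp"
        using that unfolding fin_supp_def by (auto elim: rev_finite_subset)
      show ?thesis
      proof (cases "\<nu> h \<ge> 0")
        case True
        then have "\<nu> = \<nu>(h := 0) + (\<lambda>x. int (nat (\<nu> h)) * unit_at h x)"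
          by (auto simp: fun_eq_iff unit_at_def)
        then show ?thesis using add_mult[OF z, of "nat (\<nu> h)" h] by metis
      next
        case False
        then have "\<nu>(h := 0) = \<nu> + (\<lambda>x. int (nat (- \<nu> h)) * unit_at h x)"
          by (auto simp: fun_eq_iff unit_at_def)
        then show ?thesis using agree_sym[OF add_mult[OF that, of "nat (- \<nu> h)" h]] by metis
      qed
    qed
    have "agree (Suc d) (A \<nu>) 0" if "finite T" "{h. \<nu> h \<noteq> 0} \<subseteq> T" for T and \<nu> :: "'n \<times> nat \<Rightarrow> int"
      using that
    proof (induction T arbitrary: \<nu> rule: finite_induct)
      case empty
      then have "\<nu> = 0" by (auto simp: fun_eq_iff)
      show ?case unfolding \<open>\<nu> = 0\<close> A0 by (rule agree_refl)
    next
      case (insert h T)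
      have "\<nu> \<in> fin_supp"
        using insert.prems insert.hyps(1) unfolding fin_supp_def by (auto elim: finite_subset)
      then have "agree (Suc d) (A \<nu>) (A (\<nu>(h := 0)))" by (rule drop)
      also have "agree (Suc d) (A (\<nu>(h := 0))) 0"
        by (rule insert.IH) (use insert.prems in auto)
      finally show ?case .
    qed
    then show ?case unfolding fin_supp_def by auto
  qed simp
  then show ?thesis using \<nu> by (intro agree_eqI) blast
qed

section \<open>The numbers gamma and the exponents of the Q-system\<close>

text \<open>The numbers \<open>\<gamma>\<close> as a linear function on integer families; real values, because the vacancy numbers, into which
  they enter, are real.\<close>

definition gam_int :: "('n \<times> nat \<Rightarrow> int) \<Rightarrow> 'n \<times> nat \<Rightarrow> real" where
  "gam_int \<nu> = (\<lambda>(a, m). \<Sum>k | \<nu> (a, k) \<noteq> 0. real (min m k) * real_of_int (\<nu> (a, k)))"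

lemma fin_supp_row:
  assumes "\<nu> \<in> fin_supp"
  shows "finite {k. \<nu> (a, k) \<noteq> 0}"
proof -
  have "finite ((\<lambda>k. (a, k)) -` {h. \<nu> h \<noteq> 0})"
    using assms by (intro finite_vimageI) (auto simp: fin_supp_def inj_def)
  then show ?thesis by (simp add: vimage_def)
qed

lemma gam_int_eq:
  assumes "finite T" "\<And>k. k \<notin> T \<Longrightarrow> \<nu> (a, k) = 0"
  shows "gam_int \<nu> (a, m) = (\<Sum>k\<in>T. real (min m k) * real_of_int (\<nu> (a, k)))"
  unfolding gam_int_def case_prod_conv using assms by (intro sum.mono_neutral_left) auto

lemma gam_int_add:
  assumes "\<nu> \<in> fin_supp" "\<mu> \<in> fin_supp"
  shows "gam_int (\<nu> + \<mu>) h = gam_int \<nu> h + gam_int \<mu> h"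
proof (cases h)
  case (Pair a m)
  define T where "T = {k. \<nu> (a, k) \<noteq> 0} \<union> {k. \<mu> (a, k) \<noteq> 0}"
  have T: "finite T" unfolding T_def by (intro finite_UnI fin_supp_row assms)
  have row: "gam_int f (a, m) = (\<Sum>k\<in>T. real (min m k) * real_of_int (f (a, k)))"
    if "\<And>k. k \<notin> T \<Longrightarrow> f (a, k) = 0" for f
    using T that by (rule gam_int_eq)
  have "gam_int (\<nu> + \<mu>) (a, m) = (\<Sum>k\<in>T. real (min m k) * real_of_int ((\<nu> + \<mu>) (a, k)))"
    by (rule row) (auto simp: T_def)
  also have "\<dots> = gam_int \<nu> (a, m) + gam_int \<mu> (a, m)"
    unfolding plus_fun_apply of_int_add distrib_left sum.distrib
    using row[of \<nu>] row[of \<mu>] by (simp add: T_def)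
  finally show ?thesis
    unfolding Pair .
qed

lemma gam_int_diff:
  assumes "\<nu> \<in> fin_supp" "\<mu> \<in> fin_supp"
  shows "gam_int (\<nu> - \<mu>) h = gam_int \<nu> h - gam_int \<mu> h"
proof -
  have "gam_int (\<nu> - \<mu> + \<mu>) h = gam_int (\<nu> - \<mu>) h + gam_int \<mu> h"
    by (intro gam_int_add fin_supp_diff assms)
  moreover have "\<nu> - \<mu> + \<mu> = \<nu>"
    by (simp add: fun_eq_iff)
  ultimately show ?thesis by (simp only:)
qed

lemma gam_int_unit_at: "gam_int (unit_at (b, j)) (a, m) = (if a = b then real (min m j) else 0)"
  by (subst gam_int_eq[of "{j}"]) (auto simp: unit_at_def)

lemma gam_int_0: "gam_int 0 = 0"
  by (auto simp: gam_int_def fun_eq_iff)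

lemma gam_int_cartan_A:
  fixes a :: 'n
  assumes m: "m \<ge> 1"
  shows "gam_int (cartan_A a m) = unit_at (a, m)"
proof
  fix h :: "'n \<times> nat"
  obtain b j where h: "h = (b, j)" by (cases h)
  have "gam_int (cartan_A a m) h = gam_int (unit_at (a, m)) h + gam_int (unit_at (a, m)) h
      - gam_int (unit_at (a, m - 1)) h - gam_int (unit_at (a, m + 1)) h"
    unfolding cartan_A_def
    by (simp only: gam_int_add gam_int_diff fin_supp_add fin_supp_diff fin_supp_unit_at)
  also have "\<dots> = unit_at (a, m) h"
    using m unfolding h gam_int_unit_at by (auto simp: unit_at_def min_def)
  finally show "gam_int (cartan_A a m) h = unit_at (a, m) h" .
qed

text \<open>Summation by parts. The kernel \<open>min j k\<close> is the Green function of the negative second difference.\<close>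

lemma sum_min_second_difference:
  fixes f :: "nat \<Rightarrow> real"
  shows "(\<Sum>k=1..K. real (min j k) * (2 * f k - f (k + 1) - f (k - 1)))
    = f (min j K) - f 0 + real (min j K) * (f K - f (K + 1))"
proof (induction K)
  case (Suc K)
  show ?case
  proof (cases "j \<le> K")
    case True
    then show ?thesis using Suc by (simp add: min_absorb1 algebra_simps)
  next
    case False
    then have "min j (Suc K) = Suc K" "min j K = K" by auto
    then show ?thesis using Suc by (simp add: algebra_simps)
  qed
qed simp

text \<open>The shift of \<open>\<nu>\<close> in the second term of the recursion.\<close>

definition ipB_row :: "('n \<Rightarrow> 'n \<Rightarrow> real) \<Rightarrow> 'n \<times> nat \<Rightarrow> 'n \<times> nat \<Rightarrow> int" where
  "ipB_row ip h = (\<lambda>h'. if h' \<in> HH then ipB ip h h' else 0)"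

text \<open>The properties of the Gram matrix of the simple roots on which the power series identities rest.\<close>

locale cartan_form =
  fixes ip :: "'n::finite \<Rightarrow> 'n \<Rightarrow> real"
  assumes ip_sym: "ip a b = ip b a"
    and ip_pos: "ip a a > 0"
    and ip_int: "2 * ip a b / ip b b \<in> \<int>"
begin

lemma tt_pos: "tt ip a > 0"
  using ip_pos by (simp add: tt_def)

lemma ip_min_sym: "ip_min ip h h' = ip_min ip h' h"
  by (cases h; cases h') (simp add: ip_min_def ip_sym min.commute)

lemma ip_min_int: "ip_min ip (a, m) (b, k) \<in> \<int>"
proof -
  have int: "ip a b * tt ip b \<in> \<int>" "ip a b * tt ip a \<in> \<int>"
    using ip_int[of a b] ip_int[of b a] ip_sym[of a b] by (simp_all add: tt_def mult.commute)
  have "ip a b * (tt ip b * real m) \<in> \<int>" "ip a b * (tt ip a * real k) \<in> \<int>"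
    using Ints_mult[OF int(1) Ints_of_nat[of m]] Ints_mult[OF int(2) Ints_of_nat[of k]]
    by (simp_all only: mult.assoc)
  then show ?thesis by (simp add: ip_min_def min_def)
qed

lemma ip_min_0: "ip_min ip (a, m) (b, 0) = 0"
  using tt_pos[of b] by (simp add: ip_min_def min_def not_le order.antisym)

lemma ipB_eq:
  assumes "k \<ge> 1"
  shows "real_of_int (ipB ip (a, m) (b, k))
    = 2 * ip_min ip (a, m) (b, k) - ip_min ip (a, m) (b, k + 1) - ip_min ip (a, m) (b, k - 1)" (is "_ = ?r")
proof -
  have "ip a b * BB ip (a, m) (b, k) = ?r"
    using assms by (simp add: BB_def ip_min_def of_nat_diff algebra_simps)
  moreover have "?r \<in> \<int>"
    by (intro Ints_diff Ints_mult ip_min_int) auto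
  ultimately show ?thesis
    by (simp add: ipB_def)
qed

text \<open>Beyond the level where the minimum is attained at \<open>t\<^sub>b m\<close>, the second differences in \<open>B\<close> vanish, so the
  product in the Q-system is finite.\<close>

lemma ip_min_eventually_constant:
  "\<exists>K. \<forall>k\<ge>K. \<forall>b. ip_min ip (a, m) (b, k) = ip a b * (tt ip b * real m)"
proof -
  define K where "K = nat \<lceil>Max (range (\<lambda>b. tt ip b * real m / tt ip a))\<rceil>"
  have "tt ip b * real m \<le> tt ip a * real k" if "k \<ge> K" for b k
  proof -
    have "tt ip b * real m / tt ip a \<le> Max (range (\<lambda>b. tt ip b * real m / tt ip a))"
      by (intro Max_ge) auto
    also have "\<dots> \<le> real K"
      unfolding K_def by linarith
    also have "\<dots> \<le> real k"
      using that by simp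
    finally show ?thesis
      using tt_pos[of a] by (simp add: field_simps)
  qed
  then show ?thesis
    by (intro exI[of _ K]) (simp add: ip_min_def min_absorb1)
qed

text \<open>The \<open>B\<close>-numbers are the negative second differences of \<open>min (t\<^sub>b m) (t\<^sub>a k)\<close> in \<open>k\<close>; summation by parts recovers the
  minimum, the boundary terms being zero.\<close>

lemma ipB_row_fin_supp [simp]: "ipB_row ip (a, m) \<in> fin_supp"
  and gam_int_ipB_row: "gam_int (ipB_row ip (a, m)) = ip_min ip (a, m)"
proof -
  obtain K where K: "\<And>k b. k \<ge> K \<Longrightarrow> ip_min ip (a, m) (b, k) = ip a b * (tt ip b * real m)"
    using ip_min_eventually_constant by blast
  have zero: "ipB_row ip (a, m) (b, k) = 0" if "k \<notin> {1..K}" for b k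
  proof (cases "k = 0")
    case False
    then have "k \<ge> 1" by simp
    then have "real_of_int (ipB ip (a, m) (b, k)) = 0"
      using that by (simp add: ipB_eq K)
    then show ?thesis by (simp add: ipB_row_def)
  qed (simp add: ipB_row_def HH_def)
  have "{h. ipB_row ip (a, m) h \<noteq> 0} \<subseteq> UNIV \<times> {1..K}"
    using zero by (metis (mono_tags, lifting) SigmaI UNIV_I mem_Collect_eq prod.collapse subsetI)
  then show "ipB_row ip (a, m) \<in> fin_supp"
    unfolding fin_supp_def by (auto intro: finite_subset)
  show "gam_int (ipB_row ip (a, m)) = ip_min ip (a, m)"
  proof
    fix h :: "'n \<times> nat"
    obtain b j where h: "h = (b, j)" by (cases h)
    define L where "L = max j K"
    let ?f = "\<lambda>k. ip_min ip (a, m) (b, k)"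
    have "gam_int (ipB_row ip (a, m)) (b, j) = (\<Sum>k=1..L. real (min j k) * real_of_int (ipB_row ip (a, m) (b, k)))"
      by (rule gam_int_eq) (auto intro: zero simp: L_def)
    also have "\<dots> = (\<Sum>k=1..L. real (min j k) * (2 * ?f k - ?f (k + 1) - ?f (k - 1)))"
      by (intro sum.cong refl arg_cong2[of _ _ _ _ "(*)"]) (simp add: ipB_row_def HH_def ipB_eq)
    also have "\<dots> = ?f (min j L) - ?f 0 + real (min j L) * (?f L - ?f (L + 1))"
      by (rule sum_min_second_difference)
    also have "\<dots> = ?f j"
      by (simp add: L_def K ip_min_0)
    finally show "gam_int (ipB_row ip (a, m)) h = ip_min ip (a, m) h"
      by (simp add: h)
  qed
qed

end

section \<open>The monomials in the canonical solution\<close>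

definition Q_power :: "('h \<Rightarrow> 'n::finite mfps) \<Rightarrow> ('h \<Rightarrow> int) \<Rightarrow> 'n mfps" where
  "Q_power Q \<nu> = (\<Prod>h | \<nu> h \<noteq> 0. Q h powi \<nu> h)"

lemma Q_power_eq:
  assumes "finite T" "\<And>h. h \<notin> T \<Longrightarrow> \<nu> h = 0"
  shows "Q_power Q \<nu> = (\<Prod>h\<in>T. Q h powi \<nu> h)"
  unfolding Q_power_def using assms by (intro prod.mono_neutral_left) auto

lemma Q_power_0: "Q_power Q 0 = 1"
  by (simp add: Q_power_def)

lemma Q_power_unit_at: "Q_power Q (unit_at h) = Q h"
  by (subst Q_power_eq[of "{h}"]) (auto simp: unit_at_def)

lemma Q_power_add:
  assumes "\<And>h. Q h dvd 1" "\<nu> \<in> fin_supp" "\<mu> \<in> fin_supp"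
  shows "Q_power Q (\<nu> + \<mu>) = Q_power Q \<nu> * Q_power Q \<mu>"
proof -
  define T where "T = {h. \<nu> h \<noteq> 0} \<union> {h. \<mu> h \<noteq> 0}"
  have T: "finite T" using assms by (auto simp: fin_supp_def T_def)
  have "Q_power Q f = (\<Prod>h\<in>T. Q h powi f h)" if "f = \<nu> \<or> f = \<mu> \<or> f = \<nu> + \<mu>" for f
    by (rule Q_power_eq[OF T]) (use that in \<open>auto simp: T_def\<close>)
  note * = this
  show ?thesis
    using *[of \<nu>] *[of \<mu>] *[of "\<nu> + \<mu>"]
    by (simp only: plus_fun_apply unit_powi_add[OF assms(1)] prod.distrib simp_thms)
qed

locale q_system = cartan_form ip for ip :: "'n::finite \<Rightarrow> 'n \<Rightarrow> real" +
  fixes Q :: "'n \<times> nat \<Rightarrow> 'n mfps"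
  assumes canonical: "canonical_solution ip Q"
begin

lemma Q_0: "Q (a, 0) = 1"
  and Q_eq: "m \<ge> 1 \<Longrightarrow> (Q (a, m))\<^sup>2 = Q (a, m + 1) * Q (a, m - 1)
          + mfps_var a ^ m * (Q (a, m))\<^sup>2
            * (\<Prod>h' | h' \<in> HH \<and> ipB ip (a, m) h' \<noteq> 0. Q h' powi (- ipB ip (a, m) h'))"
  and Q_lim: "\<exists>L. yadic_tendsto (\<lambda>m. Q (a, m)) L"
  using canonical by (auto simp: canonical_solution_def HH_def)

lemma Q_unit: "Q h dvd 1"
proof (cases "h \<in> HH")
  case True
  then show ?thesis using canonical by (auto simp: canonical_solution_def)
next
  case False
  then have "snd h = 0" by (cases h) (auto simp: HH_def)
  then show ?thesis using Q_0[of "fst h"] by (metis prod.collapse one_dvd)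
qed

lemma Q_add: "\<nu> \<in> fin_supp \<Longrightarrow> \<mu> \<in> fin_supp \<Longrightarrow> Q_power Q (\<nu> + \<mu>) = Q_power Q \<nu> * Q_power Q \<mu>"
  by (rule Q_power_add[OF Q_unit])

text \<open>The equation of the Q-system at \<open>(a, m)\<close>, multiplied by \<open>Q\<close> to the power \<open>\<nu> - 2 e\<^bsub>am\<^esub>\<close>.\<close>

lemma Q_power_recursion:
  assumes \<nu>: "\<nu> \<in> fin_supp" and m: "m \<ge> 1"
  shows "Q_power Q \<nu> = Q_power Q (\<nu> - cartan_A a m) + mfps_var a ^ m * Q_power Q (\<nu> - ipB_row ip (a, m))"
proof -
  let ?e = "\<lambda>j. unit_at (a, j) :: _ \<Rightarrow> int" and ?b = "ipB_row ip (a, m)"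
  \<comment> \<open>All three shifts of \<open>\<nu>\<close> are expressed through \<open>\<mu>\<close>, the exponent of the common factor.\<close>
  define \<mu> where "\<mu> = \<nu> - ?e m - ?e m"
  have \<mu>: "\<mu> \<in> fin_supp"
    unfolding \<mu>_def by (intro fin_supp_diff fin_supp_unit_at \<nu>)
  have nb: "0 - ?b \<in> fin_supp"
    by (intro fin_supp_diff fin_supp_0 ipB_row_fin_supp)
  have fs: "\<mu> + ?e j \<in> fin_supp" for j
    by (intro fin_supp_add \<mu> fin_supp_unit_at)
  have \<nu>_eq: "\<nu> = \<mu> + ?e m + ?e m" and \<nu>A: "\<nu> - cartan_A a m = \<mu> + ?e (m + 1) + ?e (m - 1)"
    and \<nu>b: "\<nu> - ?b = \<mu> + ?e m + ?e m + (0 - ?b)"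
    by (simp_all add: \<mu>_def cartan_A_def fun_eq_iff)
  have qb: "Q_power Q (0 - ?b) = (\<Prod>h' | h' \<in> HH \<and> ipB ip (a, m) h' \<noteq> 0. Q h' powi (- ipB ip (a, m) h'))"
    unfolding Q_power_def by (rule prod.cong) (auto simp: ipB_row_def)
  have "Q_power Q \<nu> = Q_power Q \<mu> * (Q (a, m))\<^sup>2"
    unfolding \<nu>_eq Q_add[OF fs fin_supp_unit_at] Q_add[OF \<mu> fin_supp_unit_at] Q_power_unit_at
    by (simp add: power2_eq_square mult.assoc)
  also have "\<dots> = Q_power Q \<mu> * Q (a, m + 1) * Q (a, m - 1)
      + mfps_var a ^ m * (Q_power Q \<mu> * Q (a, m) * Q (a, m) * Q_power Q (0 - ?b))"
    by (subst Q_eq[OF m]) (simp only: qb power2_eq_square distrib_left mult_ac)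
  also have "Q_power Q \<mu> * Q (a, m + 1) * Q (a, m - 1) = Q_power Q (\<nu> - cartan_A a m)"
    unfolding \<nu>A Q_add[OF fs fin_supp_unit_at] Q_add[OF \<mu> fin_supp_unit_at] Q_power_unit_at ..
  also have "Q_power Q \<mu> * Q (a, m) * Q (a, m) * Q_power Q (0 - ?b) = Q_power Q (\<nu> - ?b)"
    unfolding \<nu>b Q_add[OF fin_supp_add[OF fs fin_supp_unit_at] nb] Q_add[OF fs fin_supp_unit_at]
      Q_add[OF \<mu> fin_supp_unit_at] Q_power_unit_at ..
  finally show ?thesis .
qed

text \<open>One bound serves all \<open>a\<close>, since the index set is finite.\<close>

lemma Q_stable: "\<exists>M. \<forall>m\<ge>M. \<forall>a. agree d (Q (a, m + 1)) (Q (a, m))"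
proof -
  have "\<forall>a. \<exists>M. \<forall>m\<ge>M. agree d (Q (a, m + 1)) (Q (a, m))"
  proof
    fix a
    obtain L where "yadic_tendsto (\<lambda>m. Q (a, m)) L" using Q_lim by blast
    then obtain M where "\<forall>m\<ge>M. agree d (Q (a, m)) L"
      unfolding yadic_tendsto_def agree_def deg_def by blast
    then have "\<forall>m\<ge>M. agree d (Q (a, m + 1)) (Q (a, m))"
      by (meson agree_sym agree_trans le_add1 order_trans)
    then show "\<exists>M. \<forall>m\<ge>M. agree d (Q (a, m + 1)) (Q (a, m))" ..
  qed
  then obtain M where M: "\<And>a m. m \<ge> M a \<Longrightarrow> agree d (Q (a, m + 1)) (Q (a, m))"
    by metis
  have "M a \<le> Max (range M)" for a
    by (intro Max_ge) auto
  then show ?thesis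
    using M by (meson order_trans)
qed

end

section \<open>Series over families that satisfy Pascal's rule\<close>

definition families_of_weight :: "('n::finite \<Rightarrow> nat) \<Rightarrow> ('n \<times> nat \<Rightarrow> nat) set" where
  "families_of_weight \<beta> = {N \<in> families. weight N = \<beta>}"

lemma family_fin_supp: "N \<in> families \<Longrightarrow> N \<in> fin_supp"
  by (simp add: families_def fin_supp_def)

lemma weight_eq:
  assumes "finite T" "\<And>m. m \<notin> T \<Longrightarrow> N (a, m) = 0"
  shows "weight N a = (\<Sum>m\<in>T. m * N (a, m))"
proof -
  have "{m. N (a, m) \<noteq> 0} \<subseteq> T"
  proof
    fix m assume "m \<in> {m. N (a, m) \<noteq> 0}"
    then show "m \<in> T" using assms(2)[of m] by (cases "m \<in> T") simp_all
  qed
  then show ?thesis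
    unfolding weight_def by (intro sum.mono_neutral_left assms) auto
qed

lemma weight_add_unit_at:
  assumes "N \<in> fin_supp"
  shows "weight (N + unit_at (a, m)) = (weight N)(a := weight N a + m)"
proof
  fix b
  define T where "T = insert m {k. N (b, k) \<noteq> 0}"
  have T: "finite T" unfolding T_def using fin_supp_row[OF assms] by simp
  have N: "weight N b = (\<Sum>k\<in>T. k * N (b, k))"
    using T by (rule weight_eq) (simp add: T_def)
  have "weight (N + unit_at (a, m)) b = (\<Sum>k\<in>T. k * (N + unit_at (a, m)) (b, k))"
    using T by (rule weight_eq) (simp add: T_def unit_at_def)
  also have "\<dots> = (\<Sum>k\<in>T. k * N (b, k)) + (\<Sum>k\<in>T. if k = m then (if b = a then m else 0) else 0)"
    by (simp only: plus_fun_apply distrib_left sum.distrib[symmetric]) (intro sum.cong, auto simp: unit_at_def)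
  also have "(\<Sum>k\<in>T. if k = m then (if b = a then m else 0) else 0) = (if b = a then m else 0)"
    using T by (simp add: T_def)
  finally have new: "weight (N + unit_at (a, m)) b = weight N b + (if b = a then m else 0)"
    unfolding N .
  show "weight (N + unit_at (a, m)) b = ((weight N)(a := weight N a + m)) b"
    unfolding new by simp
qed

lemma families_of_weight_bound:
  assumes N: "N \<in> families_of_weight \<beta>" and nz: "N (a, m) \<noteq> 0"
  shows "m \<ge> 1" "m * N (a, m) \<le> \<beta> a"
proof -
  have fam: "N \<in> families" and wt: "weight N = \<beta>"
    using N by (simp_all add: families_of_weight_def)
  have "(a, m) \<in> HH"
  proof (rule ccontr)
    assume "(a, m) \<notin> HH"
    then have "N (a, m) = 0" using fam by (simp add: families_def)
    then show False using nz by simp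
  qed
  then show "m \<ge> 1" by (simp add: HH_def)
  have fin: "finite {k. N (a, k) \<noteq> 0}"
    by (rule fin_supp_row[OF family_fin_supp[OF fam]])
  have "m * N (a, m) \<le> (\<Sum>k | N (a, k) \<noteq> 0. k * N (a, k))"
    by (rule member_le_sum[of m _ "\<lambda>k. k * N (a, k)"]) (use fin nz in simp_all)
  then show "m * N (a, m) \<le> \<beta> a"
    unfolding wt[symmetric] weight_def .
qed

lemma families_of_weight_support: "N \<in> families_of_weight \<beta> \<Longrightarrow> N (a, m) \<noteq> 0 \<Longrightarrow> m \<le> \<beta> a"
proof -
  assume N: "N \<in> families_of_weight \<beta>" and nz: "N (a, m) \<noteq> 0"
  have "m * 1 \<le> m * N (a, m)"
    using nz by (intro mult_le_mono2) simp
  also have "\<dots> \<le> \<beta> a" by (rule families_of_weight_bound(2)[OF N nz])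
  finally show ?thesis by simp
qed

lemma finite_families_of_weight: "finite (families_of_weight \<beta>)"
proof -
  define A where "A = Sigma UNIV (\<lambda>a. {..\<beta> a})"
  define B where "B = {..Max (range \<beta>)}"
  have bound: "N (a, m) \<in> B" "(a, m) \<notin> A \<Longrightarrow> N (a, m) = 0" if N: "N \<in> families_of_weight \<beta>" for N a m
  proof -
    show "N (a, m) \<in> B"
    proof (cases "N (a, m) = 0")
      case False
      have "N (a, m) \<le> m * N (a, m)"
        using families_of_weight_bound(1)[OF N False] by simp
      also have "\<dots> \<le> \<beta> a" by (rule families_of_weight_bound(2)[OF N False])
      also have "\<dots> \<le> Max (range \<beta>)" by (intro Max_ge) auto
      finally show ?thesis by (simp add: B_def)
    qed (simp add: B_def)
    show "N (a, m) = 0" if "(a, m) \<notin> A"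
      using families_of_weight_support[OF N, of a m] that by (auto simp: A_def)
  qed
  then have "families_of_weight \<beta> \<subseteq> {N. \<forall>h. (h \<in> A \<longrightarrow> N h \<in> B) \<and> (h \<notin> A \<longrightarrow> N h = 0)}"
    by auto
  moreover have "finite A" "finite B" by (simp_all add: A_def B_def)
  ultimately show ?thesis
    by (intro finite_subset[OF _ finite_set_of_finite_funs])
qed

definition fam_series :: "(('n \<times> nat \<Rightarrow> nat) \<Rightarrow> real) \<Rightarrow> 'n::finite mfps" where
  "fam_series c = mfps_sum (\<lambda>N. mfps_monom (complex_of_real (c N)) (weight N)) families"

lemma mcoeff_fam_series: "mcoeff (fam_series c) \<beta> = (\<Sum>N\<in>families_of_weight \<beta>. of_real (c N))"
proof -
  have m: "mcoeff (mfps_monom z \<delta>) \<beta> = (if \<beta> = \<delta> then z else 0)" for z and \<delta> :: "'a \<Rightarrow> nat"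
    by (simp add: mfps_monom_def Abs_mfps_inverse)
  have "mcoeff (fam_series c) \<beta>
    = (\<Sum>N | N \<in> families \<and> mcoeff (mfps_monom (complex_of_real (c N)) (weight N)) \<beta> \<noteq> 0.
        mcoeff (mfps_monom (complex_of_real (c N)) (weight N)) \<beta>)"
    by (simp add: fam_series_def mfps_sum_def Abs_mfps_inverse)
  also have "\<dots> = (\<Sum>N\<in>families_of_weight \<beta>. of_real (c N))"
    using finite_families_of_weight[of \<beta>]
    by (intro sum.mono_neutral_cong_left) (auto simp: m families_of_weight_def split: if_splits)
  finally show ?thesis .
qed

context cartan_form
begin

text \<open>The coefficientwise form of the recursion, for coefficients \<open>C \<gamma> N\<close> that depend on \<open>\<gamma>\<close> only on the
  support of \<open>N\<close>. The latter makes the coefficient of \<open>y\<^sup>\<beta>\<close> independent of \<open>\<gamma>\<close> at high levels, which gives the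
  convergence in \<open>m\<close> that uniqueness requires.\<close>

definition pascal_family :: "(('n \<times> nat \<Rightarrow> real) \<Rightarrow> ('n \<times> nat \<Rightarrow> nat) \<Rightarrow> real) \<Rightarrow> bool" where
  "pascal_family C \<longleftrightarrow>
    (\<forall>\<gamma>. \<forall>N\<in>families. \<forall>h. C \<gamma> N - C (\<gamma> - unit_at h) N
        = (if N h = 0 then 0 else C (\<gamma> - ip_min ip h) (N - unit_at h)))
    \<and> (\<forall>\<gamma> \<gamma>'. \<forall>N\<in>families. (\<forall>h. N h \<noteq> 0 \<longrightarrow> \<gamma> h = \<gamma>' h) \<longrightarrow> C \<gamma> N = C \<gamma>' N)"

lemma pascal_step:
  assumes "pascal_family C" "N \<in> families"
  shows "C \<gamma> N - C (\<gamma> - unit_at h) N = (if N h = 0 then 0 else C (\<gamma> - ip_min ip h) (N - unit_at h))"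
  using assms unfolding pascal_family_def by blast

lemma pascal_local:
  assumes "pascal_family C" "N \<in> families" "\<And>h. N h \<noteq> 0 \<Longrightarrow> \<gamma> h = \<gamma>' h"
  shows "C \<gamma> N = C \<gamma>' N"
  using assms unfolding pascal_family_def by blast

lemma families_of_weight_remove_unit_at:
  assumes m: "m \<ge> 1"
  shows "bij_betw (\<lambda>N. N - unit_at (a, m)) {N \<in> families_of_weight \<beta>. N (a, m) \<noteq> 0}
     (if \<beta> a < m then {} else families_of_weight (\<beta>(a := \<beta> a - m)))"
proof (cases "\<beta> a < m")
  case True
  have empty: "{N \<in> families_of_weight \<beta>. N (a, m) \<noteq> 0} = {}"
    using families_of_weight_support[of _ \<beta> a m] True by auto
  show ?thesis unfolding empty using True by (simp add: bij_betw_def)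
next
  case False
  let ?e = "unit_at (a, m) :: _ \<Rightarrow> nat"
  have inv1: "N - ?e + ?e = N" if "N (a, m) \<noteq> 0" for N
    using that by (auto simp: fun_eq_iff unit_at_def)
  have inv2: "N + ?e - ?e = N" for N
    by (auto simp: fun_eq_iff)
  have fam: "N - ?e \<in> families" "N + ?e \<in> families" if "N \<in> families" for N
  proof -
    have fin: "finite (insert (a, m) {h. N h \<noteq> 0})" using that by (simp add: families_def)
    have zero: "N h = 0" if "h \<notin> HH" for h
      using \<open>N \<in> families\<close> that by (cases h) (simp add: families_def)
    have HH: "(a, m) \<in> HH" using m by (simp add: HH_def)
    have "finite {h. (N - ?e) h \<noteq> 0}" "finite {h. (N + ?e) h \<noteq> 0}"
      by (rule finite_subset[OF _ fin], auto simp: unit_at_def)+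
    moreover have "(N - ?e) h = 0" "(N + ?e) h = 0" if "h \<notin> HH" for h
      using zero[OF that] HH that by (auto simp: unit_at_def)
    ultimately show "N - ?e \<in> families" "N + ?e \<in> families"
      by (auto simp only: families_def mem_Collect_eq)
  qed
  have "bij_betw (\<lambda>N. N - ?e) {N \<in> families_of_weight \<beta>. N (a, m) \<noteq> 0} (families_of_weight (\<beta>(a := \<beta> a - m)))"
  proof (rule bij_betw_byWitness[where f' = "\<lambda>N. N + ?e"])
    show "\<forall>N\<in>{N \<in> families_of_weight \<beta>. N (a, m) \<noteq> 0}. N - ?e + ?e = N"
      using inv1 by blast
    show "\<forall>N\<in>families_of_weight (\<beta>(a := \<beta> a - m)). N + ?e - ?e = N"
      using inv2 by blast
    show "(\<lambda>N. N - ?e) ` {N \<in> families_of_weight \<beta>. N (a, m) \<noteq> 0} \<subseteq> families_of_weight (\<beta>(a := \<beta> a - m))"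
    proof (rule image_subsetI)
      fix N assume "N \<in> {N \<in> families_of_weight \<beta>. N (a, m) \<noteq> 0}"
      then have N: "N \<in> families" "weight N = \<beta>" "N (a, m) \<noteq> 0" by (auto simp: families_of_weight_def)
      have "weight N = (weight (N - ?e))(a := weight (N - ?e) a + m)"
        using weight_add_unit_at[OF family_fin_supp[OF fam(1)[OF N(1)]], of a m] unfolding inv1[of N, OF N(3)] .
      then have "\<beta> b = ((weight (N - ?e))(a := weight (N - ?e) a + m)) b" for b
        using N(2) by metis
      then have "weight (N - ?e) b = (\<beta>(a := \<beta> a - m)) b" for b
        by (cases "b = a") auto
      then have "weight (N - ?e) = \<beta>(a := \<beta> a - m)" by (rule ext)
      then show "N - ?e \<in> families_of_weight (\<beta>(a := \<beta> a - m))"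
        using fam(1)[OF N(1)] by (simp only: families_of_weight_def mem_Collect_eq simp_thms)
    qed
    show "(\<lambda>N. N + ?e) ` families_of_weight (\<beta>(a := \<beta> a - m)) \<subseteq> {N \<in> families_of_weight \<beta>. N (a, m) \<noteq> 0}"
    proof (rule image_subsetI)
      fix N assume "N \<in> families_of_weight (\<beta>(a := \<beta> a - m))"
      then have N: "N \<in> families" "weight N = \<beta>(a := \<beta> a - m)" by (auto simp: families_of_weight_def)
      have "weight (N + ?e) = \<beta>"
        using False unfolding weight_add_unit_at[OF family_fin_supp[OF N(1)]] N(2) by (auto simp: fun_eq_iff)
      moreover have "(N + ?e) (a, m) \<noteq> 0" by (simp add: unit_at_def)
      ultimately show "N + ?e \<in> {N \<in> families_of_weight \<beta>. N (a, m) \<noteq> 0}"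
        using fam(2)[OF N(1)] by (simp only: families_of_weight_def mem_Collect_eq simp_thms)
    qed
  qed
  then show ?thesis using False by simp
qed

text \<open>Removing one unit at \<open>(a, m)\<close> from \<open>N\<close> divides the monomial by \<open>y\<^sub>a\<^sup>m\<close>.\<close>

lemma pascal_series_recursion:
  assumes C: "pascal_family C" and m: "m \<ge> 1"
  shows "fam_series (C \<gamma>) = fam_series (C (\<gamma> - unit_at (a, m)))
     + mfps_var a ^ m * fam_series (C (\<gamma> - ip_min ip (a, m)))"
proof (rule mfps_eqI)
  fix \<beta>
  let ?e = "unit_at (a, m)" and ?g = "\<gamma> - ip_min ip (a, m)"
  have "mcoeff (fam_series (C \<gamma>)) \<beta> - mcoeff (fam_series (C (\<gamma> - ?e))) \<beta>
    = (\<Sum>N\<in>families_of_weight \<beta>. of_real (C \<gamma> N - C (\<gamma> - ?e) N))"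
    by (simp only: mcoeff_fam_series of_real_diff sum_subtractf)
  also have "\<dots> = (\<Sum>N\<in>families_of_weight \<beta>. if N (a, m) \<noteq> 0 then of_real (C ?g (N - unit_at (a, m))) else 0)"
    by (intro sum.cong refl) (simp add: pascal_step[OF C] families_of_weight_def)
  also have "\<dots> = (\<Sum>N\<in>{N \<in> families_of_weight \<beta>. N (a, m) \<noteq> 0}. of_real (C ?g (N - unit_at (a, m))))"
    by (rule sum.inter_filter[OF finite_families_of_weight, symmetric])
  also have "\<dots> = (\<Sum>N\<in>(if \<beta> a < m then {} else families_of_weight (\<beta>(a := \<beta> a - m))). of_real (C ?g N))"
    by (rule sum.reindex_bij_betw[OF families_of_weight_remove_unit_at[OF m]])
  also have "\<dots> = mcoeff (mfps_var a ^ m * fam_series (C ?g)) \<beta>"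
    by (auto simp: mcoeff_var_power_mult mcoeff_fam_series)
  finally show "mcoeff (fam_series (C \<gamma>)) \<beta>
     = mcoeff (fam_series (C (\<gamma> - ?e)) + mfps_var a ^ m * fam_series (C ?g)) \<beta>"
    by (simp add: algebra_simps)
qed

lemma pascal_series_local:
  assumes C: "pascal_family C" and eq: "\<And>a m. m < d \<Longrightarrow> \<gamma> (a, m) = \<gamma>' (a, m)"
  shows "agree d (fam_series (C \<gamma>)) (fam_series (C \<gamma>'))"
  unfolding agree_def
proof (intro allI impI)
  fix \<beta> :: "'n \<Rightarrow> nat" assume d: "deg \<beta> < d"
  have "C \<gamma> N = C \<gamma>' N" if N: "N \<in> families_of_weight \<beta>" for N
  proof (rule pascal_local[OF C])
    show "N \<in> families" using N by (simp add: families_of_weight_def)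
    fix h assume nz: "N h \<noteq> 0"
    obtain a m where h: "h = (a, m)" by (cases h)
    have "m \<le> \<beta> a" using families_of_weight_support[OF N] nz h by simp
    also have "\<beta> a \<le> deg \<beta>" unfolding deg_def by (rule member_le_sum) auto
    finally show "\<gamma> h = \<gamma>' h" using eq d h by simp
  qed
  then show "mcoeff (fam_series (C \<gamma>)) \<beta> = mcoeff (fam_series (C \<gamma>')) \<beta>"
    by (simp add: mcoeff_fam_series)
qed

end

context q_system
begin

text \<open>Both sides satisfy the recursion and agree at \<open>\<nu> = 0\<close>. The right-hand side does so because the recursion is
  linear over the ring of power series.\<close>

theorem pascal_series_eq_Q_power:
  assumes C: "pascal_family C" and \<nu>: "\<nu> \<in> fin_supp"
  shows "fam_series (C (gam_int \<nu>)) = Q_power Q \<nu> * fam_series (C 0)"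
proof -
  define S where "S \<nu> = fam_series (C (gam_int \<nu>))" for \<nu>
  define A where "A \<nu> = S \<nu> - Q_power Q \<nu> * fam_series (C 0)" for \<nu>
  let ?e = "\<lambda>a j. unit_at (a, j) :: _ \<Rightarrow> int"
  have gd: "gam_int (\<nu> - \<mu>) = gam_int \<nu> - gam_int \<mu>" if "\<nu> \<in> fin_supp" "\<mu> \<in> fin_supp" for \<nu> \<mu> :: "'n \<times> nat \<Rightarrow> int"
    using gam_int_diff[OF that] by (simp add: fun_eq_iff)
  have recS: "S \<nu> = S (\<nu> - cartan_A a m) + mfps_var a ^ m * S (\<nu> - ipB_row ip (a, m))"
    if "\<nu> \<in> fin_supp" "m \<ge> 1" for \<nu> a m
    unfolding S_def gd[OF that(1) cartan_A_fin_supp] gd[OF that(1) ipB_row_fin_supp]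
      gam_int_cartan_A[OF that(2)] gam_int_ipB_row
    by (rule pascal_series_recursion[OF C that(2)])
  have stableS: "agree d (S (\<nu> + ?e a (m + 1))) (S (\<nu> + ?e a m))" if "\<nu> \<in> fin_supp" "m \<ge> d" for \<nu> a m d
    unfolding S_def
    by (rule pascal_series_local[OF C]) (use that in \<open>simp add: gam_int_add gam_int_unit_at min_absorb1\<close>)
  have "A \<nu> = 0"
  proof (rule q_recursion_unique[of A "\<lambda>a m. ipB_row ip (a, m)"])
    fix \<nu> :: "'n \<times> nat \<Rightarrow> int" and a and m :: nat assume \<nu>: "\<nu> \<in> fin_supp"
    show "A \<nu> = A (\<nu> - cartan_A a m) + mfps_var a ^ m * A (\<nu> - ipB_row ip (a, m))" if "m \<ge> 1"
      unfolding A_def recS[OF \<nu> that, of a] Q_power_recursion[OF \<nu> that, of a]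
      by (simp only: algebra_simps)
    show "A (\<nu> + ?e a 0) = A \<nu>"
    proof -
      have "gam_int (\<nu> + ?e a 0) = gam_int \<nu>"
        using gam_int_add[OF \<nu> fin_supp_unit_at] by (auto simp: fun_eq_iff gam_int_unit_at)
      then show ?thesis
        unfolding A_def S_def by (simp only: Q_add[OF \<nu> fin_supp_unit_at] Q_power_unit_at Q_0 mult_1_right)
    qed
  next
    fix d
    obtain M where M: "\<And>m a. m \<ge> M \<Longrightarrow> agree d (Q (a, m + 1)) (Q (a, m))"
      using Q_stable by blast
    have "agree d (A (\<nu> + ?e a (m + 1))) (A (\<nu> + ?e a m))" if "\<nu> \<in> fin_supp" "m \<ge> max d M" for \<nu> a m
    proof -
      have "agree d (Q_power Q (\<nu> + ?e a (m + 1)) * fam_series (C 0)) (Q_power Q (\<nu> + ?e a m) * fam_series (C 0))"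
        unfolding Q_add[OF that(1) fin_supp_unit_at] Q_power_unit_at
        using M that by (intro agree_mult agree_refl) simp
      moreover have "agree d (S (\<nu> + ?e a (m + 1))) (S (\<nu> + ?e a m))"
        using stableS that by simp
      ultimately show ?thesis
        unfolding A_def agree_def by simp
    qed
    then show "\<exists>M. \<forall>m\<ge>M. \<forall>a. \<forall>\<nu>\<in>fin_supp. agree d (A (\<nu> + ?e a (m + 1))) (A (\<nu> + ?e a m))"
      by blast
  next
    show "A 0 = 0"
      unfolding A_def S_def gam_int_0 Q_power_0 by simp
  qed (use \<nu> in auto)
  then show ?thesis by (simp add: A_def S_def)
qed

end

section \<open>The coefficients of K and R\<close>

text \<open>The coefficient of \<open>z\<^sup>n\<close> in \<open>(1 - z)\<^bsup>-p\<^esup>\<close>, or in \<open>z (1 - z)\<^bsup>-p-1\<^esup>\<close> when \<open>b\<close> holds. The second series is the derivative of the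
  first with respect to \<open>z\<close>, multiplied by \<open>z / p\<close>; this is how the determinant of Lagrange inversion produces it.\<close>

definition R_factor :: "bool \<Rightarrow> real \<Rightarrow> nat \<Rightarrow> real" where
  "R_factor b p n = (if b then (if n = 0 then 0 else (p + real n - 1) gchoose (n - 1)) else (p + real n - 1) gchoose n)"

lemma gbinomial_pascal: "((p + real (Suc n)) gchoose (Suc n)) - ((p - 1 + real (Suc n)) gchoose (Suc n)) = (p + real n) gchoose n"
proof -
  have "p + real (Suc n) = (p + real n) + 1" "p - 1 + real (Suc n) = p + real n" by simp_all
  then show ?thesis by (simp only: gbinomial_Suc_Suc add_diff_cancel_right')
qed

lemma R_factor_pascal:
  "R_factor b p n - R_factor b (p - 1) n = (if n = 0 then 0 else R_factor b p (n - 1))"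
proof (cases n)
  case (Suc k)
  show ?thesis
  proof (cases b)
    case True
    then show ?thesis
      using Suc gbinomial_pascal[of p "k - 1"] by (cases k) (auto simp: R_factor_def algebra_simps)
  next
    case False
    then show ?thesis
      using Suc gbinomial_pascal[of "p - 1" k] by (simp add: R_factor_def algebra_simps)
  qed
qed (simp add: R_factor_def)

lemma R_factor_False:
  assumes "n \<noteq> 0"
  shows "R_factor False p n = p * (1 / real n * ((p + real n - 1) gchoose (n - 1)))"
proof -
  obtain k where n: "n = Suc k" using assms not0_implies_Suc by blast
  have "(p + real k) * ((p + real k) gchoose k)
    = real k * ((p + real k) gchoose k) + real (Suc k) * ((p + real k) gchoose (Suc k))"
    by (rule gbinomial_mult_1)
  then have "real (Suc k) * ((p + real k) gchoose (Suc k)) = p * ((p + real k) gchoose k)"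
    by (simp add: distrib_right)
  then show ?thesis
    unfolding R_factor_def n by (simp add: field_simps del: of_nat_Suc) (simp add: algebra_simps)
qed

context cartan_form
begin

text \<open>The vacancy numbers, with \<open>\<gamma>\<close> free.\<close>

definition P_vac :: "('n \<times> nat \<Rightarrow> real) \<Rightarrow> ('n \<times> nat \<Rightarrow> nat) \<Rightarrow> 'n \<times> nat \<Rightarrow> real" where
  "P_vac \<gamma> N h = \<gamma> h - (\<Sum>h' | N h' \<noteq> 0. ip_min ip h h' * real (N h'))"

lemma P_vac_shift: "P_vac (\<gamma> - unit_at h0) N h = P_vac \<gamma> N h - (if h = h0 then 1 else 0)"
  by (simp add: P_vac_def unit_at_def)

text \<open>The two changes compensate each other because the matrix \<open>ip_min\<close> is symmetric.\<close>

lemma P_vac_remove: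
  assumes N: "N \<in> families" and nz: "N h0 \<noteq> 0"
  shows "P_vac (\<gamma> - ip_min ip h0) (N - unit_at h0) h = P_vac \<gamma> N h"
proof -
  let ?T = "{h'. N h' \<noteq> 0}"
  have fin: "finite ?T" using N by (simp add: families_def)
  have "(\<Sum>h' | (N - unit_at h0) h' \<noteq> 0. ip_min ip h h' * real ((N - unit_at h0) h'))
    = (\<Sum>h'\<in>?T. ip_min ip h h' * real ((N - unit_at h0) h'))"
    using fin by (intro sum.mono_neutral_left) auto
  also have "\<dots> = (\<Sum>h'\<in>?T. ip_min ip h h' * real (N h') - (if h' = h0 then ip_min ip h h0 else 0))"
    using nz by (intro sum.cong refl) (auto simp: unit_at_def algebra_simps of_nat_diff)
  also have "\<dots> = (\<Sum>h'\<in>?T. ip_min ip h h' * real (N h')) - ip_min ip h h0"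
    using nz fin by (simp add: sum_subtractf)
  finally show ?thesis
    unfolding P_vac_def by (simp add: ip_min_sym[of h0 h])
qed

text \<open>By the preceding facts only the factor at \<open>h0\<close> changes, so Pascal's rule for that factor is inherited by the
  product.\<close>

lemma P_vac_product_pascal:
  fixes f :: "'n \<times> nat \<Rightarrow> real \<Rightarrow> nat \<Rightarrow> real"
  assumes f: "\<And>h p n. f h p n - f h (p - 1) n = (if n = 0 then 0 else f h p (n - 1))"
    and N: "N \<in> families" and T: "finite T" "h0 \<in> T"
  shows "(\<Prod>h\<in>T. f h (P_vac \<gamma> N h) (N h)) - (\<Prod>h\<in>T. f h (P_vac (\<gamma> - unit_at h0) N h) (N h))
    = (if N h0 = 0 then 0
       else \<Prod>h\<in>T. f h (P_vac (\<gamma> - ip_min ip h0) (N - unit_at h0) h) ((N - unit_at h0) h))"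
proof -
  let ?p = "P_vac \<gamma> N h0" and ?X = "\<Prod>h\<in>T - {h0}. f h (P_vac \<gamma> N h) (N h)"
  have 1: "(\<Prod>h\<in>T. f h (P_vac \<gamma> N h) (N h)) = f h0 ?p (N h0) * ?X"
    using T by (rule prod.remove)
  have "(\<Prod>h\<in>T. f h (P_vac (\<gamma> - unit_at h0) N h) (N h))
    = f h0 (P_vac (\<gamma> - unit_at h0) N h0) (N h0) * (\<Prod>h\<in>T - {h0}. f h (P_vac (\<gamma> - unit_at h0) N h) (N h))"
    using T by (rule prod.remove)
  also have "(\<Prod>h\<in>T - {h0}. f h (P_vac (\<gamma> - unit_at h0) N h) (N h)) = ?X"
    by (intro prod.cong refl) (simp add: P_vac_shift)
  finally have 2: "(\<Prod>h\<in>T. f h (P_vac (\<gamma> - unit_at h0) N h) (N h)) = f h0 (?p - 1) (N h0) * ?X"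
    unfolding P_vac_shift by simp
  have 3: "(\<Prod>h\<in>T. f h (P_vac (\<gamma> - ip_min ip h0) (N - unit_at h0) h) ((N - unit_at h0) h)) = f h0 ?p (N h0 - 1) * ?X"
    if "N h0 \<noteq> 0"
  proof -
    have "(\<Prod>h\<in>T. f h (P_vac (\<gamma> - ip_min ip h0) (N - unit_at h0) h) ((N - unit_at h0) h))
      = (\<Prod>h\<in>T. f h (P_vac \<gamma> N h) (N h - (if h = h0 then 1 else 0)))"
      unfolding P_vac_remove[OF N that] by (simp add: unit_at_def)
    also have "\<dots> = f h0 ?p (N h0 - 1) * (\<Prod>h\<in>T - {h0}. f h (P_vac \<gamma> N h) (N h - (if h = h0 then 1 else 0)))"
      using prod.remove[OF T, of "\<lambda>h. f h (P_vac \<gamma> N h) (N h - (if h = h0 then 1 else 0))"] by simp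
    also have "(\<Prod>h\<in>T - {h0}. f h (P_vac \<gamma> N h) (N h - (if h = h0 then 1 else 0))) = ?X"
      by (intro prod.cong) auto
    finally show ?thesis .
  qed
  have "f h0 ?p (N h0) * ?X - f h0 (?p - 1) (N h0) * ?X = (f h0 ?p (N h0) - f h0 (?p - 1) (N h0)) * ?X"
    by (simp only: left_diff_distrib)
  also have "\<dots> = (if N h0 = 0 then 0 else f h0 ?p (N h0 - 1) * ?X)"
    unfolding f by (simp only: if_distrib[of "\<lambda>z. z * ?X"] mult_zero_left)
  finally have diff: "f h0 ?p (N h0) * ?X - f h0 (?p - 1) (N h0) * ?X
    = (if N h0 = 0 then 0 else f h0 ?p (N h0 - 1) * ?X)" .
  show ?thesis
  proof (cases "N h0 = 0")
    case True
    show ?thesis unfolding 1 2 diff if_P[OF True] ..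
  next
    case False
    show ?thesis unfolding 1 2 diff if_not_P[OF False] 3[OF False] ..
  qed
qed

lemma pascal_familyI:
  assumes "\<And>\<gamma> N h. N \<in> families \<Longrightarrow> C \<gamma> N - C (\<gamma> - unit_at h) N
        = (if N h = 0 then 0 else C (\<gamma> - ip_min ip h) (N - unit_at h))"
    and "\<And>\<gamma> \<gamma>' N. N \<in> families \<Longrightarrow> (\<And>h. N h \<noteq> 0 \<Longrightarrow> P_vac \<gamma> N h = P_vac \<gamma>' N h) \<Longrightarrow> C \<gamma> N = C \<gamma>' N"
  shows "pascal_family C"
  unfolding pascal_family_def
proof (intro conjI allI ballI impI)
  fix \<gamma> \<gamma>' :: "'n \<times> nat \<Rightarrow> real" and N :: "'n \<times> nat \<Rightarrow> nat"
  assume N: "N \<in> families" and eq: "\<forall>h. N h \<noteq> 0 \<longrightarrow> \<gamma> h = \<gamma>' h"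
  show "C \<gamma> N = C \<gamma>' N"
  proof (rule assms(2)[OF N])
    fix h assume "N h \<noteq> 0"
    then have "\<gamma> h = \<gamma>' h" using eq by blast
    then show "P_vac \<gamma> N h = P_vac \<gamma>' N h" by (simp add: P_vac_def)
  qed
qed (rule assms(1))

lemma support_remove_unit_at: "{h. (N - unit_at h0) h \<noteq> 0} \<subseteq> {h. N h \<noteq> (0 :: nat)}"
  by auto

lemma finite_support: "N \<in> families \<Longrightarrow> finite {h. N h \<noteq> 0}"
  by (simp add: families_def)

definition K_coeff :: "('n \<times> nat \<Rightarrow> real) \<Rightarrow> ('n \<times> nat \<Rightarrow> nat) \<Rightarrow> real" where
  "K_coeff \<gamma> N = (\<Prod>h | N h \<noteq> 0. (P_vac \<gamma> N h + real (N h)) gchoose N h)"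

lemma K_coeff_eq:
  assumes "finite T" "{h. N h \<noteq> 0} \<subseteq> T"
  shows "K_coeff \<gamma> N = (\<Prod>h\<in>T. (P_vac \<gamma> N h + real (N h)) gchoose N h)"
  unfolding K_coeff_def using assms by (intro prod.mono_neutral_left) auto

lemma K_coeff_pascal: "pascal_family K_coeff"
proof (rule pascal_familyI)
  fix \<gamma> and N :: "'n \<times> nat \<Rightarrow> nat" and h assume N: "N \<in> families"
  define T where "T = insert h {h. N h \<noteq> 0}"
  have T: "finite T" "{h. N h \<noteq> 0} \<subseteq> T" "h \<in> T"
    using finite_support[OF N] by (auto simp: T_def)
  let ?f = "\<lambda>h p n. (p + real n) gchoose n"
  have pascal: "?f h p n - ?f h (p - 1) n = (if n = 0 then 0 else ?f h p (n - 1))" for h p n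
    using gbinomial_pascal[of p "n - 1"] by (cases n) auto
  show "K_coeff \<gamma> N - K_coeff (\<gamma> - unit_at h) N
        = (if N h = 0 then 0 else K_coeff (\<gamma> - ip_min ip h) (N - unit_at h))"
    unfolding K_coeff_eq[OF T(1,2)] K_coeff_eq[OF T(1) order_trans[OF support_remove_unit_at T(2)]]
    by (rule P_vac_product_pascal[of ?f, OF pascal N T(1,3)])
next
  fix \<gamma> \<gamma>' and N :: "'n \<times> nat \<Rightarrow> nat"
  assume "\<And>h. N h \<noteq> 0 \<Longrightarrow> P_vac \<gamma> N h = P_vac \<gamma>' N h"
  then show "K_coeff \<gamma> N = K_coeff \<gamma>' N"
    unfolding K_coeff_def by (intro prod.cong refl) simp
qed

definition R_coeff :: "('n \<times> nat \<Rightarrow> real) \<Rightarrow> ('n \<times> nat \<Rightarrow> nat) \<Rightarrow> real" where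
  "R_coeff \<gamma> N =
     det_on {h. N h \<noteq> 0} (\<lambda>h h'. (if h = h' then P_vac \<gamma> N h else 0) + ip_min ip h h' * real (N h'))
     * (\<Prod>h | N h \<noteq> 0. 1 / real (N h) * ((P_vac \<gamma> N h + real (N h) - 1) gchoose (N h - 1)))"

text \<open>Multiplying the factor \<open>1 / N * ((P + N - 1) gchoose (N - 1))\<close> by \<open>N\<close> or by \<open>P\<close> gives the two kinds of \<open>R_factor\<close>, and these
  are the weights in the expansion of the determinant. Sets \<open>S\<close> that leave the support of \<open>N\<close> contribute zero, which
  allows a summation range \<open>T\<close> independent of the family.\<close>

lemma R_coeff_eq:
  assumes T: "finite T" "{h. N h \<noteq> 0} \<subseteq> T"
  shows "R_coeff \<gamma> N = (\<Sum>S\<in>Pow T. det_on S (ip_min ip) * (\<Prod>h\<in>T. R_factor (h \<in> S) (P_vac \<gamma> N h) (N h)))"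
proof -
  let ?H = "{h. N h \<noteq> 0}" and ?P = "P_vac \<gamma> N"
  let ?c = "\<lambda>h. 1 / real (N h) * ((?P h + real (N h) - 1) gchoose (N h - 1))"
  have H: "finite ?H" using T finite_subset by blast
  have "(\<Sum>S\<in>Pow T. det_on S (ip_min ip) * (\<Prod>h\<in>T. R_factor (h \<in> S) (?P h) (N h)))
    = (\<Sum>S\<in>Pow ?H. det_on S (ip_min ip) * (((\<Prod>h\<in>S. real (N h)) * (\<Prod>h\<in>?H - S. ?P h)) * (\<Prod>h\<in>?H. ?c h)))"
  proof (rule sum.mono_neutral_cong_right)
    show "finite (Pow T)" "Pow ?H \<subseteq> Pow T" using T by auto
    show "\<forall>S\<in>Pow T - Pow ?H. det_on S (ip_min ip) * (\<Prod>h\<in>T. R_factor (h \<in> S) (?P h) (N h)) = 0"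
    proof
      fix S assume S: "S \<in> Pow T - Pow ?H"
      then obtain h where h: "h \<in> S" "h \<in> T" "N h = 0" by auto
      have "(\<Prod>h\<in>T. R_factor (h \<in> S) (?P h) (N h)) = 0"
        using T(1) h(2) by (rule prod_zero[OF _ bexI[rotated]]) (simp add: h R_factor_def)
      then show "det_on S (ip_min ip) * (\<Prod>h\<in>T. R_factor (h \<in> S) (?P h) (N h)) = 0" by simp
    qed
    fix S assume "S \<in> Pow ?H"
    then have S: "S \<subseteq> ?H" by simp
    have "(\<Prod>h\<in>T. R_factor (h \<in> S) (?P h) (N h)) = (\<Prod>h\<in>?H. R_factor (h \<in> S) (?P h) (N h))"
      using T S by (intro prod.mono_neutral_right) (auto simp: R_factor_def)
    also have "\<dots> = (\<Prod>h\<in>?H. (if h \<in> S then real (N h) else ?P h) * ?c h)"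
    proof (rule prod.cong[OF refl])
      fix h assume "h \<in> ?H"
      then have nz: "N h \<noteq> 0" by simp
      show "R_factor (h \<in> S) (?P h) (N h) = (if h \<in> S then real (N h) else ?P h) * ?c h"
        using R_factor_False[OF nz, of "?P h"] nz by (simp add: R_factor_def)
    qed
    also have "\<dots> = (\<Prod>h\<in>?H. if h \<in> S then real (N h) else ?P h) * (\<Prod>h\<in>?H. ?c h)"
      by (rule prod.distrib)
    also have "(\<Prod>h\<in>?H. if h \<in> S then real (N h) else ?P h) = (\<Prod>h\<in>S. real (N h)) * (\<Prod>h\<in>?H - S. ?P h)"
    proof -
      have "?H \<inter> S = S" "?H \<inter> - S = ?H - S" using S by auto
      then show ?thesis using prod.If_cases[OF H, of "\<lambda>h. h \<in> S" "\<lambda>h. real (N h)" ?P] by simp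
    qed
    finally show "det_on S (ip_min ip) * (\<Prod>h\<in>T. R_factor (h \<in> S) (?P h) (N h))
      = det_on S (ip_min ip) * (((\<Prod>h\<in>S. real (N h)) * (\<Prod>h\<in>?H - S. ?P h)) * (\<Prod>h\<in>?H. ?c h))"
      by (simp only:)
  qed
  also have "\<dots> = R_coeff \<gamma> N"
    unfolding R_coeff_def det_on_diag_plus[OF H] sum_distrib_right by (simp only: mult.assoc)
  finally show ?thesis ..
qed

text \<open>The principal minors \<open>det_on S (ip_min ip)\<close> involve neither \<open>\<gamma>\<close> nor \<open>N\<close>, so Pascal's rule holds term by term.\<close>

lemma R_coeff_pascal: "pascal_family R_coeff"
proof (rule pascal_familyI)
  fix \<gamma> and N :: "'n \<times> nat \<Rightarrow> nat" and h assume N: "N \<in> families"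
  define T where "T = insert h {h. N h \<noteq> 0}"
  have T: "finite T" "{h. N h \<noteq> 0} \<subseteq> T" "h \<in> T"
    using finite_support[OF N] by (auto simp: T_def)
  let ?prod = "\<lambda>S \<gamma> N. \<Prod>h\<in>T. R_factor (h \<in> S) (P_vac \<gamma> N h) (N h)"
  have step: "?prod S \<gamma> N - ?prod S (\<gamma> - unit_at h) N
      = (if N h = 0 then 0 else ?prod S (\<gamma> - ip_min ip h) (N - unit_at h))" for S
    by (rule P_vac_product_pascal[of "\<lambda>h. R_factor (h \<in> S)", OF R_factor_pascal N T(1,3)])
  show "R_coeff \<gamma> N - R_coeff (\<gamma> - unit_at h) N
        = (if N h = 0 then 0 else R_coeff (\<gamma> - ip_min ip h) (N - unit_at h))"
    unfolding R_coeff_eq[OF T(1,2)] R_coeff_eq[OF T(1) order_trans[OF support_remove_unit_at T(2)]]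
      sum_subtractf[symmetric] right_diff_distrib[symmetric] step
    by simp
next
  fix \<gamma> \<gamma>' and N :: "'n \<times> nat \<Rightarrow> nat"
  assume N: "N \<in> families" and eq: "\<And>h. N h \<noteq> 0 \<Longrightarrow> P_vac \<gamma> N h = P_vac \<gamma>' N h"
  show "R_coeff \<gamma> N = R_coeff \<gamma>' N"
    unfolding R_coeff_eq[OF finite_support[OF N] order_refl]
    by (intro sum.cong refl arg_cong2[of _ _ _ _ "(*)"] prod.cong) (simp add: eq)
qed

text \<open>For \<open>\<gamma> = 0\<close> the sum of row \<open>h\<close> of the matrix \<open>F\<close> is \<open>P\<^sub>h + (\<gamma>\<^sub>h - P\<^sub>h) = 0\<close>.\<close>

lemma R_coeff_0_nonzero:
  assumes N: "N \<in> families" "N \<noteq> 0"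
  shows "R_coeff 0 N = 0"
proof -
  let ?H = "{h. N h \<noteq> 0}"
  have H: "finite ?H" "?H \<noteq> {}"
    using finite_support[OF N(1)] N(2) by (auto simp: fun_eq_iff)
  have "det_on ?H (\<lambda>h h'. (if h = h' then P_vac 0 N h else 0) + ip_min ip h h' * real (N h')) = 0"
  proof (rule det_on_row_sums_0[OF H])
    fix h assume "h \<in> ?H"
    then have "(\<Sum>h'\<in>?H. if h = h' then P_vac 0 N h else 0) = P_vac 0 N h"
      using H(1) by simp
    then show "(\<Sum>h'\<in>?H. (if h = h' then P_vac 0 N h else 0) + ip_min ip h h' * real (N h')) = 0"
      by (simp add: sum.distrib P_vac_def)
  qed
  then show ?thesis by (simp add: R_coeff_def)
qed

lemma zero_in_families: "(0 :: 'm \<times> nat \<Rightarrow> nat) \<in> families"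
  by (simp add: families_def)

lemma families_of_weight_0: "families_of_weight (\<lambda>_ :: 'n. 0) = {0}"
proof -
  have "N = 0" if "N \<in> families_of_weight (\<lambda>_ :: 'n. 0)" for N
  proof
    fix h :: "'n \<times> nat"
    obtain a m where h: "h = (a, m)" by (cases h)
    show "N h = 0 h"
    proof (rule ccontr)
      assume "N h \<noteq> 0 h"
      then have "N (a, m) \<noteq> 0" using h by simp
      then show False using families_of_weight_bound[OF that, of a m] by simp
    qed
  qed
  moreover have "0 \<in> families_of_weight (\<lambda>_ :: 'n. 0)"
    using zero_in_families by (simp add: families_of_weight_def weight_def fun_eq_iff)
  ultimately show ?thesis by blast
qed

lemma R_series_0: "fam_series (R_coeff 0) = 1"
proof (rule mfps_eqI)
  fix \<beta> :: "'n \<Rightarrow> nat"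
  have R0: "R_coeff 0 0 = 1"
    by (simp add: R_coeff_def det_on_def)
  show "mcoeff (fam_series (R_coeff 0)) \<beta> = mcoeff 1 \<beta>"
  proof (cases "\<beta> = (\<lambda>_. 0)")
    case True
    then show ?thesis by (simp add: mcoeff_fam_series families_of_weight_0 R0 mcoeff_one)
  next
    case False
    have "R_coeff 0 N = 0" if "N \<in> families_of_weight \<beta>" for N
    proof (rule R_coeff_0_nonzero)
      show "N \<in> families" using that by (simp add: families_of_weight_def)
      show "N \<noteq> 0"
      proof
        assume "N = 0"
        then have "\<beta> = weight 0" using that by (simp add: families_of_weight_def)
        then show False using False by (simp add: weight_def fun_eq_iff)
      qed
    qed
    then show ?thesis using False by (simp add: mcoeff_fam_series mcoeff_one)
  qed
qed

lemma K_series_0_unit: "fam_series (K_coeff 0) dvd 1"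
proof (rule mfps_unit)
  have "K_coeff 0 0 = 1" by (simp add: K_coeff_def)
  then show "mcoeff (fam_series (K_coeff 0)) (\<lambda>_. 0) = 1"
    by (simp add: mcoeff_fam_series families_of_weight_0)
qed

lemma PP_eq: "PP ip \<nu> N = P_vac (\<lambda>h. real (gam \<nu> h)) N"
  by (simp add: PP_def P_vac_def fun_eq_iff)

lemma K_tilde_eq: "K_tilde ip \<nu> = fam_series (K_coeff (\<lambda>h. real (gam \<nu> h)))"
  by (simp add: K_tilde_def fam_series_def KK_def[abs_def] K_coeff_def[abs_def] PP_eq)

lemma R_tilde_eq: "R_tilde ip \<nu> = fam_series (R_coeff (\<lambda>h. real (gam \<nu> h)))"
proof -
  have "RR ip \<nu> N = R_coeff (\<lambda>h. real (gam \<nu> h)) N" for N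
  proof (cases "N = (\<lambda>_. 0)")
    case True
    then show ?thesis by (simp add: RR_def R_coeff_def det_on_def)
  next
    case False
    have pos: "N h > 0 \<longleftrightarrow> N h \<noteq> 0" for h by simp
    show ?thesis
      using False unfolding RR_def R_coeff_def FF_def[abs_def] PP_eq pos by simp
  qed
  then show ?thesis by (simp add: R_tilde_def fam_series_def)
qed

end

lemma gam_eq_gam_int: "(\<lambda>h. real (gam \<nu> h)) = gam_int (\<lambda>h. int (\<nu> h))"
  by (simp add: gam_def gam_int_def fun_eq_iff)

context q_system
begin

lemma Q_tilde_eq: "Q_tilde Q \<nu> = Q_power Q (\<lambda>h. int (\<nu> h))"
  by (simp add: Q_tilde_def Q_power_def)

theorem Q_tilde_eq_R_tilde:
  assumes "\<nu> \<in> families"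
  shows "Q_tilde Q \<nu> = R_tilde ip \<nu>"
proof -
  have "(\<lambda>h. int (\<nu> h)) \<in> fin_supp"
    using assms by (simp add: families_def fin_supp_def)
  from pascal_series_eq_Q_power[OF R_coeff_pascal this] show ?thesis
    unfolding Q_tilde_eq R_tilde_eq gam_eq_gam_int R_series_0 by (simp only: mult_1_right)
qed

theorem Q_tilde_times_K_tilde:
  assumes "\<nu> \<in> families"
  shows "K_tilde ip \<nu> = Q_tilde Q \<nu> * K_tilde ip (\<lambda>_. 0)"
proof -
  have "(\<lambda>h. int (\<nu> h)) \<in> fin_supp"
    using assms by (simp add: families_def fin_supp_def)
  note main = pascal_series_eq_Q_power[OF K_coeff_pascal this]
  have "gam_int (\<lambda>h. int ((\<lambda>_. 0 :: nat) h)) = (0 :: 'n \<times> nat \<Rightarrow> real)"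
    using gam_int_0 by (simp add: gam_int_def fun_eq_iff)
  then show ?thesis
    using main unfolding Q_tilde_eq K_tilde_eq gam_eq_gam_int by (simp only:)
qed

lemma K_tilde_0_unit: "K_tilde ip (\<lambda>_. 0) dvd 1"
proof -
  have "(\<lambda>h. real (gam (\<lambda>_. 0) h)) = (0 :: 'n \<times> nat \<Rightarrow> real)"
    by (simp add: gam_def fun_eq_iff)
  then show ?thesis
    unfolding K_tilde_eq using K_series_0_unit by (simp only:)
qed

end

section \<open>Passage to the variables x\<close>

text \<open>Injectivity of the exponent map, a consequence of the nondegeneracy of the Gram matrix, is all that the
  substitution \<open>y = y(x)\<close> requires.\<close>

locale y_exponents =
  fixes ip :: "'n::finite \<Rightarrow> 'n \<Rightarrow> real"
  assumes y_mono_exp_inj: "inj (y_mono_exp ip)"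
begin

abbreviation "X \<equiv> x_ring ip"

definition cone :: "('n \<Rightarrow> int) \<Rightarrow> ('n \<Rightarrow> int) set" where
  "cone \<mu> = range (\<lambda>\<beta> b. \<mu> b + y_mono_exp ip \<beta> b)"

lemma y_mono_exp_add: "y_mono_exp ip (\<lambda>a. \<beta> a + \<gamma> a) b = y_mono_exp ip \<beta> b + y_mono_exp ip \<gamma> b"
  by (simp add: y_mono_exp_def distrib_right sum.distrib)

lemma y_mono_exp_0: "y_mono_exp ip (\<lambda>_. 0) = (\<lambda>_. 0)"
  by (simp add: y_mono_exp_def fun_eq_iff)

text \<open>By injectivity, an exponent in the sum of two cones determines the sum of the two exponent vectors in \<open>\<nat>\<^sup>n\<close>, which has
  finitely many splittings.\<close>

lemma finite_cone_splittings:
  "finite {(u, v). u \<in> cone \<mu> \<and> v \<in> cone \<mu>' \<and> (\<forall>b. u b + v b = e b)}" (is "finite ?A")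
proof (cases "?A = {}")
  case False
  let ?f = "\<lambda>(\<beta>, \<gamma>). (\<lambda>b. \<mu> b + y_mono_exp ip \<beta> b, \<lambda>b. \<mu>' b + y_mono_exp ip \<gamma> b)"
  have split: "\<exists>\<beta> \<gamma>. p = ?f (\<beta>, \<gamma>) \<and> (\<forall>b. \<mu> b + \<mu>' b + y_mono_exp ip (\<lambda>a. \<beta> a + \<gamma> a) b = e b)"
    if "p \<in> ?A" for p
  proof -
    obtain u v where p: "p = (u, v)" by (cases p)
    have uv: "u \<in> cone \<mu>" "v \<in> cone \<mu>'" "\<forall>b. u b + v b = e b"
      using that unfolding p by simp_all
    obtain \<beta> where \<beta>: "u = (\<lambda>b. \<mu> b + y_mono_exp ip \<beta> b)" using uv(1) unfolding cone_def by blast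
    obtain \<gamma> where \<gamma>: "v = (\<lambda>b. \<mu>' b + y_mono_exp ip \<gamma> b)" using uv(2) unfolding cone_def by blast
    have "\<mu> b + \<mu>' b + y_mono_exp ip (\<lambda>a. \<beta> a + \<gamma> a) b = e b" for b
      using spec[OF uv(3), of b] unfolding \<beta> \<gamma> y_mono_exp_add by simp
    then show ?thesis using p \<beta> \<gamma> by (intro exI[of _ \<beta>] exI[of _ \<gamma>]) simp
  qed
  obtain p where "p \<in> ?A" using False by blast
  from split[OF this] obtain \<delta> where \<delta>: "\<forall>b. \<mu> b + \<mu>' b + y_mono_exp ip \<delta> b = e b" by blast
  have "?A \<subseteq> ?f ` {(\<beta>, \<gamma>). \<forall>a. \<beta> a + \<gamma> a = \<delta> a}"
  proof
    fix p assume "p \<in> ?A"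
    from split[OF this] obtain \<beta> \<gamma> where p: "p = ?f (\<beta>, \<gamma>)"
      and e: "\<forall>b. \<mu> b + \<mu>' b + y_mono_exp ip (\<lambda>a. \<beta> a + \<gamma> a) b = e b" by blast
    have "y_mono_exp ip (\<lambda>a. \<beta> a + \<gamma> a) b = y_mono_exp ip \<delta> b" for b
      using spec[OF e, of b] spec[OF \<delta>, of b] by linarith
    then have "y_mono_exp ip (\<lambda>a. \<beta> a + \<gamma> a) = y_mono_exp ip \<delta>" by (rule ext)
    then have "(\<lambda>a. \<beta> a + \<gamma> a) = \<delta>" by (rule injD[OF y_mono_exp_inj])
    then have "(\<beta>, \<gamma>) \<in> {(\<beta>, \<gamma>). \<forall>a. \<beta> a + \<gamma> a = \<delta> a}" by auto
    then show "p \<in> ?f ` {(\<beta>, \<gamma>). \<forall>a. \<beta> a + \<gamma> a = \<delta> a}"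
      unfolding p by (rule imageI)
  qed
  then show ?thesis
    using finite_exponent_splittings finite_surj by blast
next
  case True
  then show ?thesis by (simp only: finite.emptyI)
qed

lemma carrier_iff: "f \<in> carrier X \<longleftrightarrow> (\<exists>S. finite S \<and> {e. f e \<noteq> 0} \<subseteq> (\<Union>\<mu>\<in>S. cone \<mu>))"
proof -
  have "(\<forall>e. f e \<noteq> 0 \<longrightarrow> (\<exists>\<mu>\<in>S. \<exists>\<beta>. e = (\<lambda>b. \<mu> b + y_mono_exp ip \<beta> b)))
    \<longleftrightarrow> {e. f e \<noteq> 0} \<subseteq> (\<Union>\<mu>\<in>S. cone \<mu>)" for S
    unfolding cone_def by (auto simp: subset_iff image_iff)
  then show ?thesis by (simp add: x_ring_def)
qed

definition splits :: "(('n \<Rightarrow> int) \<Rightarrow> complex) \<Rightarrow> (('n \<Rightarrow> int) \<Rightarrow> complex) \<Rightarrow> ('n \<Rightarrow> int) \<Rightarrow> (('n \<Rightarrow> int) \<times> ('n \<Rightarrow> int)) set" where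
  "splits f g e = {(u, v). (\<forall>b. u b + v b = e b) \<and> f u \<noteq> 0 \<and> g v \<noteq> 0}"

lemma mult_eq: "(f \<otimes>\<^bsub>X\<^esub> g) e = (\<Sum>(u, v)\<in>splits f g e. f u * g v)"
  by (simp add: x_ring_def splits_def)

lemma finite_splits:
  assumes "f \<in> carrier X" "g \<in> carrier X"
  shows "finite (splits f g e)"
proof -
  obtain S T where S: "finite S" "{e. f e \<noteq> 0} \<subseteq> (\<Union>\<mu>\<in>S. cone \<mu>)"
    and T: "finite T" "{e. g e \<noteq> 0} \<subseteq> (\<Union>\<mu>\<in>T. cone \<mu>)"
    using assms unfolding carrier_iff by blast
  have "splits f g e \<subseteq> (\<Union>\<mu>\<in>S. \<Union>\<mu>'\<in>T. {(u, v). u \<in> cone \<mu> \<and> v \<in> cone \<mu>' \<and> (\<forall>b. u b + v b = e b)})"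
  proof
    fix p assume "p \<in> splits f g e"
    then obtain u v where p: "p = (u, v)" "\<forall>b. u b + v b = e b" "f u \<noteq> 0" "g v \<noteq> 0"
      by (auto simp: splits_def)
    then obtain \<mu> \<mu>' where "\<mu> \<in> S" "u \<in> cone \<mu>" "\<mu>' \<in> T" "v \<in> cone \<mu>'"
      using S(2) T(2) by blast
    then show "p \<in> (\<Union>\<mu>\<in>S. \<Union>\<mu>'\<in>T. {(u, v). u \<in> cone \<mu> \<and> v \<in> cone \<mu>' \<and> (\<forall>b. u b + v b = e b)})"
      using p by blast
  qed
  then show ?thesis
    by (rule finite_subset) (intro finite_UN_I S T finite_cone_splittings)
qed

lemma support_mult:
  assumes "(f \<otimes>\<^bsub>X\<^esub> g) e \<noteq> 0"
  obtains u v where "(u, v) \<in> splits f g e"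
  using assms unfolding mult_eq by (metis (no_types, lifting) equals0I prod.collapse sum.empty)

lemma cone_add:
  assumes "u \<in> cone \<mu>" "v \<in> cone \<mu>'"
  shows "(\<lambda>b. u b + v b) \<in> cone (\<lambda>b. \<mu> b + \<mu>' b)"
proof -
  obtain \<beta> where \<beta>: "u = (\<lambda>b. \<mu> b + y_mono_exp ip \<beta> b)" using assms(1) unfolding cone_def by blast
  obtain \<gamma> where \<gamma>: "v = (\<lambda>b. \<mu>' b + y_mono_exp ip \<gamma> b)" using assms(2) unfolding cone_def by blast
  show ?thesis
    unfolding cone_def \<beta> \<gamma> by (rule range_eqI[of _ _ "\<lambda>a. \<beta> a + \<gamma> a"]) (simp add: y_mono_exp_add add_ac)
qed

lemma mult_closed:
  assumes "f \<in> carrier X" "g \<in> carrier X"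
  shows "f \<otimes>\<^bsub>X\<^esub> g \<in> carrier X"
proof -
  obtain S T where S: "finite S" "{e. f e \<noteq> 0} \<subseteq> (\<Union>\<mu>\<in>S. cone \<mu>)"
    and T: "finite T" "{e. g e \<noteq> 0} \<subseteq> (\<Union>\<mu>\<in>T. cone \<mu>)"
    using assms unfolding carrier_iff by blast
  let ?U = "(\<lambda>(\<mu>, \<mu>') b. \<mu> b + \<mu>' b) ` (S \<times> T)"
  have "{e. (f \<otimes>\<^bsub>X\<^esub> g) e \<noteq> 0} \<subseteq> (\<Union>\<mu>\<in>?U. cone \<mu>)"
  proof
    fix e assume "e \<in> {e. (f \<otimes>\<^bsub>X\<^esub> g) e \<noteq> 0}"
    then have "(f \<otimes>\<^bsub>X\<^esub> g) e \<noteq> 0" by simp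
    then obtain u v where "(u, v) \<in> splits f g e" by (rule support_mult)
    then have uv: "\<forall>b. u b + v b = e b" "f u \<noteq> 0" "g v \<noteq> 0" by (auto simp: splits_def)
    then obtain \<mu> \<mu>' where \<mu>: "\<mu> \<in> S" "u \<in> cone \<mu>" "\<mu>' \<in> T" "v \<in> cone \<mu>'"
      using S(2) T(2) by blast
    have "e = (\<lambda>b. u b + v b)" using uv(1) by auto
    then have "e \<in> cone (\<lambda>b. \<mu> b + \<mu>' b)" using cone_add[OF \<mu>(2,4)] by simp
    then show "e \<in> (\<Union>\<mu>\<in>?U. cone \<mu>)" using \<mu>(1,3) by force
  qed
  then show ?thesis
    unfolding carrier_iff using S(1) T(1) by (intro exI[of _ ?U] conjI) auto
qed

lemma mult_comm: "f \<otimes>\<^bsub>X\<^esub> g = g \<otimes>\<^bsub>X\<^esub> f"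
proof
  fix e
  show "(f \<otimes>\<^bsub>X\<^esub> g) e = (g \<otimes>\<^bsub>X\<^esub> f) e"
    unfolding mult_eq
    by (rule sum.reindex_bij_witness[of _ prod.swap prod.swap]) (auto simp: splits_def add.commute)
qed

lemma x_monom_mult: "(x_monom \<mu> \<otimes>\<^bsub>X\<^esub> f) e = f (\<lambda>b. e b - \<mu> b)"
proof -
  let ?v = "\<lambda>b. e b - \<mu> b"
  have "splits (x_monom \<mu>) f e = (if f ?v = 0 then {} else {(\<mu>, ?v)})"
  proof -
    have "(u, v) \<in> splits (x_monom \<mu>) f e \<longleftrightarrow> u = \<mu> \<and> v = ?v \<and> f v \<noteq> 0" for u v
      unfolding splits_def x_monom_def by (auto simp: fun_eq_iff algebra_simps)
    then show ?thesis by (auto simp: set_eq_iff)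
  qed
  then show ?thesis by (simp add: mult_eq x_monom_def)
qed

lemma one_eq: "\<one>\<^bsub>X\<^esub> = x_monom (\<lambda>_. 0)"
  by (simp add: x_ring_def x_monom_def fun_eq_iff)

lemma x_monom_closed: "x_monom \<mu> \<in> carrier X"
proof -
  have "\<mu> \<in> cone \<mu>"
    unfolding cone_def by (rule range_eqI[of _ _ "\<lambda>_. 0"]) (simp add: y_mono_exp_0)
  then show ?thesis
    unfolding carrier_iff by (intro exI[of _ "{\<mu>}"]) (auto simp: x_monom_def)
qed

text \<open>Convolution sums may be taken over any finite set of splittings that contains the relevant ones.\<close>

lemma mult_eq_superset:
  assumes "finite A" "splits f g e \<subseteq> A" "A \<subseteq> {(u, v). \<forall>b. u b + v b = e b}"
  shows "(f \<otimes>\<^bsub>X\<^esub> g) e = (\<Sum>(u, v)\<in>A. f u * g v)"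
  unfolding mult_eq
  by (rule sum.mono_neutral_left[OF assms(1,2)]) (use assms(3) in \<open>auto simp: splits_def\<close>)

text \<open>A description of a triple product that is symmetric in its factors, from which associativity follows by
  commutativity.\<close>

lemma mult_assoc_eq:
  assumes f: "f \<in> carrier X" and g: "g \<in> carrier X" and h: "h \<in> carrier X"
  defines "T \<equiv> \<lambda>e. {(s, t, v). (\<forall>b. s b + t b + v b = e b) \<and> f s \<noteq> 0 \<and> g t \<noteq> 0 \<and> h v \<noteq> 0}"
  shows "((f \<otimes>\<^bsub>X\<^esub> g) \<otimes>\<^bsub>X\<^esub> h) e = (\<Sum>(s, t, v)\<in>T e. f s * g t * h v)"
    and "finite (T e)"
proof -
  obtain S1 where S1: "finite S1" "{e. f e \<noteq> 0} \<subseteq> (\<Union>\<mu>\<in>S1. cone \<mu>)" using f unfolding carrier_iff by blast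
  obtain S2 where S2: "finite S2" "{e. g e \<noteq> 0} \<subseteq> (\<Union>\<mu>\<in>S2. cone \<mu>)" using g unfolding carrier_iff by blast
  obtain S3 where S3: "finite S3" "{e. h e \<noteq> 0} \<subseteq> (\<Union>\<mu>\<in>S3. cone \<mu>)" using h unfolding carrier_iff by blast
  let ?W = "\<Union>\<mu>1\<in>S1. \<Union>\<mu>2\<in>S2. \<Union>\<mu>3\<in>S3. {(w, v). w \<in> cone (\<lambda>b. \<mu>1 b + \<mu>2 b) \<and> v \<in> cone \<mu>3 \<and> (\<forall>b. w b + v b = e b)}"
  have W: "finite ?W"
    by (intro finite_UN_I S1 S2 S3 finite_cone_splittings)
  have sub: "((\<lambda>b. s b + t b), v) \<in> ?W" if st: "f s \<noteq> 0" "g t \<noteq> 0" "h v \<noteq> 0" "\<forall>b. s b + t b + v b = e b" for s t v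
  proof -
    obtain \<mu>1 \<mu>2 \<mu>3 where \<mu>: "\<mu>1 \<in> S1" "s \<in> cone \<mu>1" "\<mu>2 \<in> S2" "t \<in> cone \<mu>2" "\<mu>3 \<in> S3" "v \<in> cone \<mu>3"
      using st S1(2) S2(2) S3(2) by blast
    have "(\<lambda>b. s b + t b) \<in> cone (\<lambda>b. \<mu>1 b + \<mu>2 b)" by (rule cone_add[OF \<mu>(2,4)])
    then show ?thesis using \<mu> st(4) by blast
  qed
  let ?Sig = "Sigma ?W (\<lambda>p. splits f g (fst p))"
  have Sig: "finite ?Sig"
    by (rule finite_SigmaI[OF W]) (intro finite_splits[OF f g])
  have "((f \<otimes>\<^bsub>X\<^esub> g) \<otimes>\<^bsub>X\<^esub> h) e = (\<Sum>(w, v)\<in>?W. (f \<otimes>\<^bsub>X\<^esub> g) w * h v)"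
  proof (rule mult_eq_superset[OF W])
    show "splits (f \<otimes>\<^bsub>X\<^esub> g) h e \<subseteq> ?W"
    proof
      fix p assume "p \<in> splits (f \<otimes>\<^bsub>X\<^esub> g) h e"
      then obtain w v where p: "p = (w, v)" "\<forall>b. w b + v b = e b" "(f \<otimes>\<^bsub>X\<^esub> g) w \<noteq> 0" "h v \<noteq> 0"
        by (auto simp: splits_def)
      from p(3) obtain s t where "(s, t) \<in> splits f g w" by (rule support_mult)
      then have st: "\<forall>b. s b + t b = w b" "f s \<noteq> 0" "g t \<noteq> 0" by (auto simp: splits_def)
      then have "w = (\<lambda>b. s b + t b)" by auto
      then show "p \<in> ?W" using sub[OF st(2,3) p(4)] p(1,2) by simp
    qed
  qed blast
  also have "\<dots> = (\<Sum>p\<in>?W. \<Sum>q\<in>splits f g (fst p). f (fst q) * g (snd q) * h (snd p))"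
    by (simp add: mult_eq sum_distrib_right split_def)
  also have "\<dots> = (\<Sum>(p, q)\<in>?Sig. f (fst q) * g (snd q) * h (snd p))"
    by (rule sum.Sigma[OF W]) (intro ballI finite_splits[OF f g])
  also have "\<dots> = (\<Sum>(p, q)\<in>?Sig \<inter> {(p, q). h (snd p) \<noteq> 0}. f (fst q) * g (snd q) * h (snd p))"
    by (rule sum.mono_neutral_right[OF Sig]) auto
  also have "\<dots> = (\<Sum>(s, t, v)\<in>T e. f s * g t * h v)"
    by (rule sum.reindex_bij_witness[of _ "\<lambda>(s, t, v). (((\<lambda>b. s b + t b), v), (s, t))" "\<lambda>(p, q). (fst q, snd q, snd p)"])
       (auto simp: T_def splits_def fun_eq_iff intro!: sub)
  finally show "((f \<otimes>\<^bsub>X\<^esub> g) \<otimes>\<^bsub>X\<^esub> h) e = (\<Sum>(s, t, v)\<in>T e. f s * g t * h v)" .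
  have "T e \<subseteq> (\<lambda>(p, q). (fst q, snd q, snd p)) ` ?Sig"
  proof
    fix x assume "x \<in> T e"
    then obtain s t v where x: "x = (s, t, v)" "\<forall>b. s b + t b + v b = e b" "f s \<noteq> 0" "g t \<noteq> 0" "h v \<noteq> 0"
      by (auto simp: T_def)
    have "(((\<lambda>b. s b + t b), v), (s, t)) \<in> ?Sig"
      using sub[OF x(3-5,2)] x by (auto simp: splits_def)
    then show "x \<in> (\<lambda>(p, q). (fst q, snd q, snd p)) ` ?Sig"
      unfolding x(1) by (rule rev_image_eqI) simp
  qed
  then show "finite (T e)"
    using Sig finite_surj by blast
qed

lemma mult_assoc:
  assumes f: "f \<in> carrier X" and g: "g \<in> carrier X" and h: "h \<in> carrier X"
  shows "(f \<otimes>\<^bsub>X\<^esub> g) \<otimes>\<^bsub>X\<^esub> h = f \<otimes>\<^bsub>X\<^esub> (g \<otimes>\<^bsub>X\<^esub> h)"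
proof
  fix e
  have "f \<otimes>\<^bsub>X\<^esub> (g \<otimes>\<^bsub>X\<^esub> h) = (g \<otimes>\<^bsub>X\<^esub> h) \<otimes>\<^bsub>X\<^esub> f" by (rule mult_comm)
  then show "((f \<otimes>\<^bsub>X\<^esub> g) \<otimes>\<^bsub>X\<^esub> h) e = (f \<otimes>\<^bsub>X\<^esub> (g \<otimes>\<^bsub>X\<^esub> h)) e"
    unfolding mult_assoc_eq(1)[OF f g h] mult_assoc_eq(1)[OF g h f]
    by (simp only: mult_assoc_eq(1)[OF g h f])
       (rule sum.reindex_bij_witness[of _ "\<lambda>(t, v, s). (s, t, v)" "\<lambda>(s, t, v). (t, v, s)"], auto simp: add_ac mult_ac)
qed

lemma x_ring_comm_monoid: "comm_monoid X"
proof (rule comm_monoidI)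
  show "\<one>\<^bsub>X\<^esub> \<in> carrier X" unfolding one_eq by (rule x_monom_closed)
  show "\<one>\<^bsub>X\<^esub> \<otimes>\<^bsub>X\<^esub> f = f" for f
    unfolding one_eq by (rule ext) (simp add: x_monom_mult)
qed (rule mult_closed mult_assoc mult_comm; assumption?)+

sublocale x: comm_monoid X
  by (rule x_ring_comm_monoid)

lemma y_of_x_exp: "y_of_x ip f (y_mono_exp ip \<beta>) = mcoeff f \<beta>"
proof -
  have "{\<gamma>. y_mono_exp ip \<gamma> = y_mono_exp ip \<beta>} = {\<beta>}"
    using injD[OF y_mono_exp_inj] by blast
  then show ?thesis by (simp add: y_of_x_def)
qed

lemma y_of_x_support: "y_of_x ip f e \<noteq> 0 \<Longrightarrow> \<exists>\<beta>. e = y_mono_exp ip \<beta>"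
  unfolding y_of_x_def by (metis (mono_tags, lifting) Collect_empty_eq sum.empty)

lemma y_of_x_closed: "y_of_x ip f \<in> carrier X"
proof -
  have "cone (\<lambda>_. 0) = range (y_mono_exp ip)" by (simp add: cone_def)
  then show ?thesis
    unfolding carrier_iff using y_of_x_support[of f] by (intro exI[of _ "{\<lambda>_. 0}"]) (auto simp: image_iff)
qed

lemma y_of_x_1: "y_of_x ip 1 = \<one>\<^bsub>X\<^esub>"
proof
  fix e
  show "y_of_x ip 1 e = \<one>\<^bsub>X\<^esub> e"
  proof (cases "\<exists>\<beta>. e = y_mono_exp ip \<beta>")
    case True
    then obtain \<beta> where e: "e = y_mono_exp ip \<beta>" by blast
    have "y_mono_exp ip \<beta> = (\<lambda>_. 0) \<longleftrightarrow> \<beta> = (\<lambda>_. 0)"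
      using injD[OF y_mono_exp_inj, of \<beta> "\<lambda>_. 0"] y_mono_exp_0 by auto
    then show ?thesis unfolding e y_of_x_exp by (simp add: one_eq x_monom_def one_mfps.rep_eq)
  next
    case False
    then have "e \<noteq> (\<lambda>_. 0)" using y_mono_exp_0 by metis
    then show ?thesis using False y_of_x_support[of 1 e] by (auto simp: one_eq x_monom_def)
  qed
qed

lemma y_of_x_mult: "y_of_x ip (f * g) = y_of_x ip f \<otimes>\<^bsub>X\<^esub> y_of_x ip g"
proof
  fix e
  show "y_of_x ip (f * g) e = (y_of_x ip f \<otimes>\<^bsub>X\<^esub> y_of_x ip g) e"
  proof (cases "\<exists>\<beta>. e = y_mono_exp ip \<beta>")
    case True
    then obtain \<beta> where e: "e = y_mono_exp ip \<beta>" by blast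
    let ?E = "y_mono_exp ip" and ?S = "{(\<gamma>, \<delta>). \<forall>a. \<gamma> a + \<delta> a = \<beta> a}"
    let ?j = "\<lambda>(\<gamma>, \<delta>). (?E \<gamma>, ?E \<delta>)"
    have inj: "inj_on ?j ?S"
      using injD[OF y_mono_exp_inj] by (auto intro!: inj_onI)
    have add: "(\<forall>b. ?E \<gamma> b + ?E \<delta> b = ?E \<beta> b) = (\<forall>a. \<gamma> a + \<delta> a = \<beta> a)" for \<gamma> \<delta>
    proof
      assume *: "\<forall>b. ?E \<gamma> b + ?E \<delta> b = ?E \<beta> b"
      have "?E (\<lambda>a. \<gamma> a + \<delta> a) = ?E \<beta>"
        by (rule ext) (simp add: y_mono_exp_add *)
      then have "(\<lambda>a. \<gamma> a + \<delta> a) = \<beta>" by (rule injD[OF y_mono_exp_inj])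
      then show "\<forall>a. \<gamma> a + \<delta> a = \<beta> a" by (auto dest: fun_cong)
    next
      assume "\<forall>a. \<gamma> a + \<delta> a = \<beta> a"
      then have "(\<lambda>a. \<gamma> a + \<delta> a) = \<beta>" by auto
      then show "\<forall>b. ?E \<gamma> b + ?E \<delta> b = ?E \<beta> b"
        using y_mono_exp_add[of \<gamma> \<delta>] by simp
    qed
    have "(y_of_x ip f \<otimes>\<^bsub>X\<^esub> y_of_x ip g) e = (\<Sum>(u, v)\<in>?j ` ?S. y_of_x ip f u * y_of_x ip g v)"
    proof (rule mult_eq_superset)
      show "finite (?j ` ?S)" using finite_exponent_splittings by blast
      show "?j ` ?S \<subseteq> {(u, v). \<forall>b. u b + v b = e b}"
        using add e by auto
      show "splits (y_of_x ip f) (y_of_x ip g) e \<subseteq> ?j ` ?S"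
      proof
        fix p assume "p \<in> splits (y_of_x ip f) (y_of_x ip g) e"
        then obtain u v where p: "p = (u, v)" "\<forall>b. u b + v b = e b" "y_of_x ip f u \<noteq> 0" "y_of_x ip g v \<noteq> 0"
          by (auto simp: splits_def)
        obtain \<gamma> \<delta> where uv: "u = ?E \<gamma>" "v = ?E \<delta>"
          using y_of_x_support p(3,4) by meson
        then have "(\<gamma>, \<delta>) \<in> ?S" using p(2) add[of \<gamma> \<delta>] e by simp
        then show "p \<in> ?j ` ?S" unfolding p(1) uv by (rule rev_image_eqI) simp
      qed
    qed
    also have "\<dots> = (\<Sum>(\<gamma>, \<delta>)\<in>?S. mcoeff f \<gamma> * mcoeff g \<delta>)"
      by (subst sum.reindex[OF inj], rule sum.cong) (auto simp: y_of_x_exp)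
    also have "\<dots> = y_of_x ip (f * g) e"
      unfolding e y_of_x_exp by (simp add: times_mfps.rep_eq)
    finally show ?thesis ..
  next
    case False
    have "(y_of_x ip f \<otimes>\<^bsub>X\<^esub> y_of_x ip g) e = 0"
    proof (rule ccontr)
      assume "(y_of_x ip f \<otimes>\<^bsub>X\<^esub> y_of_x ip g) e \<noteq> 0"
      then obtain u v where "(u, v) \<in> splits (y_of_x ip f) (y_of_x ip g) e" by (rule support_mult)
      then have uv: "\<forall>b. u b + v b = e b" "y_of_x ip f u \<noteq> 0" "y_of_x ip g v \<noteq> 0" by (auto simp: splits_def)
      obtain \<gamma> \<delta> where "u = y_mono_exp ip \<gamma>" "v = y_mono_exp ip \<delta>"
        using y_of_x_support uv(2,3) by meson
      then have "e = y_mono_exp ip (\<lambda>a. \<gamma> a + \<delta> a)"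
        using uv(1) by (auto simp: fun_eq_iff y_mono_exp_add)
      then show False using False by blast
    qed
    then show ?thesis using False y_of_x_support by metis
  qed
qed

lemma x_monom_add: "x_monom \<mu> \<otimes>\<^bsub>X\<^esub> x_monom \<mu>' = x_monom (\<lambda>b. \<mu> b + \<mu>' b)"
proof
  fix e
  have "(\<lambda>b. e b - \<mu> b) = \<mu>' \<longleftrightarrow> e = (\<lambda>b. \<mu> b + \<mu>' b)"
    by (auto simp: fun_eq_iff algebra_simps)
  then show "(x_monom \<mu> \<otimes>\<^bsub>X\<^esub> x_monom \<mu>') e = x_monom (\<lambda>b. \<mu> b + \<mu>' b) e"
    unfolding x_monom_mult by (simp add: x_monom_def)
qed

text \<open>The series \<open>x\<^sup>\<mu> f(y(x))\<close>. All elements of the ring that occur in the theorem have this form, and their products are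
  computed componentwise.\<close>

definition graded :: "('n \<Rightarrow> int) \<Rightarrow> 'n mfps \<Rightarrow> ('n \<Rightarrow> int) \<Rightarrow> complex" where
  "graded \<mu> f = x_monom \<mu> \<otimes>\<^bsub>X\<^esub> y_of_x ip f"

lemma graded_closed: "graded \<mu> f \<in> carrier X"
  unfolding graded_def by (intro mult_closed x_monom_closed y_of_x_closed)

lemma graded_1: "graded (\<lambda>_. 0) 1 = \<one>\<^bsub>X\<^esub>"
  unfolding graded_def y_of_x_1 one_eq[symmetric] by (rule x.l_one) (rule x.one_closed)

lemma graded_mult: "graded \<mu> f \<otimes>\<^bsub>X\<^esub> graded \<mu>' g = graded (\<lambda>b. \<mu> b + \<mu>' b) (f * g)"
  unfolding graded_def x_monom_add[symmetric] y_of_x_mult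
  by (simp add: x.m_ac x_monom_closed y_of_x_closed mult_closed)

lemma graded_power: "graded \<mu> f [^]\<^bsub>X\<^esub> (k :: nat) = graded (\<lambda>b. int k * \<mu> b) (f ^ k)"
proof (induction k)
  case 0
  show ?case by (simp add: graded_1)
next
  case (Suc k)
  have "graded \<mu> f [^]\<^bsub>X\<^esub> Suc k = graded (\<lambda>b. int k * \<mu> b + \<mu> b) (f ^ k * f)"
    by (simp add: Suc graded_mult)
  also have "\<dots> = graded (\<lambda>b. int (Suc k) * \<mu> b) (f ^ Suc k)"
    by (simp add: algebra_simps)
  finally show ?case .
qed

lemma graded_finprod:
  "finite A \<Longrightarrow> (\<Otimes>\<^bsub>X\<^esub>h\<in>A. graded (\<mu> h) (f h)) = graded (\<lambda>b. \<Sum>h\<in>A. \<mu> h b) (\<Prod>h\<in>A. f h)"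
proof (induction A rule: finite_induct)
  case empty
  show ?case by (simp add: graded_1)
next
  case (insert h A)
  then show ?case by (simp add: graded_closed graded_mult)
qed

lemma graded_inv:
  assumes "f * g = 1"
  shows "inv\<^bsub>X\<^esub> graded (\<lambda>_. 0) f = graded (\<lambda>_. 0) g"
proof (rule x.comm_inv_char[OF graded_closed graded_closed])
  show "graded (\<lambda>_. 0) f \<otimes>\<^bsub>X\<^esub> graded (\<lambda>_. 0) g = \<one>\<^bsub>X\<^esub>"
    unfolding graded_mult assms by (simp add: graded_1)
qed

lemma Q_x_eq:
  assumes "\<nu> \<in> families"
  shows "Q_x ip Q \<nu> = graded (\<lambda>a. int (weight \<nu> a)) (Q_tilde Q \<nu>)"
proof -
  let ?H = "{h. \<nu> h \<noteq> 0}" and ?\<mu> = "\<lambda>h b. if b = fst h then int (snd h) else 0"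
  have H: "finite ?H" using assms by (simp add: families_def)
  have "Q_x ip Q \<nu> = (\<Otimes>\<^bsub>X\<^esub>h\<in>?H. graded (\<lambda>b. int (\<nu> h) * ?\<mu> h b) (Q h ^ \<nu> h))"
    unfolding Q_x_def graded_power[symmetric] by (simp add: Q_x1_def graded_def split_def)
  also have "\<dots> = graded (\<lambda>b. \<Sum>h\<in>?H. int (\<nu> h) * ?\<mu> h b) (\<Prod>h\<in>?H. Q h ^ \<nu> h)"
    by (rule graded_finprod[OF H])
  also have "(\<lambda>b. \<Sum>h\<in>?H. int (\<nu> h) * ?\<mu> h b) = (\<lambda>b. int (weight \<nu> b))"
  proof
    fix b
    have "(\<Sum>h\<in>?H. int (\<nu> h) * ?\<mu> h b) = (\<Sum>h\<in>Pair b ` {m. \<nu> (b, m) \<noteq> 0}. int (snd h * \<nu> h))"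
      using H by (intro sum.mono_neutral_cong_right) (auto split: if_splits)
    also have "\<dots> = int (weight \<nu> b)"
      by (simp add: sum.reindex inj_on_def weight_def)
    finally show "(\<Sum>h\<in>?H. int (\<nu> h) * ?\<mu> h b) = int (weight \<nu> b)" .
  qed
  finally show ?thesis by (simp add: Q_tilde_def)
qed

end

context cartan_form
begin

lemma y_exp_eq: "real_of_int (y_exp ip a b) = - (ip a b * tt ip b)"
proof -
  have "ip a b * tt ip b \<in> \<int>"
    using ip_int[of a b] by (simp add: tt_def mult.commute)
  then show ?thesis by (simp add: y_exp_def)
qed

text \<open>The matrix of exponents is the Gram matrix with its columns rescaled by \<open>-t\<^sub>b\<close>.\<close>

lemma y_mono_exp_inj:
  assumes nondeg: "\<And>c. (\<And>b. (\<Sum>a\<in>UNIV. c a * ip a b) = 0) \<Longrightarrow> c = (\<lambda>_. 0 :: real)"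
  shows "inj (y_mono_exp ip)"
proof (rule injI)
  fix \<beta> \<beta>' assume eq: "y_mono_exp ip \<beta> = y_mono_exp ip \<beta>'"
  let ?c = "\<lambda>a. real (\<beta> a) - real (\<beta>' a)"
  have exp: "real_of_int (y_mono_exp ip \<gamma> b) = - (\<Sum>a\<in>UNIV. real (\<gamma> a) * ip a b) * tt ip b" for \<gamma> b
    by (simp add: y_mono_exp_def y_exp_eq sum_distrib_right sum_negf mult.assoc)
  have "(\<Sum>a\<in>UNIV. ?c a * ip a b) = 0" for b
  proof -
    have "- (\<Sum>a\<in>UNIV. real (\<beta> a) * ip a b) * tt ip b = - (\<Sum>a\<in>UNIV. real (\<beta>' a) * ip a b) * tt ip b"
      unfolding exp[symmetric] eq ..
    then have "(\<Sum>a\<in>UNIV. real (\<beta> a) * ip a b) = (\<Sum>a\<in>UNIV. real (\<beta>' a) * ip a b)"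
      using tt_pos[of b] by simp
    then show ?thesis
      by (simp add: left_diff_distrib sum_subtractf)
  qed
  then have "?c = (\<lambda>_. 0)" by (rule nondeg)
  then have "real (\<beta> a) - real (\<beta>' a) = 0" for a by (rule fun_cong)
  then show "\<beta> = \<beta>'" by (simp add: fun_eq_iff)
qed

end

theorem corollary5p5:
  fixes scale :: "complex \<Rightarrow> 'g::ab_group_add \<Rightarrow> 'g"
    and bracket :: "'g \<Rightarrow> 'g \<Rightarrow> 'g"
    and \<h> :: "'g set"
    and \<kappa> :: "'g \<Rightarrow> 'g \<Rightarrow> complex"
    and \<alpha> :: "'n::finite \<Rightarrow> 'g \<Rightarrow> complex"
    and ip :: "'n \<Rightarrow> 'n \<Rightarrow> real"
    and Q :: "'n \<times> nat \<Rightarrow> 'n mfps"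
    and \<nu> :: "'n \<times> nat \<Rightarrow> nat"
  assumes "simple_lie_data scale bracket \<h> \<kappa> \<alpha>"
    and "ip = simple_lie_data.root_ip \<h> \<kappa> \<alpha>"
    and "canonical_solution ip Q"
    and "\<nu> \<in> families"
  shows "(Q_tilde Q \<nu> = R_tilde ip \<nu>
      \<and> R_tilde ip \<nu> = K_tilde ip \<nu> / K_tilde ip (\<lambda>_. 0))
    \<and> (Q_x ip Q \<nu> = R_x ip \<nu>
      \<and> R_x ip \<nu> = K_x ip \<nu> \<otimes>\<^bsub>x_ring ip\<^esub> inv\<^bsub>x_ring ip\<^esub> K_x ip (\<lambda>_. 0))"
proof -
  interpret L: simple_lie_data scale bracket \<h> \<kappa> \<alpha> by (rule assms(1))
  have ip: "ip = L.root_ip" by (rule assms(2))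
  interpret q_system ip Q
    unfolding ip using assms(3)[unfolded ip] L.root_ip_sym L.root_ip_pos L.cartan_integer
    by unfold_locales
  interpret y_exponents ip
  proof
    show "inj (y_mono_exp ip)"
    proof (rule y_mono_exp_inj)
      fix c :: "'n \<Rightarrow> real" assume c: "\<And>b. (\<Sum>a\<in>UNIV. c a * ip a b) = 0"
      show "c = (\<lambda>_. 0)"
      proof
        fix a
        show "c a = 0"
          by (rule L.root_ip_nondegenerate) (rule c[unfolded ip])
      qed
    qed
  qed
  let ?K0 = "K_tilde ip (\<lambda>_. 0)"
  have unit: "?K0 * inverse ?K0 = 1"
    by (rule mfps_inverse[OF K_tilde_0_unit])
  have QR: "Q_tilde Q \<nu> = R_tilde ip \<nu>"
    by (rule Q_tilde_eq_R_tilde[OF assms(4)])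
  have RK: "K_tilde ip \<nu> * inverse ?K0 = R_tilde ip \<nu>"
    using Q_tilde_times_K_tilde[OF assms(4)] unit by (simp add: QR mult.assoc)
  have "K_x ip (\<lambda>_. 0) = graded (\<lambda>_. 0) ?K0"
    by (simp add: K_x_def graded_def weight_def)
  then have inv: "inv\<^bsub>x_ring ip\<^esub> K_x ip (\<lambda>_. 0) = graded (\<lambda>_. 0) (inverse ?K0)"
    using graded_inv[OF unit] by simp
  have K\<nu>: "K_x ip \<nu> = graded (\<lambda>a. int (weight \<nu> a)) (K_tilde ip \<nu>)"
    by (simp add: K_x_def graded_def)
  have "K_x ip \<nu> \<otimes>\<^bsub>x_ring ip\<^esub> inv\<^bsub>x_ring ip\<^esub> K_x ip (\<lambda>_. 0) = graded (\<lambda>a. int (weight \<nu> a)) (R_tilde ip \<nu>)"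
    unfolding inv K\<nu> graded_mult RK by simp
  moreover have "R_x ip \<nu> = graded (\<lambda>a. int (weight \<nu> a)) (R_tilde ip \<nu>)"
    by (simp add: R_x_def graded_def)
  moreover have "Q_x ip Q \<nu> = graded (\<lambda>a. int (weight \<nu> a)) (R_tilde ip \<nu>)"
    unfolding Q_x_eq[OF assms(4)] QR ..
  moreover have "K_tilde ip \<nu> / ?K0 = R_tilde ip \<nu>"
    unfolding divide_mfps_def by (rule RK)
  ultimately show ?thesis
    using QR by simp
qed

end
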